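(* Let $(A,\alpha)$ be a monoidal Hom-algebra and $(C,\gamma)$ a monoidal Hom-coalgebra. (1) Let $[(A,\alpha),(C,\gamma)]_\psi$ be a Hom-entwining structure. Then $(A\otimes C,\alpha\otimes\gamma)$ is an $(A,\alpha)$-Hom-bimodule with left Hom-module structure $a(a'\otimes c)=\alpha^{-1}(a)a'\otimes\gamma(c)$ and right Hom-module structure $(a'\otimes c)a=a'\alpha^{-1}(a)_\kappa\otimes\gamma(c^\kappa)$ for all $a,a'\in A$, $c\in C$. Furthermore $(\mathcal{C},\chi)=(A\otimes C,\alpha\otimes\gamma)$ is an $(A,\alpha)$-Hom-coring with comultiplication and counit $$\Delta_{\mathcal{C}}:\mathcal{C}\to\mathcal{C}\otimes_A\mathcal{C},\quad a\otimes c\mapsto(\alpha^{-1}(a)\otimes c_1)\otimes_A(1\otimes c_2),$$ $$\varepsilon_{\mathcal{C}}:\mathcal{C}\to A,\quad a\otimes c\mapsto\alpha(a)\varepsilon(c).$$ (2) If $\mathcal{C}=(A\otimes C,\alpha\otimes\gamma)$ is an $(A,\alpha)$-Hom-coring with left Hom-module structure $a(a'\otimes c)=\alpha^{-1}(a)a'\otimes\gamma(c)$ and with comultiplication $a\otimes c\mapsto(\alpha^{-1}(a)\otimes c_1)\otimes_A(1\otimes c_2)$ and counit $a\otimes c\mapsto\alpha(a)\varepsilon(c)$, then $[(A,\alpha),(C,\gamma)]_\psi$ is a Hom-entwining structure, where $$\psi:C\otimes A\to A\otimes C,\quad c\otimes a\mapsto(1\otimes\gamma^{-1}(c))a.$$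 (3) Let $(\mathcal{C},\chi)=(A\otimes C,\alpha\otimes\gamma)$ be the $(A,\alpha)$-Hom-coring associated to a Hom-entwining structure $[(A,\alpha),(C,\gamma)]_\psi$ as in (1). Then the category of $[(A,\alpha),(C,\gamma)]_\psi$-entwined Hom-modules is isomorphic to the category of right $(\mathcal{C},\chi)$-Hom-comodules.
   Context: $k$ is a commutative ring with unit; unadorned $\otimes$ is over $k$. The category $\widetilde{\mathcal{H}}(\mathcal{M}_k)$ has as objects pairs $(M,\mu)$ with $M$ a $k$-module and $\mu$ a $k$-linear automorphism of $M$; morphisms $(M,\mu)\to(N,\nu)$ are $k$-linear maps $f$ with $\nu\circ f=f\circ\mu$; $(M,\mu)\otimes(N,\nu)=(M\otimes N,\mu\otimes\nu)$. A monoidal Hom-algebra $(A,\alpha)$ is an object of $\widetilde{\mathcal{H}}(\mathcal{M}_k)$ with a $k$-linear multiplication $a\otimes b\mapsto ab$ and an element $1=1_A$ such that $\alpha(a)(bc)=(ab)\alpha(c)$, $a1_A=1_Aa=\alpha(a)$, $\alpha(ab)=\alpha(a)\alpha(b)$, $\alpha(1_A)=1_A$. A monoidal Hom-coalgebra $(C,\gamma)$ is an object of $\widetilde{\mathcal{H}}(\mathcal{M}_k)$ with $k$-linear maps $\Delta:C\to C\otimes C$, $\Delta(c)=c_1\otimes c_2$ (summation understood), and $\varepsilon:C\to k$ such that $\gamma^{-1}(c_1)\otimes\Delta(c_2)=c_{11}\otimes(c_{12}\otimes\gamma^{-1}(c_2))$, $\varepsilon(c_1)c_2=\gamma^{-1}(c)=c_1\varepsilon(c_2)$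 (ordinary scalar multiplication), $\Delta(\gamma(c))=\gamma(c_1)\otimes\gamma(c_2)$, $\varepsilon(\gamma(c))=\varepsilon(c)$. A right $(C,\gamma)$-Hom-comodule is an object $(M,\mu)$ with a $k$-linear map $\rho^M:M\to M\otimes C$, $m\mapsto m_{(0)}\otimes m_{(1)}$, such that $\mu^{-1}(m_{(0)})\otimes\Delta(m_{(1)})=m_{(0)(0)}\otimes(m_{(0)(1)}\otimes\gamma^{-1}(m_{(1)}))$, $m_{(0)}\varepsilon(m_{(1)})=\mu^{-1}(m)$, $\rho^M(\mu(m))=\mu(m_{(0)})\otimes\gamma(m_{(1)})$. A colinear map is a morphism $f$ in $\widetilde{\mathcal{H}}(\mathcal{M}_k)$ with $\rho(f(m))=f(m_{(0)})\otimes m_{(1)}$. A right $(A,\alpha)$-Hom-module is an object $(M,\mu)$ with a $k$-linear map $m\otimes a\mapsto ma$ such that $\mu(m)(ab)=(ma)\alpha(b)$, $m1_A=\mu(m)$, $\mu(ma)=\mu(m)\alpha(a)$. A left one satisfies $\alpha(a)(bm)=(ab)\mu(m)$, $1_Am=\mu(m)$, $\mu(am)=\alpha(a)\mu(m)$. An $(A,\alpha)$-Hom-bimodule is both, with $(am)\alpha(b)=\alpha(a)(mb)$. Linear maps are morphisms in $\widetilde{\mathcal{H}}(\mathcal{M}_k)$ commuting with the actions; bilinear means left and right linear. $(A,\alpha)$ is a Hom-bimodule over itself by multiplication. For a right Hom-module $(M,\mu)$ and a left Hom-module $(N,\nu)$, $M\otimes_AN$ is the quotient of $M\otimes N$ by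 the relations $ma\otimes n=\mu(m)\otimes a\nu^{-1}(n)$, with automorphism $\mu\otimes\nu$; when $M$ (resp. $N$) is a Hom-bimodule it has the left (resp. right) action $a(m\otimes_An)=\alpha^{-1}(a)m\otimes_A\nu(n)$ (resp. $(m\otimes_An)a=\mu(m)\otimes_An\alpha^{-1}(a)$). An $(A,\alpha)$-Hom-coring is an $(A,\alpha)$-Hom-bimodule $(\mathcal{C},\chi)$ with $(A,\alpha)$-bilinear maps $\Delta_{\mathcal{C}}:\mathcal{C}\to\mathcal{C}\otimes_A\mathcal{C}$, $x\mapsto x_1\otimes_Ax_2$, and $\varepsilon_{\mathcal{C}}:\mathcal{C}\to A$, such that $x_1\otimes_A\Delta_{\mathcal{C}}(x_2)=\chi(x_{11})\otimes_A(x_{12}\otimes_A\chi^{-1}(x_2))$, $\varepsilon_{\mathcal{C}}(x_1)x_2=x=x_1\varepsilon_{\mathcal{C}}(x_2)$, $\Delta_{\mathcal{C}}(\chi(x))=\chi(x_1)\otimes_A\chi(x_2)$, $\varepsilon_{\mathcal{C}}(\chi(x))=\alpha(\varepsilon_{\mathcal{C}}(x))$. A right $(\mathcal{C},\chi)$-Hom-comodule is a right $(A,\alpha)$-Hom-module $(M,\mu)$ with a right $(A,\alpha)$-linear map $\rho:M\to M\otimes_A\mathcal{C}$, $m\mapsto m_{(0)}\otimes_Am_{(1)}$, such that $m_{(0)}\otimes_A\Delta_{\mathcal{C}}(m_{(1)})=\mu(m_{(0)(0)})\otimes_A(m_{(0)(1)}\otimes_A\chi^{-1}(m_{(1)}))$,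 $m=m_{(0)}\varepsilon_{\mathcal{C}}(m_{(1)})$, $\rho(\mu(m))=\mu(m_{(0)})\otimes_A\chi(m_{(1)})$; morphisms are the right $(A,\alpha)$-linear maps $f$ with $\rho(f(m))=f(m_{(0)})\otimes_Am_{(1)}$. A (right-right) Hom-entwining structure $[(A,\alpha),(C,\gamma)]_\psi$ consists of a monoidal Hom-algebra $(A,\alpha)$, a monoidal Hom-coalgebra $(C,\gamma)$ and a morphism $\psi:C\otimes A\to A\otimes C$ in $\widetilde{\mathcal{H}}(\mathcal{M}_k)$, written $\psi(c\otimes a)=a_\kappa\otimes c^\kappa$ (summation understood; further letters $\lambda,\dots$ for further applications of $\psi$), such that for all $a,a'\in A$, $c\in C$: $(aa')_\kappa\otimes\gamma(c)^\kappa=a_\kappa a'_\lambda\otimes\gamma(c^{\kappa\lambda})$; $\alpha^{-1}(a_\kappa)\otimes c^\kappa{}_1\otimes c^\kappa{}_2=\alpha^{-1}(a)_{\kappa\lambda}\otimes c_1{}^\lambda\otimes c_2{}^\kappa$; $1_\kappa\otimes c^\kappa=1\otimes c$; $a_\kappa\varepsilon(c^\kappa)=a\varepsilon(c)$. An $[(A,\alpha),(C,\gamma)]_\psi$-entwined Hom-module is an object $(M,\mu)$ that is a right $(A,\alpha)$-Hom-module and a right $(C,\gamma)$-Hom-comodule with $\rho^M(ma)=m_{(0)}\alpha^{-1}(a)_\kappa\otimes\gamma(m_{(1)}{}^\kappa)$ for all $m\in M$, $a\in A$; morphisms are the right $(A,\alpha)$-linear and right $(C,\gamma)$-colinear maps.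 *)

theory Defs
  imports "HOL-Algebra.Module" "HOL-Algebra.AbelCoset"
begin

text \<open>
  Everything is carrier-based: \<open>R\<close> is the commutative ground ring \<open>k\<close>, and \<open>k\<close>-modules are
  \<^locale>\<open>module\<close>s over \<open>R\<close>. The fields \<open>mult\<close> and \<open>one\<close> that the record \<open>module\<close> inherits from
  \<open>ring\<close> are meaningful only for a monoidal Hom-algebra; otherwise they carry no information.
  A \<open>k\<close>-linear map out of \<open>M \<otimes> N\<close> that serves as a multiplication or as an action is given by the
  corresponding \<open>k\<close>-bilinear map on \<open>M \<times> N\<close>.
\<close>

record ('k, 'm) hmod = "('k, 'm) module" +
  aut :: "'m \<Rightarrow> 'm"

record ('k, 'm, 'a) rmod = "('k, 'm) hmod" +
  ract :: "'m \<Rightarrow> 'a \<Rightarrow> 'm"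

record ('k, 'm, 'a) bimod = "('k, 'm, 'a) rmod" +
  lact :: "'a \<Rightarrow> 'm \<Rightarrow> 'm"

definition ainv :: "('k, 'm, 'z) hmod_scheme \<Rightarrow> 'm \<Rightarrow> 'm" where
  "ainv M = inv_into (carrier M) (aut M)"


section \<open>Linear algebra over the ground ring\<close>

definition lin_map :: "('k, 'r) ring_scheme \<Rightarrow> ('k, 'm, 'y) module_scheme \<Rightarrow>
    ('k, 'n, 'z) module_scheme \<Rightarrow> ('m \<Rightarrow> 'n) \<Rightarrow> bool" where
  "lin_map R M N f \<longleftrightarrow> f \<in> carrier M \<rightarrow> carrier N \<and>
    (\<forall>x \<in> carrier M. \<forall>y \<in> carrier M. f (x \<oplus>\<^bsub>M\<^esub> y) = f x \<oplus>\<^bsub>N\<^esub> f y) \<and>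
    (\<forall>s \<in> carrier R. \<forall>x \<in> carrier M. f (s \<odot>\<^bsub>M\<^esub> x) = s \<odot>\<^bsub>N\<^esub> f x)"

definition bilin_map :: "('k, 'r) ring_scheme \<Rightarrow> ('k, 'm, 'x) module_scheme \<Rightarrow>
    ('k, 'n, 'y) module_scheme \<Rightarrow> ('k, 'p, 'z) module_scheme \<Rightarrow> ('m \<Rightarrow> 'n \<Rightarrow> 'p) \<Rightarrow> bool" where
  "bilin_map R M N P f \<longleftrightarrow>
    (\<forall>x \<in> carrier M. lin_map R N P (f x)) \<and> (\<forall>y \<in> carrier N. lin_map R M P (\<lambda>x. f x y))"

definition self_module :: "('k, 'r) ring_scheme \<Rightarrow> ('k, 'k) module" where
  "self_module R = \<lparr>carrier = carrier R, mult = mult R, one = one R, zero = zero R, add = add R,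
     smult = mult R\<rparr>"

definition free_module :: "('k, 'r) ring_scheme \<Rightarrow> 's set \<Rightarrow> ('k, 's \<Rightarrow> 'k) module" where
  "free_module R S =
    \<lparr>carrier = {f. f \<in> UNIV \<rightarrow> carrier R \<and> (\<forall>x. x \<notin> S \<longrightarrow> f x = \<zero>\<^bsub>R\<^esub>) \<and> finite {x. f x \<noteq> \<zero>\<^bsub>R\<^esub>}},
     mult = undefined, one = undefined,
     zero = (\<lambda>_. \<zero>\<^bsub>R\<^esub>), add = (\<lambda>f g x. f x \<oplus>\<^bsub>R\<^esub> g x), smult = (\<lambda>s f x. s \<otimes>\<^bsub>R\<^esub> f x)\<rparr>"

definition single :: "('k, 'r) ring_scheme \<Rightarrow> 's \<Rightarrow> 's \<Rightarrow> 'k" where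
  "single R x = (\<lambda>y. if y = x then \<one>\<^bsub>R\<^esub> else \<zero>\<^bsub>R\<^esub>)"

definition generated_submodule ::
    "('k, 'r) ring_scheme \<Rightarrow> ('k, 'm) module \<Rightarrow> 'm set \<Rightarrow> 'm set" where
  "generated_submodule R M S = \<Inter> {N. submodule N R M \<and> S \<subseteq> N}"

definition quot_module :: "('k, 'm) module \<Rightarrow> 'm set \<Rightarrow> ('k, 'm set) module" where
  "quot_module M N =
    \<lparr>carrier = a_rcosets\<^bsub>M\<^esub> N, mult = undefined, one = undefined,
     zero = N, add = (<+>\<^bsub>M\<^esub>), smult = (\<lambda>s X. \<Union>x\<in>X. N +>\<^bsub>M\<^esub> (s \<odot>\<^bsub>M\<^esub> x))\<rparr>"


section \<open>The tensor product over the ground ring\<close>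

type_synonym ('k, 'm, 'n) tens = "('m \<times> 'n \<Rightarrow> 'k) set"

definition tensor_relations :: "('k, 'r) ring_scheme \<Rightarrow> ('k, 'm, 'y) module_scheme \<Rightarrow>
    ('k, 'n, 'z) module_scheme \<Rightarrow> ('m \<times> 'n \<Rightarrow> 'k) set" where
  "tensor_relations R M N = (let F = free_module R (carrier M \<times> carrier N) in
     {single R (x \<oplus>\<^bsub>M\<^esub> x', y) \<ominus>\<^bsub>F\<^esub> (single R (x, y) \<oplus>\<^bsub>F\<^esub> single R (x', y)) | x x' y.
        x \<in> carrier M \<and> x' \<in> carrier M \<and> y \<in> carrier N} \<union>
     {single R (x, y \<oplus>\<^bsub>N\<^esub> y') \<ominus>\<^bsub>F\<^esub> (single R (x, y) \<oplus>\<^bsub>F\<^esub> single R (x, y')) | x y y'.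
        x \<in> carrier M \<and> y \<in> carrier N \<and> y' \<in> carrier N} \<union>
     {single R (s \<odot>\<^bsub>M\<^esub> x, y) \<ominus>\<^bsub>F\<^esub> s \<odot>\<^bsub>F\<^esub> single R (x, y) | s x y.
        s \<in> carrier R \<and> x \<in> carrier M \<and> y \<in> carrier N} \<union>
     {single R (x, s \<odot>\<^bsub>N\<^esub> y) \<ominus>\<^bsub>F\<^esub> s \<odot>\<^bsub>F\<^esub> single R (x, y) | s x y.
        s \<in> carrier R \<and> x \<in> carrier M \<and> y \<in> carrier N})"

definition tensor_kernel :: "('k, 'r) ring_scheme \<Rightarrow> ('k, 'm, 'y) module_scheme \<Rightarrow>
    ('k, 'n, 'z) module_scheme \<Rightarrow> ('m \<times> 'n \<Rightarrow> 'k) set" where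
  "tensor_kernel R M N =
     generated_submodule R (free_module R (carrier M \<times> carrier N)) (tensor_relations R M N)"

definition tensor_module :: "('k, 'r) ring_scheme \<Rightarrow> ('k, 'm, 'y) module_scheme \<Rightarrow>
    ('k, 'n, 'z) module_scheme \<Rightarrow> ('k, ('k, 'm, 'n) tens) module" where
  "tensor_module R M N =
     quot_module (free_module R (carrier M \<times> carrier N)) (tensor_kernel R M N)"

definition pure :: "('k, 'r) ring_scheme \<Rightarrow> ('k, 'm, 'y) module_scheme \<Rightarrow>
    ('k, 'n, 'z) module_scheme \<Rightarrow> 'm \<Rightarrow> 'n \<Rightarrow> ('k, 'm, 'n) tens" where
  "pure R M N x y =
     tensor_kernel R M N +>\<^bsub>free_module R (carrier M \<times> carrier N)\<^esub> single R (x, y)"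

text \<open>
  \<open>tlift R P f t\<close> is Sweedler's sum: for \<open>t = x\<^sub>1 \<otimes> x\<^sub>2\<close> (summation understood) and a \<open>k\<close>-bilinear
  map \<open>f\<close> into \<open>P\<close>, it is \<open>f x\<^sub>1 x\<^sub>2\<close> (summation understood), i.e. the value at \<open>t\<close> of the linear map
  induced by \<open>f\<close>. All representatives of \<open>t\<close> give the same value when \<open>f\<close> is bilinear.
\<close>

definition linext :: "('k, 'r) ring_scheme \<Rightarrow> ('k, 'p, 'z) module_scheme \<Rightarrow>
    ('s \<Rightarrow> 'p) \<Rightarrow> ('s \<Rightarrow> 'k) \<Rightarrow> 'p" where
  "linext R P f u = (\<Oplus>\<^bsub>P\<^esub>x \<in> {x. u x \<noteq> \<zero>\<^bsub>R\<^esub>}. u x \<odot>\<^bsub>P\<^esub> f x)"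

definition tlift :: "('k, 'r) ring_scheme \<Rightarrow> ('k, 'p, 'z) module_scheme \<Rightarrow>
    ('m \<Rightarrow> 'n \<Rightarrow> 'p) \<Rightarrow> ('k, 'm, 'n) tens \<Rightarrow> 'p" where
  "tlift R P f t = the_elem (linext R P (\<lambda>(x, y). f x y) ` t)"

definition tensor :: "('k, 'r) ring_scheme \<Rightarrow> ('k, 'm, 'y) hmod_scheme \<Rightarrow>
    ('k, 'n, 'z) hmod_scheme \<Rightarrow> ('k, ('k, 'm, 'n) tens) hmod" where
  "tensor R M N = module.extend (tensor_module R M N)
     (hmod.fields (tlift R (tensor_module R M N) (\<lambda>x y. pure R M N (aut M x) (aut N y))))"


section \<open>Monoidal Hom-algebras and Hom-coalgebras\<close>

text \<open>Objects and morphisms of the category of \<open>k\<close>-modules with an automorphism\<close>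

definition hom_object :: "('k, 'r) ring_scheme \<Rightarrow> ('k, 'm, 'z) hmod_scheme \<Rightarrow> bool" where
  "hom_object R M \<longleftrightarrow> module R M \<and> lin_map R M M (aut M) \<and>
     bij_betw (aut M) (carrier M) (carrier M)"

definition hom_morphism :: "('k, 'r) ring_scheme \<Rightarrow> ('k, 'm, 'y) hmod_scheme \<Rightarrow>
    ('k, 'n, 'z) hmod_scheme \<Rightarrow> ('m \<Rightarrow> 'n) \<Rightarrow> bool" where
  "hom_morphism R M N f \<longleftrightarrow> lin_map R M N f \<and> (\<forall>x \<in> carrier M. aut N (f x) = f (aut M x))"

definition hom_algebra :: "('k, 'r) ring_scheme \<Rightarrow> ('k, 'a, 'z) hmod_scheme \<Rightarrow> bool" where
  "hom_algebra R A \<longleftrightarrow> hom_object R A \<and> bilin_map R A A A (mult A) \<and> \<one>\<^bsub>A\<^esub> \<in> carrier A \<and>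
     (\<forall>a \<in> carrier A. \<forall>b \<in> carrier A. \<forall>c \<in> carrier A.
        aut A a \<otimes>\<^bsub>A\<^esub> (b \<otimes>\<^bsub>A\<^esub> c) = (a \<otimes>\<^bsub>A\<^esub> b) \<otimes>\<^bsub>A\<^esub> aut A c) \<and>
     (\<forall>a \<in> carrier A. a \<otimes>\<^bsub>A\<^esub> \<one>\<^bsub>A\<^esub> = aut A a \<and> \<one>\<^bsub>A\<^esub> \<otimes>\<^bsub>A\<^esub> a = aut A a) \<and>
     (\<forall>a \<in> carrier A. \<forall>b \<in> carrier A. aut A (a \<otimes>\<^bsub>A\<^esub> b) = aut A a \<otimes>\<^bsub>A\<^esub> aut A b) \<and>
     aut A \<one>\<^bsub>A\<^esub> = \<one>\<^bsub>A\<^esub>"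

record ('k, 'c) coalg = "('k, 'c) hmod" +
  comult :: "'c \<Rightarrow> ('k, 'c, 'c) tens"
  counit :: "'c \<Rightarrow> 'k"

definition hom_coalgebra :: "('k, 'r) ring_scheme \<Rightarrow> ('k, 'c, 'z) coalg_scheme \<Rightarrow> bool" where
  "hom_coalgebra R C \<longleftrightarrow> hom_object R C \<and>
     lin_map R C (tensor R C C) (comult C) \<and> lin_map R C (self_module R) (counit C) \<and>
     (\<forall>c \<in> carrier C.
        tlift R (tensor R C (tensor R C C))
          (\<lambda>c1 c2. pure R C (tensor R C C) (ainv C c1) (comult C c2)) (comult C c) =
        tlift R (tensor R C (tensor R C C))
          (\<lambda>c1 c2. tlift R (tensor R C (tensor R C C))
             (\<lambda>c11 c12. pure R C (tensor R C C) c11 (pure R C C c12 (ainv C c2)))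
             (comult C c1)) (comult C c)) \<and>
     (\<forall>c \<in> carrier C.
        tlift R C (\<lambda>c1 c2. counit C c1 \<odot>\<^bsub>C\<^esub> c2) (comult C c) = ainv C c \<and>
        tlift R C (\<lambda>c1 c2. counit C c2 \<odot>\<^bsub>C\<^esub> c1) (comult C c) = ainv C c) \<and>
     (\<forall>c \<in> carrier C. comult C (aut C c) =
        tlift R (tensor R C C) (\<lambda>c1 c2. pure R C C (aut C c1) (aut C c2)) (comult C c)) \<and>
     (\<forall>c \<in> carrier C. counit C (aut C c) = counit C c)"

definition hom_comodule :: "('k, 'r) ring_scheme \<Rightarrow> ('k, 'c, 'y) coalg_scheme \<Rightarrow>
    ('k, 'm, 'z) hmod_scheme \<Rightarrow> ('m \<Rightarrow> ('k, 'm, 'c) tens) \<Rightarrow> bool" where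
  "hom_comodule R C M \<rho> \<longleftrightarrow> hom_object R M \<and> lin_map R M (tensor R M C) \<rho> \<and>
     (\<forall>m \<in> carrier M.
        tlift R (tensor R M (tensor R C C))
          (\<lambda>m0 m1. pure R M (tensor R C C) (ainv M m0) (comult C m1)) (\<rho> m) =
        tlift R (tensor R M (tensor R C C))
          (\<lambda>m0 m1. tlift R (tensor R M (tensor R C C))
             (\<lambda>m00 m01. pure R M (tensor R C C) m00 (pure R C C m01 (ainv C m1)))
             (\<rho> m0)) (\<rho> m)) \<and>
     (\<forall>m \<in> carrier M. tlift R M (\<lambda>m0 m1. counit C m1 \<odot>\<^bsub>M\<^esub> m0) (\<rho> m) = ainv M m) \<and>
     (\<forall>m \<in> carrier M. \<rho> (aut M m) =
        tlift R (tensor R M C) (\<lambda>m0 m1. pure R M C (aut M m0) (aut C m1)) (\<rho> m))"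

definition colinear :: "('k, 'r) ring_scheme \<Rightarrow> ('k, 'c, 'x) hmod_scheme \<Rightarrow>
    ('k, 'm, 'y) hmod_scheme \<Rightarrow> ('m \<Rightarrow> ('k, 'm, 'c) tens) \<Rightarrow>
    ('k, 'n, 'z) hmod_scheme \<Rightarrow> ('n \<Rightarrow> ('k, 'n, 'c) tens) \<Rightarrow> ('m \<Rightarrow> 'n) \<Rightarrow> bool" where
  "colinear R C M \<rho> N \<sigma> f \<longleftrightarrow> hom_morphism R M N f \<and>
     (\<forall>m \<in> carrier M.
        \<sigma> (f m) = tlift R (tensor R N C) (\<lambda>m0 m1. pure R N C (f m0) m1) (\<rho> m))"


section \<open>Hom-modules and Hom-bimodules\<close>

definition right_hom_module :: "('k, 'r) ring_scheme \<Rightarrow> ('k, 'a, 'y) hmod_scheme \<Rightarrow>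
    ('k, 'm, 'a, 'z) rmod_scheme \<Rightarrow> bool" where
  "right_hom_module R A M \<longleftrightarrow> hom_object R M \<and> bilin_map R M A M (ract M) \<and>
     (\<forall>m \<in> carrier M. \<forall>a \<in> carrier A. \<forall>b \<in> carrier A.
        ract M (aut M m) (a \<otimes>\<^bsub>A\<^esub> b) = ract M (ract M m a) (aut A b)) \<and>
     (\<forall>m \<in> carrier M. ract M m \<one>\<^bsub>A\<^esub> = aut M m) \<and>
     (\<forall>m \<in> carrier M. \<forall>a \<in> carrier A. aut M (ract M m a) = ract M (aut M m) (aut A a))"

definition left_hom_module :: "('k, 'r) ring_scheme \<Rightarrow> ('k, 'a, 'y) hmod_scheme \<Rightarrow>
    ('k, 'm, 'a, 'z) bimod_scheme \<Rightarrow> bool" where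
  "left_hom_module R A M \<longleftrightarrow> hom_object R M \<and> bilin_map R A M M (lact M) \<and>
     (\<forall>a \<in> carrier A. \<forall>b \<in> carrier A. \<forall>m \<in> carrier M.
        lact M (aut A a) (lact M b m) = lact M (a \<otimes>\<^bsub>A\<^esub> b) (aut M m)) \<and>
     (\<forall>m \<in> carrier M. lact M \<one>\<^bsub>A\<^esub> m = aut M m) \<and>
     (\<forall>a \<in> carrier A. \<forall>m \<in> carrier M. aut M (lact M a m) = lact M (aut A a) (aut M m))"

definition hom_bimodule :: "('k, 'r) ring_scheme \<Rightarrow> ('k, 'a, 'y) hmod_scheme \<Rightarrow>
    ('k, 'm, 'a, 'z) bimod_scheme \<Rightarrow> bool" where
  "hom_bimodule R A M \<longleftrightarrow> left_hom_module R A M \<and> right_hom_module R A M \<and>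
     (\<forall>a \<in> carrier A. \<forall>b \<in> carrier A. \<forall>m \<in> carrier M.
        ract M (lact M a m) (aut A b) = lact M (aut A a) (ract M m b))"

definition right_linear :: "('k, 'r) ring_scheme \<Rightarrow> ('k, 'a, 'x) hmod_scheme \<Rightarrow>
    ('k, 'm, 'a, 'y) rmod_scheme \<Rightarrow> ('k, 'n, 'a, 'z) rmod_scheme \<Rightarrow> ('m \<Rightarrow> 'n) \<Rightarrow> bool" where
  "right_linear R A M N f \<longleftrightarrow> hom_morphism R M N f \<and>
     (\<forall>m \<in> carrier M. \<forall>a \<in> carrier A. f (ract M m a) = ract N (f m) a)"

definition left_linear :: "('k, 'r) ring_scheme \<Rightarrow> ('k, 'a, 'x) hmod_scheme \<Rightarrow>
    ('k, 'm, 'a, 'y) bimod_scheme \<Rightarrow> ('k, 'n, 'a, 'z) bimod_scheme \<Rightarrow> ('m \<Rightarrow> 'n) \<Rightarrow> bool" where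
  "left_linear R A M N f \<longleftrightarrow> hom_morphism R M N f \<and>
     (\<forall>m \<in> carrier M. \<forall>a \<in> carrier A. f (lact M a m) = lact N a (f m))"

definition bilinear :: "('k, 'r) ring_scheme \<Rightarrow> ('k, 'a, 'x) hmod_scheme \<Rightarrow>
    ('k, 'm, 'a, 'y) bimod_scheme \<Rightarrow> ('k, 'n, 'a, 'z) bimod_scheme \<Rightarrow> ('m \<Rightarrow> 'n) \<Rightarrow> bool" where
  "bilinear R A M N f \<longleftrightarrow> left_linear R A M N f \<and> right_linear R A M N f"

definition regular_bimod :: "('k, 'a, 'z) hmod_scheme \<Rightarrow> ('k, 'a, 'a) bimod" where
  "regular_bimod A = hmod.extend (hmod.truncate A) \<lparr>ract = mult A, lact = mult A\<rparr>"


section \<open>The tensor product over a monoidal Hom-algebra\<close>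

type_synonym ('k, 'm, 'n) tensA = "('k, 'm, 'n) tens set"

definition tensorA_kernel :: "('k, 'r) ring_scheme \<Rightarrow> ('k, 'a, 'x) hmod_scheme \<Rightarrow>
    ('k, 'm, 'a, 'y) rmod_scheme \<Rightarrow> ('k, 'n, 'a, 'z) bimod_scheme \<Rightarrow> ('k, 'm, 'n) tensA" where
  "tensorA_kernel R A M N = generated_submodule R (tensor_module R M N)
     {pure R M N (ract M m a) n \<ominus>\<^bsub>tensor_module R M N\<^esub> pure R M N (aut M m) (lact N a (ainv N n)) |
        m a n. m \<in> carrier M \<and> a \<in> carrier A \<and> n \<in> carrier N}"

definition tensorA_module :: "('k, 'r) ring_scheme \<Rightarrow> ('k, 'a, 'x) hmod_scheme \<Rightarrow>
    ('k, 'm, 'a, 'y) rmod_scheme \<Rightarrow> ('k, 'n, 'a, 'z) bimod_scheme \<Rightarrow>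
    ('k, ('k, 'm, 'n) tensA) module" where
  "tensorA_module R A M N = quot_module (tensor_module R M N) (tensorA_kernel R A M N)"

definition pureA :: "('k, 'r) ring_scheme \<Rightarrow> ('k, 'a, 'x) hmod_scheme \<Rightarrow>
    ('k, 'm, 'a, 'y) rmod_scheme \<Rightarrow> ('k, 'n, 'a, 'z) bimod_scheme \<Rightarrow>
    'm \<Rightarrow> 'n \<Rightarrow> ('k, 'm, 'n) tensA" where
  "pureA R A M N m n = tensorA_kernel R A M N +>\<^bsub>tensor_module R M N\<^esub> pure R M N m n"

text \<open>The analogue of \<open>tlift\<close> for \<open>t = m \<otimes>\<^sub>A n\<close> and \<open>A\<close>-balanced \<open>f\<close>\<close>

definition tliftA :: "('k, 'r) ring_scheme \<Rightarrow> ('k, 'p, 'z) module_scheme \<Rightarrow>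
    ('m \<Rightarrow> 'n \<Rightarrow> 'p) \<Rightarrow> ('k, 'm, 'n) tensA \<Rightarrow> 'p" where
  "tliftA R P f t = the_elem (tlift R P f ` t)"

text \<open>
  \<open>tensorA\<close> is the right Hom-module \<open>M \<otimes>\<^sub>A N\<close> for a right Hom-module \<open>M\<close> and a Hom-bimodule \<open>N\<close>;
  \<open>tensorAA\<close> adds the left action when \<open>M\<close> is a Hom-bimodule, too.
\<close>

definition tensorA :: "('k, 'r) ring_scheme \<Rightarrow> ('k, 'a, 'x) hmod_scheme \<Rightarrow>
    ('k, 'm, 'a, 'y) rmod_scheme \<Rightarrow> ('k, 'n, 'a, 'z) bimod_scheme \<Rightarrow>
    ('k, ('k, 'm, 'n) tensA, 'a) rmod" where
  "tensorA R A M N = (let T = tensorA_module R A M N in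
     hmod.extend
       (module.extend T (hmod.fields (tliftA R T (\<lambda>m n. pureA R A M N (aut M m) (aut N n)))))
       (rmod.fields (\<lambda>t a. tliftA R T (\<lambda>m n. pureA R A M N (aut M m) (ract N n (ainv A a))) t)))"

definition tensorAA :: "('k, 'r) ring_scheme \<Rightarrow> ('k, 'a, 'x) hmod_scheme \<Rightarrow>
    ('k, 'm, 'a, 'y) bimod_scheme \<Rightarrow> ('k, 'n, 'a, 'z) bimod_scheme \<Rightarrow>
    ('k, ('k, 'm, 'n) tensA, 'a) bimod" where
  "tensorAA R A M N = rmod.extend (tensorA R A M N)
     (bimod.fields (\<lambda>a t. tliftA R (tensorA_module R A M N)
        (\<lambda>m n. pureA R A M N (lact M (ainv A a) m) (aut N n)) t))"


section \<open>Hom-corings and their comodules\<close>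

record ('k, 'x, 'a) coring = "('k, 'x, 'a) bimod" +
  ccomult :: "'x \<Rightarrow> ('k, 'x, 'x) tensA"
  ccounit :: "'x \<Rightarrow> 'a"

definition hom_coring :: "('k, 'r) ring_scheme \<Rightarrow> ('k, 'a, 'y) hmod_scheme \<Rightarrow>
    ('k, 'x, 'a, 'z) coring_scheme \<Rightarrow> bool" where
  "hom_coring R A D \<longleftrightarrow> (let DD = tensorAA R A D D; DDD = tensorA R A D DD in
     hom_bimodule R A D \<and>
     bilinear R A D DD (ccomult D) \<and>
     bilinear R A D (regular_bimod A) (ccounit D) \<and>
     (\<forall>x \<in> carrier D.
        tliftA R DDD (\<lambda>x1 x2. pureA R A D DD x1 (ccomult D x2)) (ccomult D x) =
        tliftA R DDD (\<lambda>x1 x2. tliftA R DDD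
          (\<lambda>x11 x12. pureA R A D DD (aut D x11) (pureA R A D D x12 (ainv D x2)))
          (ccomult D x1)) (ccomult D x)) \<and>
     (\<forall>x \<in> carrier D.
        tliftA R D (\<lambda>x1 x2. lact D (ccounit D x1) x2) (ccomult D x) = x \<and>
        tliftA R D (\<lambda>x1 x2. ract D x1 (ccounit D x2)) (ccomult D x) = x) \<and>
     (\<forall>x \<in> carrier D. ccomult D (aut D x) =
        tliftA R DD (\<lambda>x1 x2. pureA R A D D (aut D x1) (aut D x2)) (ccomult D x)) \<and>
     (\<forall>x \<in> carrier D. ccounit D (aut D x) = aut A (ccounit D x)))"

definition coring_comodule :: "('k, 'r) ring_scheme \<Rightarrow> ('k, 'a, 'w) hmod_scheme \<Rightarrow>
    ('k, 'x, 'a, 'y) coring_scheme \<Rightarrow> ('k, 'm, 'a, 'z) rmod_scheme \<Rightarrow>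
    ('m \<Rightarrow> ('k, 'm, 'x) tensA) \<Rightarrow> bool" where
  "coring_comodule R A D M \<rho> \<longleftrightarrow> (let DD = tensorAA R A D D; MDD = tensorA R A M DD in
     right_hom_module R A M \<and> right_linear R A M (tensorA R A M D) \<rho> \<and>
     (\<forall>m \<in> carrier M.
        tliftA R MDD (\<lambda>m0 m1. pureA R A M DD m0 (ccomult D m1)) (\<rho> m) =
        tliftA R MDD (\<lambda>m0 m1. tliftA R MDD
          (\<lambda>m00 m01. pureA R A M DD (aut M m00) (pureA R A D D m01 (ainv D m1)))
          (\<rho> m0)) (\<rho> m)) \<and>
     (\<forall>m \<in> carrier M. tliftA R M (\<lambda>m0 m1. ract M m0 (ccounit D m1)) (\<rho> m) = m) \<and>
     (\<forall>m \<in> carrier M. \<rho> (aut M m) =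
        tliftA R (tensorA R A M D) (\<lambda>m0 m1. pureA R A M D (aut M m0) (aut D m1)) (\<rho> m)))"

definition coring_comodule_morphism :: "('k, 'r) ring_scheme \<Rightarrow> ('k, 'a, 'w) hmod_scheme \<Rightarrow>
    ('k, 'x, 'a, 'v) bimod_scheme \<Rightarrow>
    ('k, 'm, 'a, 'y) rmod_scheme \<Rightarrow> ('m \<Rightarrow> ('k, 'm, 'x) tensA) \<Rightarrow>
    ('k, 'n, 'a, 'z) rmod_scheme \<Rightarrow> ('n \<Rightarrow> ('k, 'n, 'x) tensA) \<Rightarrow> ('m \<Rightarrow> 'n) \<Rightarrow> bool" where
  "coring_comodule_morphism R A D M \<rho> N \<sigma> f \<longleftrightarrow> right_linear R A M N f \<and>
     (\<forall>m \<in> carrier M.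
        \<sigma> (f m) = tliftA R (tensorA R A N D) (\<lambda>m0 m1. pureA R A N D (f m0) m1) (\<rho> m))"


section \<open>Hom-entwining structures and entwined Hom-modules\<close>

text \<open>
  In the conditions below, \<open>a\<^sub>\<kappa> \<otimes> c\<^sup>\<kappa>\<close> is written \<open>b \<otimes> d\<close>, and \<open>b' \<otimes> d'\<close> is the result of the
  second application of \<open>\<psi>\<close>.
\<close>

definition hom_entwining :: "('k, 'r) ring_scheme \<Rightarrow> ('k, 'a, 'y) hmod_scheme \<Rightarrow>
    ('k, 'c, 'z) coalg_scheme \<Rightarrow> (('k, 'c, 'a) tens \<Rightarrow> ('k, 'a, 'c) tens) \<Rightarrow> bool" where
  "hom_entwining R A C \<psi> \<longleftrightarrow> hom_algebra R A \<and> hom_coalgebra R C \<and>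
     hom_morphism R (tensor R C A) (tensor R A C) \<psi> \<and>
     (\<forall>a \<in> carrier A. \<forall>a' \<in> carrier A. \<forall>c \<in> carrier C.
        \<psi> (pure R C A (aut C c) (a \<otimes>\<^bsub>A\<^esub> a')) =
        tlift R (tensor R A C)
          (\<lambda>b d. tlift R (tensor R A C)
             (\<lambda>b' d'. pure R A C (b \<otimes>\<^bsub>A\<^esub> b') (aut C d'))
             (\<psi> (pure R C A d a')))
          (\<psi> (pure R C A c a))) \<and>
     (\<forall>a \<in> carrier A. \<forall>c \<in> carrier C.
        tlift R (tensor R A (tensor R C C))
          (\<lambda>b d. pure R A (tensor R C C) (ainv A b) (comult C d))
          (\<psi> (pure R C A c a)) =
        tlift R (tensor R A (tensor R C C))
          (\<lambda>c1 c2. tlift R (tensor R A (tensor R C C))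
             (\<lambda>b d. tlift R (tensor R A (tensor R C C))
                (\<lambda>b' d'. pure R A (tensor R C C) b' (pure R C C d' d))
                (\<psi> (pure R C A c1 b)))
             (\<psi> (pure R C A c2 (ainv A a))))
          (comult C c)) \<and>
     (\<forall>c \<in> carrier C. \<psi> (pure R C A c \<one>\<^bsub>A\<^esub>) = pure R A C \<one>\<^bsub>A\<^esub> c) \<and>
     (\<forall>a \<in> carrier A. \<forall>c \<in> carrier C.
        tlift R A (\<lambda>b d. counit C d \<odot>\<^bsub>A\<^esub> b) (\<psi> (pure R C A c a)) = counit C c \<odot>\<^bsub>A\<^esub> a)"

definition entwined_module :: "('k, 'r) ring_scheme \<Rightarrow> ('k, 'a, 'x) hmod_scheme \<Rightarrow>
    ('k, 'c, 'y) coalg_scheme \<Rightarrow> (('k, 'c, 'a) tens \<Rightarrow> ('k, 'a, 'c) tens) \<Rightarrow>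
    ('k, 'm, 'a, 'z) rmod_scheme \<Rightarrow> ('m \<Rightarrow> ('k, 'm, 'c) tens) \<Rightarrow> bool" where
  "entwined_module R A C \<psi> M \<rho> \<longleftrightarrow> right_hom_module R A M \<and> hom_comodule R C M \<rho> \<and>
     (\<forall>m \<in> carrier M. \<forall>a \<in> carrier A.
        \<rho> (ract M m a) =
        tlift R (tensor R M C)
          (\<lambda>m0 m1. tlift R (tensor R M C)
             (\<lambda>b d. pure R M C (ract M m0 b) (aut C d))
             (\<psi> (pure R C A m1 (ainv A a))))
          (\<rho> m))"


section \<open>The coring \<open>A \<otimes> C\<close>\<close>

text \<open>
  \<open>AC_coring R A C r\<close> is \<open>(A \<otimes> C, \<alpha> \<otimes> \<gamma>)\<close> with right action \<open>r\<close>, left action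
  \<open>a(a' \<otimes> c) = \<alpha>\<^sup>-\<^sup>1(a)a' \<otimes> \<gamma>(c)\<close>, comultiplication
  \<open>a \<otimes> c \<mapsto> (\<alpha>\<^sup>-\<^sup>1(a) \<otimes> c\<^sub>1) \<otimes>\<^sub>A (1 \<otimes> c\<^sub>2)\<close> and counit \<open>a \<otimes> c \<mapsto> \<alpha>(a)\<epsilon>(c)\<close>.
\<close>

definition AC_bimod :: "('k, 'r) ring_scheme \<Rightarrow> ('k, 'a, 'y) hmod_scheme \<Rightarrow>
    ('k, 'c, 'z) coalg_scheme \<Rightarrow> (('k, 'a, 'c) tens \<Rightarrow> 'a \<Rightarrow> ('k, 'a, 'c) tens) \<Rightarrow>
    ('k, ('k, 'a, 'c) tens, 'a) bimod" where
  "AC_bimod R A C r = hmod.extend (tensor R A C)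
     \<lparr>ract = r,
      lact = (\<lambda>a. tlift R (tensor R A C)
        (\<lambda>a' c. pure R A C (ainv A a \<otimes>\<^bsub>A\<^esub> a') (aut C c)))\<rparr>"

definition AC_coring :: "('k, 'r) ring_scheme \<Rightarrow> ('k, 'a, 'y) hmod_scheme \<Rightarrow>
    ('k, 'c, 'z) coalg_scheme \<Rightarrow> (('k, 'a, 'c) tens \<Rightarrow> 'a \<Rightarrow> ('k, 'a, 'c) tens) \<Rightarrow>
    ('k, ('k, 'a, 'c) tens, 'a) coring" where
  "AC_coring R A C r = (let B = AC_bimod R A C r in
     bimod.extend B
       \<lparr>ccomult = tlift R (tensorAA R A B B) (\<lambda>a c.
          tlift R (tensorAA R A B B)
            (\<lambda>c1 c2. pureA R A B B (pure R A C (ainv A a) c1) (pure R A C \<one>\<^bsub>A\<^esub> c2))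
            (comult C c)),
        ccounit = tlift R A (\<lambda>a c. counit C c \<odot>\<^bsub>A\<^esub> aut A a)\<rparr>)"

definition entwining_ract :: "('k, 'r) ring_scheme \<Rightarrow> ('k, 'a, 'y) hmod_scheme \<Rightarrow>
    ('k, 'c, 'z) hmod_scheme \<Rightarrow> (('k, 'c, 'a) tens \<Rightarrow> ('k, 'a, 'c) tens) \<Rightarrow>
    ('k, 'a, 'c) tens \<Rightarrow> 'a \<Rightarrow> ('k, 'a, 'c) tens" where
  "entwining_ract R A C \<psi> t a = tlift R (tensor R A C)
     (\<lambda>a' c. tlift R (tensor R A C)
        (\<lambda>b d. pure R A C (a' \<otimes>\<^bsub>A\<^esub> b) (aut C d)) (\<psi> (pure R C A c (ainv A a)))) t"

definition coring_psi :: "('k, 'r) ring_scheme \<Rightarrow> ('k, 'a, 'y) hmod_scheme \<Rightarrow>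
    ('k, 'c, 'z) hmod_scheme \<Rightarrow> (('k, 'a, 'c) tens \<Rightarrow> 'a \<Rightarrow> ('k, 'a, 'c) tens) \<Rightarrow>
    ('k, 'c, 'a) tens \<Rightarrow> ('k, 'a, 'c) tens" where
  "coring_psi R A C r =
     tlift R (tensor R A C) (\<lambda>c a. r (pure R A C \<one>\<^bsub>A\<^esub> (ainv C c)) a)"


section \<open>Categories\<close>

text \<open>Hom-sets need not be disjoint, so composition takes the three objects as arguments.\<close>

record ('o, 'f) cat =
  Obj :: "'o set"
  Hom :: "'o \<Rightarrow> 'o \<Rightarrow> 'f set"
  Idn :: "'o \<Rightarrow> 'f"
  Cmp :: "'o \<Rightarrow> 'o \<Rightarrow> 'o \<Rightarrow> 'f \<Rightarrow> 'f \<Rightarrow> 'f"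

definition is_category :: "('o, 'f) cat \<Rightarrow> bool" where
  "is_category K \<longleftrightarrow>
     (\<forall>X \<in> Obj K. Idn K X \<in> Hom K X X) \<and>
     (\<forall>X \<in> Obj K. \<forall>Y \<in> Obj K. \<forall>Z \<in> Obj K. \<forall>f \<in> Hom K X Y. \<forall>g \<in> Hom K Y Z.
        Cmp K X Y Z g f \<in> Hom K X Z) \<and>
     (\<forall>X \<in> Obj K. \<forall>Y \<in> Obj K. \<forall>f \<in> Hom K X Y.
        Cmp K X X Y f (Idn K X) = f \<and> Cmp K X Y Y (Idn K Y) f = f) \<and>
     (\<forall>W \<in> Obj K. \<forall>X \<in> Obj K. \<forall>Y \<in> Obj K. \<forall>Z \<in> Obj K.
        \<forall>f \<in> Hom K W X. \<forall>g \<in> Hom K X Y. \<forall>h \<in> Hom K Y Z.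
        Cmp K W X Z (Cmp K X Y Z h g) f = Cmp K W Y Z h (Cmp K W X Y g f))"

definition is_functor :: "('o, 'f) cat \<Rightarrow> ('p, 'g) cat \<Rightarrow> ('o \<Rightarrow> 'p) \<Rightarrow>
    ('o \<Rightarrow> 'o \<Rightarrow> 'f \<Rightarrow> 'g) \<Rightarrow> bool" where
  "is_functor K L F \<Phi> \<longleftrightarrow> F \<in> Obj K \<rightarrow> Obj L \<and>
     (\<forall>X \<in> Obj K. \<forall>Y \<in> Obj K. \<Phi> X Y \<in> Hom K X Y \<rightarrow> Hom L (F X) (F Y)) \<and>
     (\<forall>X \<in> Obj K. \<Phi> X X (Idn K X) = Idn L (F X)) \<and>
     (\<forall>X \<in> Obj K. \<forall>Y \<in> Obj K. \<forall>Z \<in> Obj K. \<forall>f \<in> Hom K X Y. \<forall>g \<in> Hom K Y Z.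
        \<Phi> X Z (Cmp K X Y Z g f) = Cmp L (F X) (F Y) (F Z) (\<Phi> Y Z g) (\<Phi> X Y f))"

definition isomorphic_categories :: "('o, 'f) cat \<Rightarrow> ('p, 'g) cat \<Rightarrow> bool" where
  "isomorphic_categories K L \<longleftrightarrow> is_category K \<and> is_category L \<and>
     (\<exists>F \<Phi> G \<Psi>. is_functor K L F \<Phi> \<and> is_functor L K G \<Psi> \<and>
        (\<forall>X \<in> Obj K. G (F X) = X) \<and> (\<forall>X \<in> Obj L. F (G X) = X) \<and>
        (\<forall>X \<in> Obj K. \<forall>Y \<in> Obj K. \<forall>f \<in> Hom K X Y. \<Psi> (F X) (F Y) (\<Phi> X Y f) = f) \<and>
        (\<forall>X \<in> Obj L. \<forall>Y \<in> Obj L. \<forall>f \<in> Hom L X Y. \<Phi> (G X) (G Y) (\<Psi> X Y f) = f))"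

text \<open>
  \<open>normal_rmod\<close> fixes the values of the structure maps outside the carriers and of the two idle
  fields \<open>mult\<close> and \<open>one\<close>. An object of the categories below is thereby determined by its carrier
  and its structure on the carrier, and a morphism by its values on the carrier, so that equality
  of objects and of morphisms has its usual meaning. All underlying sets are sets of elements of the type \<open>'m\<close>.
\<close>

definition normal_rmod :: "('k, 'r) ring_scheme \<Rightarrow> ('k, 'a, 'y) hmod_scheme \<Rightarrow>
    ('k, 'm, 'a) rmod \<Rightarrow> bool" where
  "normal_rmod R A M \<longleftrightarrow> mult M = undefined \<and> one M = undefined \<and>
     (\<forall>x y. \<not> (x \<in> carrier M \<and> y \<in> carrier M) \<longrightarrow> x \<oplus>\<^bsub>M\<^esub> y = undefined) \<and>
     (\<forall>s x. \<not> (s \<in> carrier R \<and> x \<in> carrier M) \<longrightarrow> s \<odot>\<^bsub>M\<^esub> x = undefined) \<and>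
     aut M \<in> extensional (carrier M) \<and>
     (\<forall>x a. \<not> (x \<in> carrier M \<and> a \<in> carrier A) \<longrightarrow> ract M x a = undefined)"

definition entwined_category :: "('k, 'r) ring_scheme \<Rightarrow> ('k, 'a, 'y) hmod_scheme \<Rightarrow>
    ('k, 'c, 'z) coalg_scheme \<Rightarrow> (('k, 'c, 'a) tens \<Rightarrow> ('k, 'a, 'c) tens) \<Rightarrow>
    (('k, 'm, 'a) rmod \<times> ('m \<Rightarrow> ('k, 'm, 'c) tens), 'm \<Rightarrow> 'm) cat" where
  "entwined_category R A C \<psi> =
     \<lparr>Obj = {(M, \<rho>). normal_rmod R A M \<and> \<rho> \<in> extensional (carrier M) \<and>
        entwined_module R A C \<psi> M \<rho>},
      Hom = (\<lambda>(M, \<rho>) (N, \<sigma>). {f \<in> extensional (carrier M).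
        right_linear R A M N f \<and> colinear R C M \<rho> N \<sigma> f}),
      Idn = (\<lambda>(M, \<rho>). restrict id (carrier M)),
      Cmp = (\<lambda>(M, \<rho>) _ _ g f. compose (carrier M) g f)\<rparr>"

definition coring_comodule_category :: "('k, 'r) ring_scheme \<Rightarrow> ('k, 'a, 'y) hmod_scheme \<Rightarrow>
    ('k, 'x, 'a, 'z) coring_scheme \<Rightarrow>
    (('k, 'm, 'a) rmod \<times> ('m \<Rightarrow> ('k, 'm, 'x) tensA), 'm \<Rightarrow> 'm) cat" where
  "coring_comodule_category R A D =
     \<lparr>Obj = {(M, \<rho>). normal_rmod R A M \<and> \<rho> \<in> extensional (carrier M) \<and>
        coring_comodule R A D M \<rho>},
      Hom = (\<lambda>(M, \<rho>) (N, \<sigma>). {f \<in> extensional (carrier M).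
        coring_comodule_morphism R A D M \<rho> N \<sigma> f}),
      Idn = (\<lambda>(M, \<rho>). restrict id (carrier M)),
      Cmp = (\<lambda>(M, \<rho>) _ _ g f. compose (carrier M) g f)\<rparr>"

end

theory Submission
  imports Defs
begin

text \<open>
  All three parts rest on one isomorphism. In \<open>A \<otimes> C\<close> one has \<open>a \<otimes> c = a(1 \<otimes> \<gamma>\<^sup>-\<^sup>1(c))\<close>, so in
  \<open>M \<otimes>\<^sub>A (A \<otimes> C)\<close> the factor \<open>a\<close> can be moved to \<open>M\<close>. Hence
  \<open>\<theta> : M \<otimes> C \<rightarrow> M \<otimes>\<^sub>A (A \<otimes> C)\<close>, \<open>m \<otimes> c \<mapsto> m \<otimes>\<^sub>A (1 \<otimes> \<gamma>\<^sup>-\<^sup>1(c))\<close>, is bijective, with inverse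
  \<open>m \<otimes>\<^sub>A (a \<otimes> c) \<mapsto> \<mu>\<^sup>-\<^sup>1(m)a \<otimes> \<gamma>(c)\<close>. Let \<open>\<rho> : M \<rightarrow> M \<otimes> C\<close> be linear and \<open>\<sigma> = \<theta> \<circ> \<rho>\<close>. Under \<open>\<theta>\<close>
  the right action of \<open>A\<close> on \<open>M \<otimes>\<^sub>A (A \<otimes> C)\<close> becomes
  \<open>(m \<otimes> c)a = m \<alpha>\<^sup>-\<^sup>1(a)\<^sub>\<kappa> \<otimes> \<gamma>(c\<^sup>\<kappa>)\<close>, so \<open>\<sigma>\<close> is right linear iff \<open>\<rho>\<close> is equivariant and satisfies the
  compatibility condition of entwined modules. The counit laws of \<open>\<sigma>\<close> and \<open>\<rho>\<close> differ by the
  application of \<open>\<mu>\<close>, and the coassociativity law of \<open>\<sigma>\<close> is the image of that of \<open>\<rho>\<close> under an injective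
  map \<open>M \<otimes> (C \<otimes> C) \<rightarrow> M \<otimes>\<^sub>A ((A \<otimes> C) \<otimes>\<^sub>A (A \<otimes> C))\<close>. This equivalence is \<open>coring_comodule_iff\<close>;
  it assumes only that \<open>A \<otimes> C\<close> is a Hom-bimodule whose right action has the form given by \<open>\<psi>\<close>.

  Part 3 follows, since \<open>\<theta>\<close> is natural in \<open>M\<close>: the two functors change neither the
  underlying Hom-modules nor the maps between them.

  For part 1, the bimodule axioms for \<open>A \<otimes> C\<close> come from the laws for \<open>\<psi>\<close> on products and on \<open>1\<close>. The
  comultiplication is \<open>\<theta>\<close> after the coaction \<open>a \<otimes> c \<mapsto> (\<alpha>\<^sup>-\<^sup>1(a) \<otimes> c\<^sub>1) \<otimes> \<gamma>(c\<^sub>2)\<close>, and the law for \<open>\<psi>\<close> and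
  \<open>\<Delta>\<close> makes \<open>A \<otimes> C\<close> with this coaction an entwined module, so that right linearity of the
  comultiplication, coassociativity and the right counit law are the comodule axioms of \<open>A \<otimes> C\<close> over
  itself. The axioms that remain are left linearity, the left counit law and bilinearity of the
  counit.

  Part 2 reads these equivalences backwards. The bimodule axioms determine the right action from its
  values on \<open>1 \<otimes> c\<close>, that is, from \<open>\<psi>\<close>; associativity and the unit law at \<open>1 \<otimes> c\<close> give two of the laws for
  \<open>\<psi>\<close>, right linearity of \<open>\<Delta>\<close> and of \<open>\<epsilon>\<close> at \<open>1 \<otimes> c\<close> the other two.

  The identities themselves are checked on pure tensors by the simplifier, in a calculus of
  Sweedler sums: a sum inside a linear operation is pulled outwards, and expressions in the
  Hom-associative operations are brought to a normal form.
\<close>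

section \<open>Linear maps\<close>

lemma lin_mapI:
  assumes "\<And>x. x \<in> carrier M \<Longrightarrow> f x \<in> carrier N"
    and "\<And>x y. x \<in> carrier M \<Longrightarrow> y \<in> carrier M \<Longrightarrow> f (x \<oplus>\<^bsub>M\<^esub> y) = f x \<oplus>\<^bsub>N\<^esub> f y"
    and "\<And>s x. s \<in> carrier R \<Longrightarrow> x \<in> carrier M \<Longrightarrow> f (s \<odot>\<^bsub>M\<^esub> x) = s \<odot>\<^bsub>N\<^esub> f x"
  shows "lin_map R M N f"
  using assms by (auto simp: lin_map_def)

lemma lin_map_closed: "lin_map R M N f \<Longrightarrow> x \<in> carrier M \<Longrightarrow> f x \<in> carrier N"
  and lin_map_add: "lin_map R M N f \<Longrightarrow> x \<in> carrier M \<Longrightarrow> y \<in> carrier M \<Longrightarrow> f (x \<oplus>\<^bsub>M\<^esub> y) = f x \<oplus>\<^bsub>N\<^esub> f y"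
  and lin_map_smult: "lin_map R M N f \<Longrightarrow> s \<in> carrier R \<Longrightarrow> x \<in> carrier M \<Longrightarrow> f (s \<odot>\<^bsub>M\<^esub> x) = s \<odot>\<^bsub>N\<^esub> f x"
  by (auto simp: lin_map_def)

lemma module_cring: "module R M \<Longrightarrow> cring R"
  by (simp add: module_def)

lemma lin_map_zero:
  assumes "lin_map R M N f" "module R M" "module R N"
  shows "f \<zero>\<^bsub>M\<^esub> = \<zero>\<^bsub>N\<^esub>"
proof -
  interpret M: module R M by fact
  interpret N: module R N by fact
  have "f (\<zero>\<^bsub>R\<^esub> \<odot>\<^bsub>M\<^esub> \<zero>\<^bsub>M\<^esub>) = \<zero>\<^bsub>R\<^esub> \<odot>\<^bsub>N\<^esub> f \<zero>\<^bsub>M\<^esub>"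
    using assms(1) by (intro lin_map_smult) auto
  thus ?thesis using lin_map_closed[OF assms(1), of "\<zero>\<^bsub>M\<^esub>"] by simp
qed

lemma lin_map_minus:
  assumes "lin_map R M N f" "module R M" "module R N" "x \<in> carrier M"
  shows "f (\<ominus>\<^bsub>M\<^esub> x) = \<ominus>\<^bsub>N\<^esub> f x"
proof -
  interpret M: module R M by fact
  interpret N: module R N by fact
  have "f (\<ominus>\<^bsub>M\<^esub> x) \<oplus>\<^bsub>N\<^esub> f x = f (\<ominus>\<^bsub>M\<^esub> x \<oplus>\<^bsub>M\<^esub> x)"
    using assms by (subst lin_map_add[OF assms(1)]) auto
  also have "\<dots> = \<zero>\<^bsub>N\<^esub>"
    using assms lin_map_zero by (simp add: M.M.l_neg)
  finally show ?thesis
    using assms(4) lin_map_closed[OF assms(1)] by (simp add: N.M.minus_equality)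
qed

lemma lin_map_id: "lin_map R M M (\<lambda>x. x)"
  by (auto simp: lin_map_def)

lemma lin_map_comp: "lin_map R N P f \<Longrightarrow> lin_map R M N g \<Longrightarrow> lin_map R M P (\<lambda>x. f (g x))"
  by (auto simp: lin_map_def Pi_iff)

lemma lin_map_sum:
  assumes "lin_map R M N f" "lin_map R M N g" "module R M" "module R N"
  shows "lin_map R M N (\<lambda>x. f x \<oplus>\<^bsub>N\<^esub> g x)"
proof -
  interpret M: module R M by fact
  interpret N: module R N by fact
  note c = lin_map_closed[OF assms(1)] lin_map_closed[OF assms(2)]
  show ?thesis
  proof (rule lin_mapI)
    fix x y assume "x \<in> carrier M" "y \<in> carrier M"
    thus "f (x \<oplus>\<^bsub>M\<^esub> y) \<oplus>\<^bsub>N\<^esub> g (x \<oplus>\<^bsub>M\<^esub> y) = f x \<oplus>\<^bsub>N\<^esub> g x \<oplus>\<^bsub>N\<^esub> (f y \<oplus>\<^bsub>N\<^esub> g y)"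
      by (simp add: c lin_map_add[OF assms(1)] lin_map_add[OF assms(2)] N.a_ac)
  qed (auto simp: c lin_map_smult[OF assms(1)] lin_map_smult[OF assms(2)] N.smult_r_distr)
qed

lemma lin_map_scale:
  assumes "lin_map R M N f" "s \<in> carrier R" "module R M" "module R N"
  shows "lin_map R M N (\<lambda>x. s \<odot>\<^bsub>N\<^esub> f x)"
proof -
  interpret M: module R M by fact
  interpret N: module R N by fact
  note c = lin_map_closed[OF assms(1)]
  show ?thesis
  proof (rule lin_mapI)
    fix t x assume *: "t \<in> carrier R" "x \<in> carrier M"
    have "s \<odot>\<^bsub>N\<^esub> (t \<odot>\<^bsub>N\<^esub> f x) = t \<odot>\<^bsub>N\<^esub> (s \<odot>\<^bsub>N\<^esub> f x)"
      using * assms(2) c by (simp flip: N.smult_assoc1 add: M.R.m_comm)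
    thus "s \<odot>\<^bsub>N\<^esub> f (t \<odot>\<^bsub>M\<^esub> x) = t \<odot>\<^bsub>N\<^esub> (s \<odot>\<^bsub>N\<^esub> f x)"
      using * by (simp add: lin_map_smult[OF assms(1)])
  qed (use assms(2) in \<open>auto simp: c lin_map_add[OF assms(1)] N.smult_r_distr\<close>)
qed

lemma lin_map_cong:
  assumes "module R M" "\<And>x. x \<in> carrier M \<Longrightarrow> f x = g x" "lin_map R M N f"
  shows "lin_map R M N g"
proof -
  interpret M: module R M by fact
  show ?thesis using assms(2,3) by (auto simp: lin_map_def Pi_iff)
qed

lemma submodule_kernel:
  assumes "lin_map R M N f" "module R M" "module R N"
  shows "submodule {x \<in> carrier M. f x = \<zero>\<^bsub>N\<^esub>} R M"
proof -
  interpret M: module R M by fact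
  interpret N: module R N by fact
  show ?thesis
    by (rule M.submoduleI)
      (use assms in \<open>auto simp: lin_map_zero lin_map_add lin_map_smult lin_map_minus\<close>)
qed

section \<open>Quotient modules\<close>

locale quotient_module = module R M
  for R :: "('k, 'r) ring_scheme" and M :: "('k, 'm) module" +
  fixes N
  assumes submodule: "submodule N R M"
begin

abbreviation "Q \<equiv> quot_module M N"

lemma abelian_subgroup: "abelian_subgroup N M"
  by (rule abelian_subgroupI3)
    (auto intro: additive_subgroup.intro submodule.axioms(1)[OF submodule] M.abelian_group_axioms)

lemmas submodule_subset = submoduleE(1)[OF submodule]

lemma quot_carrier: "carrier Q = (\<lambda>x. N +>\<^bsub>M\<^esub> x) ` carrier M"
  by (auto simp: quot_module_def A_RCOSETS_def')

lemma coset_in_quot: "x \<in> carrier M \<Longrightarrow> N +>\<^bsub>M\<^esub> x \<in> carrier Q"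
  by (simp add: quot_carrier)

lemma coset_add:
  "x \<in> carrier M \<Longrightarrow> y \<in> carrier M \<Longrightarrow>
    (N +>\<^bsub>M\<^esub> x) \<oplus>\<^bsub>Q\<^esub> (N +>\<^bsub>M\<^esub> y) = N +>\<^bsub>M\<^esub> (x \<oplus>\<^bsub>M\<^esub> y)"
  by (simp add: quot_module_def abelian_subgroup.a_rcos_sum[OF abelian_subgroup])

lemma coset_eqI:
  assumes "x \<in> carrier M" "y \<in> carrier M" "x \<ominus>\<^bsub>M\<^esub> y \<in> N"
  shows "N +>\<^bsub>M\<^esub> x = N +>\<^bsub>M\<^esub> y"
proof -
  have "x = (x \<ominus>\<^bsub>M\<^esub> y) \<oplus>\<^bsub>M\<^esub> y"
    using assms by (simp add: a_minus_def M.a_assoc M.l_neg)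
  hence "x \<in> N +>\<^bsub>M\<^esub> y"
    using assms(3) by (auto simp: a_r_coset_def')
  thus ?thesis using abelian_subgroup.a_repr_independence'[OF abelian_subgroup _ assms(2)] by simp
qed

lemma coset_memD:
  assumes "x \<in> carrier M" "z \<in> N +>\<^bsub>M\<^esub> x"
  obtains n where "n \<in> N" "n \<in> carrier M" "z = n \<oplus>\<^bsub>M\<^esub> x"
  using assms submodule_subset by (auto simp: a_r_coset_def')

lemma coset_smult:
  assumes "s \<in> carrier R" "x \<in> carrier M"
  shows "s \<odot>\<^bsub>Q\<^esub> (N +>\<^bsub>M\<^esub> x) = N +>\<^bsub>M\<^esub> (s \<odot>\<^bsub>M\<^esub> x)"
proof -
  have "N +>\<^bsub>M\<^esub> (s \<odot>\<^bsub>M\<^esub> z) = N +>\<^bsub>M\<^esub> (s \<odot>\<^bsub>M\<^esub> x)" if z: "z \<in> N +>\<^bsub>M\<^esub> x" for z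
  proof -
    obtain n where n: "n \<in> N" "n \<in> carrier M" "z = n \<oplus>\<^bsub>M\<^esub> x"
      using coset_memD[OF assms(2) z] .
    have "s \<odot>\<^bsub>M\<^esub> z = s \<odot>\<^bsub>M\<^esub> n \<oplus>\<^bsub>M\<^esub> s \<odot>\<^bsub>M\<^esub> x"
      using n assms by (simp add: smult_r_distr)
    hence "s \<odot>\<^bsub>M\<^esub> z \<ominus>\<^bsub>M\<^esub> s \<odot>\<^bsub>M\<^esub> x = s \<odot>\<^bsub>M\<^esub> n"
      using n assms by (simp add: a_minus_def M.a_assoc M.r_neg)
    thus ?thesis
      using n assms submoduleE(4)[OF submodule] by (intro coset_eqI) auto
  qed
  moreover have "x \<in> N +>\<^bsub>M\<^esub> x" using assms(2) by (rule abelian_subgroup.a_rcos_self[OF abelian_subgroup])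
  ultimately have "(\<Union>z\<in>N +>\<^bsub>M\<^esub> x. N +>\<^bsub>M\<^esub> (s \<odot>\<^bsub>M\<^esub> z)) = N +>\<^bsub>M\<^esub> (s \<odot>\<^bsub>M\<^esub> x)"
    by blast
  thus ?thesis by (simp add: quot_module_def)
qed

lemma quot_zero: "\<zero>\<^bsub>Q\<^esub> = N +>\<^bsub>M\<^esub> \<zero>\<^bsub>M\<^esub>"
  using submodule_subset by (simp add: quot_module_def)

lemma module_quot: "module R Q"
proof (rule moduleI)
  show "cring R" by (rule R.is_cring)
  show "abelian_group Q"
  proof (rule abelian_groupI)
    fix X assume "X \<in> carrier Q"
    then obtain x where x: "x \<in> carrier M" "X = N +>\<^bsub>M\<^esub> x" by (auto simp: quot_carrier)
    show "\<zero>\<^bsub>Q\<^esub> \<oplus>\<^bsub>Q\<^esub> X = X"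
      using x by (simp add: coset_add quot_zero)
    show "\<exists>Y\<in>carrier Q. Y \<oplus>\<^bsub>Q\<^esub> X = \<zero>\<^bsub>Q\<^esub>"
      using x by (intro bexI[of _ "N +>\<^bsub>M\<^esub> (\<ominus>\<^bsub>M\<^esub> x)"])
        (simp_all add: coset_add quot_zero coset_in_quot M.l_neg)
    fix Y assume "Y \<in> carrier Q"
    then obtain y where y: "y \<in> carrier M" "Y = N +>\<^bsub>M\<^esub> y" by (auto simp: quot_carrier)
    show "X \<oplus>\<^bsub>Q\<^esub> Y \<in> carrier Q"
      using x y by (simp add: coset_add coset_in_quot)
    show "X \<oplus>\<^bsub>Q\<^esub> Y = Y \<oplus>\<^bsub>Q\<^esub> X"
      using x y by (simp add: coset_add M.a_comm)
    fix Z assume "Z \<in> carrier Q"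
    then obtain z where z: "z \<in> carrier M" "Z = N +>\<^bsub>M\<^esub> z" by (auto simp: quot_carrier)
    show "X \<oplus>\<^bsub>Q\<^esub> Y \<oplus>\<^bsub>Q\<^esub> Z = X \<oplus>\<^bsub>Q\<^esub> (Y \<oplus>\<^bsub>Q\<^esub> Z)"
      using x y z by (simp add: coset_add M.a_assoc)
  qed (simp add: quot_zero coset_in_quot)
next
  fix s X assume s: "s \<in> carrier R" and "X \<in> carrier Q"
  then obtain x where x: "x \<in> carrier M" "X = N +>\<^bsub>M\<^esub> x" by (auto simp: quot_carrier)
  show "s \<odot>\<^bsub>Q\<^esub> X \<in> carrier Q"
    using s x by (simp add: coset_smult coset_in_quot)
  fix Y assume "Y \<in> carrier Q"
  then obtain y where y: "y \<in> carrier M" "Y = N +>\<^bsub>M\<^esub> y" by (auto simp: quot_carrier)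
  show "s \<odot>\<^bsub>Q\<^esub> (X \<oplus>\<^bsub>Q\<^esub> Y) =
      s \<odot>\<^bsub>Q\<^esub> X \<oplus>\<^bsub>Q\<^esub> s \<odot>\<^bsub>Q\<^esub> Y"
    using s x y by (simp add: coset_smult coset_add smult_r_distr)
next
  fix X assume "X \<in> carrier Q"
  then obtain x where x: "x \<in> carrier M" "X = N +>\<^bsub>M\<^esub> x" by (auto simp: quot_carrier)
  show "\<one>\<^bsub>R\<^esub> \<odot>\<^bsub>Q\<^esub> X = X"
    using x by (simp add: coset_smult)
next
  fix s t X assume s: "s \<in> carrier R" and t: "t \<in> carrier R" and "X \<in> carrier Q"
  then obtain x where x: "x \<in> carrier M" "X = N +>\<^bsub>M\<^esub> x" by (auto simp: quot_carrier)
  show "(s \<oplus>\<^bsub>R\<^esub> t) \<odot>\<^bsub>Q\<^esub> X =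
      s \<odot>\<^bsub>Q\<^esub> X \<oplus>\<^bsub>Q\<^esub> t \<odot>\<^bsub>Q\<^esub> X"
    using s t x by (simp add: coset_smult coset_add smult_l_distr)
  show "(s \<otimes>\<^bsub>R\<^esub> t) \<odot>\<^bsub>Q\<^esub> X = s \<odot>\<^bsub>Q\<^esub> (t \<odot>\<^bsub>Q\<^esub> X)"
    using s t x by (simp add: coset_smult smult_assoc1)
qed

text \<open>
  A linear map that vanishes on the submodule is constant on cosets, so the \<^const>\<open>the_elem\<close> of the
  image of a coset is its common value.
\<close>

lemma the_elem_coset:
  assumes "lin_map R M P h" "module R P" "\<And>x. x \<in> N \<Longrightarrow> h x = \<zero>\<^bsub>P\<^esub>" "x \<in> carrier M"
  shows "the_elem (h ` (N +>\<^bsub>M\<^esub> x)) = h x"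
proof -
  interpret P: module R P by fact
  have "h z = h x" if z: "z \<in> N +>\<^bsub>M\<^esub> x" for z
  proof -
    obtain n where "n \<in> N" "n \<in> carrier M" "z = n \<oplus>\<^bsub>M\<^esub> x"
      using coset_memD[OF assms(4) z] .
    thus ?thesis
      using assms(4) lin_map_closed[OF assms(1,4)] by (simp add: lin_map_add[OF assms(1)] assms(3))
  qed
  moreover have "x \<in> N +>\<^bsub>M\<^esub> x" using assms(4) by (rule abelian_subgroup.a_rcos_self[OF abelian_subgroup])
  ultimately have "h ` (N +>\<^bsub>M\<^esub> x) = {h x}" by blast
  thus ?thesis by simp
qed

lemma lin_map_the_elem:
  assumes "lin_map R M P h" "module R P" "\<And>x. x \<in> N \<Longrightarrow> h x = \<zero>\<^bsub>P\<^esub>"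
  shows "lin_map R Q P (\<lambda>X. the_elem (h ` X))"
proof (rule lin_mapI)
  note e = the_elem_coset[OF assms]
  fix X assume "X \<in> carrier Q"
  then obtain x where x: "x \<in> carrier M" "X = N +>\<^bsub>M\<^esub> x" by (auto simp: quot_carrier)
  show "the_elem (h ` X) \<in> carrier P"
    using x by (simp add: e lin_map_closed[OF assms(1)])
  fix Y assume "Y \<in> carrier Q"
  then obtain y where y: "y \<in> carrier M" "Y = N +>\<^bsub>M\<^esub> y" by (auto simp: quot_carrier)
  show "the_elem (h ` (X \<oplus>\<^bsub>Q\<^esub> Y)) = the_elem (h ` X) \<oplus>\<^bsub>P\<^esub> the_elem (h ` Y)"
    using x y by (simp add: e coset_add lin_map_add[OF assms(1)])
next
  note e = the_elem_coset[OF assms]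
  fix s X assume s: "s \<in> carrier R" and "X \<in> carrier Q"
  then obtain x where x: "x \<in> carrier M" "X = N +>\<^bsub>M\<^esub> x" by (auto simp: quot_carrier)
  show "the_elem (h ` (s \<odot>\<^bsub>Q\<^esub> X)) = s \<odot>\<^bsub>P\<^esub> the_elem (h ` X)"
    using s x by (simp add: e coset_smult lin_map_smult[OF assms(1)])
qed

end

lemma generated_submodule_incl: "S \<subseteq> generated_submodule R M S"
  by (auto simp: generated_submodule_def)

lemma generated_submodule_least:
  "submodule N R M \<Longrightarrow> S \<subseteq> N \<Longrightarrow> generated_submodule R M S \<subseteq> N"
  by (auto simp: generated_submodule_def)

lemma submodule_generated:
  assumes "module R M" "S \<subseteq> carrier M"
  shows "submodule (generated_submodule R M S) R M"
proof -
  interpret M: module R M by fact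
  have mem: "x \<in> generated_submodule R M S \<longleftrightarrow> (\<forall>N. submodule N R M \<longrightarrow> S \<subseteq> N \<longrightarrow> x \<in> N)" for x
    by (auto simp: generated_submodule_def)
  show ?thesis
  proof (rule M.submoduleI)
    show "generated_submodule R M S \<subseteq> carrier M"
      by (rule generated_submodule_least[OF M.carrier_is_submodule assms(2)])
    have "\<zero>\<^bsub>M\<^esub> \<in> N" if "submodule N R M" for N
      using subgroup.one_closed[OF submodule.axioms(1)[OF that]] by simp
    thus "\<zero>\<^bsub>M\<^esub> \<in> generated_submodule R M S" unfolding mem by blast
    fix a assume a: "a \<in> generated_submodule R M S"
    show "\<ominus>\<^bsub>M\<^esub> a \<in> generated_submodule R M S"
      using a unfolding mem by (metis M.submoduleE(3))
    fix b assume b: "b \<in> generated_submodule R M S"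
    show "a \<oplus>\<^bsub>M\<^esub> b \<in> generated_submodule R M S"
      using a b unfolding mem by (metis M.submoduleE(5))
  next
    fix s a assume "s \<in> carrier R" "a \<in> generated_submodule R M S"
    thus "s \<odot>\<^bsub>M\<^esub> a \<in> generated_submodule R M S"
      unfolding mem by (metis M.submoduleE(4))
  qed
qed

lemma quotient_module_generated:
  "module R M \<Longrightarrow> S \<subseteq> carrier M \<Longrightarrow> quotient_module R M (generated_submodule R M S)"
  by (simp add: quotient_module_def quotient_module_axioms_def submodule_generated)

section \<open>Free modules\<close>

lemma module_free:
  assumes "cring R"
  shows "module R (free_module R S)"
proof -
  interpret R: cring R by fact
  show ?thesis
  proof (rule moduleI)
    show "abelian_group (free_module R S)"
    proof (rule abelian_groupI)
      fix f g assume fg: "f \<in> carrier (free_module R S)" "g \<in> carrier (free_module R S)"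
      have "{x. f x \<oplus>\<^bsub>R\<^esub> g x \<noteq> \<zero>\<^bsub>R\<^esub>} \<subseteq> {x. f x \<noteq> \<zero>\<^bsub>R\<^esub>} \<union> {x. g x \<noteq> \<zero>\<^bsub>R\<^esub>}" by auto
      thus "f \<oplus>\<^bsub>free_module R S\<^esub> g \<in> carrier (free_module R S)"
        using fg by (auto simp: free_module_def Pi_iff intro: finite_subset)
    next
      fix f assume f: "f \<in> carrier (free_module R S)"
      have "{x. \<ominus>\<^bsub>R\<^esub> f x \<noteq> \<zero>\<^bsub>R\<^esub>} \<subseteq> {x. f x \<noteq> \<zero>\<^bsub>R\<^esub>}" by auto
      thus "\<exists>g\<in>carrier (free_module R S). g \<oplus>\<^bsub>free_module R S\<^esub> f = \<zero>\<^bsub>free_module R S\<^esub>"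
        using f by (intro bexI[of _ "\<lambda>x. \<ominus>\<^bsub>R\<^esub> f x"])
          (auto simp: free_module_def Pi_iff R.l_neg intro: finite_subset)
    qed (auto simp: free_module_def Pi_iff R.a_ac)
  next
    fix s f assume "s \<in> carrier R" "f \<in> carrier (free_module R S)"
    moreover have "{x. s \<otimes>\<^bsub>R\<^esub> f x \<noteq> \<zero>\<^bsub>R\<^esub>} \<subseteq> {x. f x \<noteq> \<zero>\<^bsub>R\<^esub>}" if "s \<in> carrier R"
      using that by auto
    ultimately show "s \<odot>\<^bsub>free_module R S\<^esub> f \<in> carrier (free_module R S)"
      by (auto simp: free_module_def Pi_iff intro: finite_subset)
  qed (auto simp: free_module_def Pi_iff R.l_distr R.r_distr R.m_assoc R.is_cring)
qed

lemma single_closed: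
  assumes "cring R" "x \<in> S" shows "single R x \<in> carrier (free_module R S)"
proof -
  interpret R: cring R by fact
  have "{y. single R x y \<noteq> \<zero>\<^bsub>R\<^esub>} \<subseteq> {x}" by (auto simp: single_def)
  thus ?thesis using assms(2) by (auto simp: free_module_def single_def intro: finite_subset)
qed

lemma free_module_support:
  assumes "u \<in> carrier (free_module R S)"
  shows "finite {x. u x \<noteq> \<zero>\<^bsub>R\<^esub>}" "{x. u x \<noteq> \<zero>\<^bsub>R\<^esub>} \<subseteq> S" "u x \<in> carrier R"
  using assms by (auto simp: free_module_def)

text \<open>
  Linear extensions of \<open>u\<close> and \<open>v\<close> are sums over different supports; to add them, both are written as
  sums over a common finite set.
\<close>

lemma linext_eq_sum:
  assumes "module R P" "u \<in> carrier (free_module R S)" "\<And>x. x \<in> S \<Longrightarrow> f x \<in> carrier P"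
    and "finite T" "T \<subseteq> S" "{x. u x \<noteq> \<zero>\<^bsub>R\<^esub>} \<subseteq> T"
  shows "linext R P f u = (\<Oplus>\<^bsub>P\<^esub>x\<in>T. u x \<odot>\<^bsub>P\<^esub> f x)"
proof -
  interpret P: module R P by fact
  note s = free_module_support[OF assms(2)]
  show ?thesis
    unfolding linext_def using assms s
    by (intro P.add.finprod_mono_neutral_cong_left) (auto simp: subset_iff)
qed

lemma lin_map_linext:
  assumes "module R P" "\<And>x. x \<in> S \<Longrightarrow> f x \<in> carrier P"
  shows "lin_map R (free_module R S) P (linext R P f)"
proof -
  interpret P: module R P by fact
  have c: "cring R" by (rule P.is_cring)
  interpret F: module R "free_module R S" by (rule module_free[OF c])
  have "linext R P f u \<in> carrier P" if u: "u \<in> carrier (free_module R S)" for u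
    using free_module_support[OF u] assms(2)
    by (auto simp: linext_def intro!: P.finsum_closed)
  moreover have "linext R P f (u \<oplus>\<^bsub>free_module R S\<^esub> v) = linext R P f u \<oplus>\<^bsub>P\<^esub> linext R P f v"
    if uv: "u \<in> carrier (free_module R S)" "v \<in> carrier (free_module R S)" for u v
  proof -
    let ?T = "{x. u x \<noteq> \<zero>\<^bsub>R\<^esub>} \<union> {x. v x \<noteq> \<zero>\<^bsub>R\<^esub>}"
    note s = free_module_support[OF uv(1)] free_module_support[OF uv(2)]
    have *: "linext R P f w = (\<Oplus>\<^bsub>P\<^esub>x\<in>?T. w x \<odot>\<^bsub>P\<^esub> f x)"
      if "w \<in> carrier (free_module R S)" "{x. w x \<noteq> \<zero>\<^bsub>R\<^esub>} \<subseteq> ?T" for w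
      using that s assms by (intro linext_eq_sum[of R P w S]) auto
    have "{x. (u \<oplus>\<^bsub>free_module R S\<^esub> v) x \<noteq> \<zero>\<^bsub>R\<^esub>} \<subseteq> ?T"
      by (auto simp: free_module_def)
    moreover have "u \<oplus>\<^bsub>free_module R S\<^esub> v \<in> carrier (free_module R S)"
      using uv by (rule F.M.a_closed)
    ultimately have "linext R P f (u \<oplus>\<^bsub>free_module R S\<^esub> v) =
      (\<Oplus>\<^bsub>P\<^esub>x\<in>?T. (u x \<oplus>\<^bsub>R\<^esub> v x) \<odot>\<^bsub>P\<^esub> f x)"
      by (subst *) (auto simp: free_module_def)
    also have "\<dots> = (\<Oplus>\<^bsub>P\<^esub>x\<in>?T. u x \<odot>\<^bsub>P\<^esub> f x \<oplus>\<^bsub>P\<^esub> v x \<odot>\<^bsub>P\<^esub> f x)"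
      using s assms(2) by (intro P.finsum_cong') (auto simp: P.smult_l_distr subset_iff)
    also have "\<dots> = (\<Oplus>\<^bsub>P\<^esub>x\<in>?T. u x \<odot>\<^bsub>P\<^esub> f x) \<oplus>\<^bsub>P\<^esub> (\<Oplus>\<^bsub>P\<^esub>x\<in>?T. v x \<odot>\<^bsub>P\<^esub> f x)"
      using s assms(2) by (intro P.finsum_addf) (auto simp: subset_iff)
    also have "\<dots> = linext R P f u \<oplus>\<^bsub>P\<^esub> linext R P f v"
      using uv by (simp add: *)
    finally show ?thesis .
  qed
  moreover have "linext R P f (s \<odot>\<^bsub>free_module R S\<^esub> u) = s \<odot>\<^bsub>P\<^esub> linext R P f u"
    if su: "s \<in> carrier R" "u \<in> carrier (free_module R S)" for s u
  proof -
    let ?T = "{x. u x \<noteq> \<zero>\<^bsub>R\<^esub>}"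
    note s = free_module_support[OF su(2)]
    have "{x. (s \<odot>\<^bsub>free_module R S\<^esub> u) x \<noteq> \<zero>\<^bsub>R\<^esub>} \<subseteq> ?T"
      using su by (auto simp: free_module_def)
    note e = linext_eq_sum[where u = "s \<odot>\<^bsub>free_module R S\<^esub> u" and T = ?T and f = f,
      OF assms(1) F.smult_closed[OF su] assms(2) s(1,2) this]
    have "linext R P f (s \<odot>\<^bsub>free_module R S\<^esub> u) =
        (\<Oplus>\<^bsub>P\<^esub>x\<in>?T. (s \<odot>\<^bsub>free_module R S\<^esub> u) x \<odot>\<^bsub>P\<^esub> f x)"
      by (rule e)
    also have "\<dots> = (\<Oplus>\<^bsub>P\<^esub>x\<in>?T. (s \<otimes>\<^bsub>R\<^esub> u x) \<odot>\<^bsub>P\<^esub> f x)"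
      by (simp add: free_module_def)
    also have "\<dots> = (\<Oplus>\<^bsub>P\<^esub>x\<in>?T. s \<odot>\<^bsub>P\<^esub> (u x \<odot>\<^bsub>P\<^esub> f x))"
      using s su assms(2) by (intro P.finsum_cong') (auto simp: P.smult_assoc1 subset_iff)
    also have "\<dots> = s \<odot>\<^bsub>P\<^esub> (\<Oplus>\<^bsub>P\<^esub>x\<in>?T. u x \<odot>\<^bsub>P\<^esub> f x)"
      using s su assms(2) by (intro P.finsum_smult_ldistr[symmetric]) (auto simp: subset_iff)
    finally show ?thesis by (simp add: linext_def)
  qed
  ultimately show ?thesis by (intro lin_mapI) auto
qed

lemma linext_single:
  assumes "module R P" "x \<in> S" "\<And>x. x \<in> S \<Longrightarrow> f x \<in> carrier P"
  shows "linext R P f (single R x) = f x"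
proof -
  interpret P: module R P by fact
  have "linext R P f (single R x) = (\<Oplus>\<^bsub>P\<^esub>y\<in>{x}. single R x y \<odot>\<^bsub>P\<^esub> f y)"
    using assms by (intro linext_eq_sum[of R P _ S])
      (auto simp: single_closed P.is_cring, auto simp: single_def split: if_splits)
  also have "\<dots> = f x" using assms(2,3) by (simp add: single_def)
  finally show ?thesis .
qed

lemma free_module_induct [consumes 2, case_names zero single add]:
  assumes "cring R" "u \<in> carrier (free_module R S)"
    and "P (\<lambda>_. \<zero>\<^bsub>R\<^esub>)"
    and "\<And>s x. s \<in> carrier R \<Longrightarrow> x \<in> S \<Longrightarrow> P (s \<odot>\<^bsub>free_module R S\<^esub> single R x)"
    and "\<And>u v. u \<in> carrier (free_module R S) \<Longrightarrow> v \<in> carrier (free_module R S) \<Longrightarrow> P u \<Longrightarrow> P v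
      \<Longrightarrow> P (u \<oplus>\<^bsub>free_module R S\<^esub> v)"
  shows "P u"
proof -
  interpret R: cring R by fact
  interpret F: module R "free_module R S" by (rule module_free[OF assms(1)])
  have "finite T \<Longrightarrow> u \<in> carrier (free_module R S) \<Longrightarrow> {x. u x \<noteq> \<zero>\<^bsub>R\<^esub>} = T \<Longrightarrow> P u" for T u
  proof (induction T arbitrary: u rule: finite_induct)
    case empty
    hence "u = (\<lambda>_. \<zero>\<^bsub>R\<^esub>)" by auto
    thus ?case using assms(3) by simp
  next
    case (insert x T)
    let ?v = "u(x := \<zero>\<^bsub>R\<^esub>)"
    have x: "x \<in> S" "u x \<in> carrier R" "\<And>x. u x \<in> carrier R"
      using insert.prems free_module_support[OF insert.prems(1)] by auto
    have supp: "{y. ?v y \<noteq> \<zero>\<^bsub>R\<^esub>} = T" using insert by auto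
    moreover have v: "?v \<in> carrier (free_module R S)"
      using insert.prems(1) insert.hyps(1) supp by (auto simp: free_module_def Pi_iff)
    ultimately have "P ?v" by (intro insert.IH)
    moreover have "u = (u x \<odot>\<^bsub>free_module R S\<^esub> single R x) \<oplus>\<^bsub>free_module R S\<^esub> ?v"
      using x by (auto simp: free_module_def single_def)
    ultimately show ?case
      using assms(4)[OF x(2,1)] assms(5)[OF _ v] x single_closed[OF assms(1) x(1)]
      by (metis F.smult_closed)
  qed
  thus ?thesis using assms(2) free_module_support[OF assms(2)] by blast
qed

section \<open>Tensor products over the ground ring\<close>

lemma bilin_mapI:
  "(\<And>x. x \<in> carrier M \<Longrightarrow> lin_map R N P (f x)) \<Longrightarrow>
   (\<And>y. y \<in> carrier N \<Longrightarrow> lin_map R M P (\<lambda>x. f x y)) \<Longrightarrow> bilin_map R M N P f"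
  by (simp add: bilin_map_def)

lemma bilin_mapD:
  "bilin_map R M N P f \<Longrightarrow> x \<in> carrier M \<Longrightarrow> lin_map R N P (f x)"
  "bilin_map R M N P f \<Longrightarrow> y \<in> carrier N \<Longrightarrow> lin_map R M P (\<lambda>x. f x y)"
  by (simp_all add: bilin_map_def)

lemma bilin_map_closed:
  "bilin_map R M N P f \<Longrightarrow> x \<in> carrier M \<Longrightarrow> y \<in> carrier N \<Longrightarrow> f x y \<in> carrier P"
  by (meson bilin_mapD(1) lin_map_closed)

text \<open>
  The fold that defines a finite product only evaluates the function on the index set, so congruence
  holds even for functions whose values lie outside the carrier.
\<close>

lemma finprod_cong_any:
  assumes "\<And>z. z \<in> A \<Longrightarrow> f z = g z"
  shows "finprod G f A = finprod G g A"
proof -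
  have *: "(A, x) \<in> foldSetD (carrier G) ((\<otimes>\<^bsub>G\<^esub>) \<circ> g) \<one>\<^bsub>G\<^esub>"
    if "(A, x) \<in> foldSetD (carrier G) ((\<otimes>\<^bsub>G\<^esub>) \<circ> f) \<one>\<^bsub>G\<^esub>" "\<And>z. z \<in> A \<Longrightarrow> f z = g z" for x f g A
    using that
  proof (induction A x rule: foldSetD.induct)
    case (insertI x A y)
    thus ?case using foldSetD.insertI[of x A "(\<otimes>\<^bsub>G\<^esub>) \<circ> g" y "carrier G"] by (simp add: comp_def)
  qed (auto intro: foldSetD.intros)
  have "(A, x) \<in> foldSetD (carrier G) ((\<otimes>\<^bsub>G\<^esub>) \<circ> f) \<one>\<^bsub>G\<^esub> \<longleftrightarrow>
      (A, x) \<in> foldSetD (carrier G) ((\<otimes>\<^bsub>G\<^esub>) \<circ> g) \<one>\<^bsub>G\<^esub>" for x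
    using *[of A x f g] *[of A x g f] assms by auto
  thus ?thesis by (simp add: finprod_def foldD_def)
qed

lemma finsum_cong_any: "(\<And>z. z \<in> A \<Longrightarrow> f z = g z) \<Longrightarrow> finsum G f A = finsum G g A"
  unfolding finsum_def by (rule finprod_cong_any)

lemma tensor_relations_subset:
  assumes "module R M" "module R N"
  shows "tensor_relations R M N \<subseteq> carrier (free_module R (carrier M \<times> carrier N))"
proof -
  interpret M: module R M by fact
  interpret N: module R N by fact
  interpret F: module R "free_module R (carrier M \<times> carrier N)"
    by (rule module_free[OF M.is_cring])
  note s = single_closed[OF M.is_cring]
  show ?thesis
    unfolding tensor_relations_def Let_def
    by (intro Un_least subsetI; elim CollectE exE conjE; hypsubst)
      (intro F.M.minus_closed F.M.a_closed F.smult_closed s SigmaI M.M.a_closed N.M.a_closed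
        M.smult_closed N.smult_closed; assumption)+
qed

lemma quotient_module_tensor:
  assumes "module R M" "module R N"
  shows "quotient_module R (free_module R (carrier M \<times> carrier N)) (tensor_kernel R M N)"
  unfolding tensor_kernel_def
  by (intro quotient_module_generated module_free tensor_relations_subset assms
      module_cring[OF assms(1)])

lemma tensor_relations_in_kernel: "u \<in> tensor_relations R M N \<Longrightarrow> u \<in> tensor_kernel R M N"
  unfolding tensor_kernel_def by (rule subsetD[OF generated_submodule_incl])

context
  fixes R :: "('k, 'r) ring_scheme" and M :: "('k, 'm, 'y) module_scheme"
    and N :: "('k, 'n, 'z) module_scheme"
  assumes M: "module R M" and N: "module R N"
begin

interpretation M: module R M by (rule M)
interpretation N: module R N by (rule N)
interpretation Q: quotient_module R "free_module R (carrier M \<times> carrier N)" "tensor_kernel R M N"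
  by (rule quotient_module_tensor[OF M N])

lemma module_tensor: "module R (tensor_module R M N)"
  unfolding tensor_module_def by (rule Q.module_quot)

lemma pure_closed:
  "x \<in> carrier M \<Longrightarrow> y \<in> carrier N \<Longrightarrow> pure R M N x y \<in> carrier (tensor_module R M N)"
  unfolding tensor_module_def pure_def
  by (intro Q.coset_in_quot single_closed M.is_cring) simp

abbreviation "Fr \<equiv> free_module R (carrier M \<times> carrier N)"

lemma single_pair_closed: "x \<in> carrier M \<Longrightarrow> y \<in> carrier N \<Longrightarrow> single R (x, y) \<in> carrier Fr"
  by (intro single_closed M.is_cring SigmaI)

lemma coset_eq_of_relation:
  "u \<ominus>\<^bsub>Fr\<^esub> v \<in> tensor_relations R M N \<Longrightarrow> u \<in> carrier Fr \<Longrightarrow> v \<in> carrier Fr \<Longrightarrow>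
    tensor_kernel R M N +>\<^bsub>Fr\<^esub> u = tensor_kernel R M N +>\<^bsub>Fr\<^esub> v"
  by (intro Q.coset_eqI tensor_relations_in_kernel)

lemma pure_add_left:
  assumes "x \<in> carrier M" "x' \<in> carrier M" "y \<in> carrier N"
  shows "pure R M N (x \<oplus>\<^bsub>M\<^esub> x') y = pure R M N x y \<oplus>\<^bsub>tensor_module R M N\<^esub> pure R M N x' y"
proof -
  have "single R (x \<oplus>\<^bsub>M\<^esub> x', y) \<ominus>\<^bsub>Fr\<^esub> (single R (x, y) \<oplus>\<^bsub>Fr\<^esub> single R (x', y))
      \<in> tensor_relations R M N"
    unfolding tensor_relations_def Let_def
    by (rule UnI1, rule UnI1, rule UnI1, rule CollectI, rule exI, rule exI, rule exI, rule conjI, rule refl, intro conjI assms)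
  from coset_eq_of_relation[OF this] show ?thesis
    unfolding tensor_module_def pure_def using assms
    by (subst Q.coset_add) (simp_all add: single_pair_closed)
qed

lemma pure_add_right:
  assumes "x \<in> carrier M" "y \<in> carrier N" "y' \<in> carrier N"
  shows "pure R M N x (y \<oplus>\<^bsub>N\<^esub> y') = pure R M N x y \<oplus>\<^bsub>tensor_module R M N\<^esub> pure R M N x y'"
proof -
  have "single R (x, y \<oplus>\<^bsub>N\<^esub> y') \<ominus>\<^bsub>Fr\<^esub> (single R (x, y) \<oplus>\<^bsub>Fr\<^esub> single R (x, y'))
      \<in> tensor_relations R M N"
    unfolding tensor_relations_def Let_def
    by (rule UnI1, rule UnI1, rule UnI2, rule CollectI, rule exI, rule exI, rule exI, rule conjI, rule refl, intro conjI assms)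
  from coset_eq_of_relation[OF this] show ?thesis
    unfolding tensor_module_def pure_def using assms
    by (subst Q.coset_add) (simp_all add: single_pair_closed)
qed

lemma pure_smult_left:
  assumes "s \<in> carrier R" "x \<in> carrier M" "y \<in> carrier N"
  shows "pure R M N (s \<odot>\<^bsub>M\<^esub> x) y = s \<odot>\<^bsub>tensor_module R M N\<^esub> pure R M N x y"
proof -
  have "single R (s \<odot>\<^bsub>M\<^esub> x, y) \<ominus>\<^bsub>Fr\<^esub> s \<odot>\<^bsub>Fr\<^esub> single R (x, y)
      \<in> tensor_relations R M N"
    unfolding tensor_relations_def Let_def
    by (rule UnI1, rule UnI2, rule CollectI, rule exI, rule exI, rule exI, rule conjI, rule refl, intro conjI assms)
  from coset_eq_of_relation[OF this] show ?thesis
    unfolding tensor_module_def pure_def using assms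
    by (subst Q.coset_smult) (simp_all add: single_pair_closed)
qed

lemma pure_smult_right:
  assumes "s \<in> carrier R" "x \<in> carrier M" "y \<in> carrier N"
  shows "pure R M N x (s \<odot>\<^bsub>N\<^esub> y) = s \<odot>\<^bsub>tensor_module R M N\<^esub> pure R M N x y"
proof -
  have "single R (x, s \<odot>\<^bsub>N\<^esub> y) \<ominus>\<^bsub>Fr\<^esub> s \<odot>\<^bsub>Fr\<^esub> single R (x, y)
      \<in> tensor_relations R M N"
    unfolding tensor_relations_def Let_def
    by (rule UnI2, rule CollectI, rule exI, rule exI, rule exI, rule conjI, rule refl, intro conjI assms)
  from coset_eq_of_relation[OF this] show ?thesis
    unfolding tensor_module_def pure_def using assms
    by (subst Q.coset_smult) (simp_all add: single_pair_closed)
qed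

lemma bilin_map_pure: "bilin_map R M N (tensor_module R M N) (pure R M N)"
  by (intro bilin_mapI lin_mapI)
    (simp_all add: pure_closed pure_add_left pure_add_right pure_smult_left pure_smult_right)

text \<open>
  Scalars are absorbed by pure tensors, \<open>s(x \<otimes> y) = (sx) \<otimes> y\<close>, so every element is a sum of pure tensors.
\<close>

lemma tensor_induct [consumes 1, case_names pure add]:
  assumes "t \<in> carrier (tensor_module R M N)"
    and pure: "\<And>x y. x \<in> carrier M \<Longrightarrow> y \<in> carrier N \<Longrightarrow> P (pure R M N x y)"
    and add: "\<And>s t. s \<in> carrier (tensor_module R M N) \<Longrightarrow> t \<in> carrier (tensor_module R M N) \<Longrightarrow>
      P s \<Longrightarrow> P t \<Longrightarrow> P (s \<oplus>\<^bsub>tensor_module R M N\<^esub> t)"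
  shows "P t"
proof -
  interpret T: module R "tensor_module R M N" by (rule module_tensor)
  let ?F = "free_module R (carrier M \<times> carrier N)"
  obtain u where u: "u \<in> carrier ?F" "t = tensor_kernel R M N +>\<^bsub>?F\<^esub> u"
    using assms(1) unfolding tensor_module_def Q.quot_carrier by blast
  have "P (tensor_kernel R M N +>\<^bsub>?F\<^esub> u)"
    using M.is_cring u(1)
  proof (induction u rule: free_module_induct)
    case zero
    have "pure R M N \<zero>\<^bsub>M\<^esub> \<zero>\<^bsub>N\<^esub> = \<zero>\<^bsub>tensor_module R M N\<^esub>"
      by (rule lin_map_zero[OF bilin_mapD(1)[OF bilin_map_pure]]) (auto intro: M N module_tensor)
    also have "\<dots> = tensor_kernel R M N +>\<^bsub>?F\<^esub> (\<lambda>_. \<zero>\<^bsub>R\<^esub>)"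
      unfolding tensor_module_def Q.quot_zero by (simp add: free_module_def)
    finally show ?case using pure[of "\<zero>\<^bsub>M\<^esub>" "\<zero>\<^bsub>N\<^esub>"] by simp
  next
    case (single s z)
    then obtain x y where z: "z = (x, y)" "x \<in> carrier M" "y \<in> carrier N" by auto
    have "tensor_kernel R M N +>\<^bsub>?F\<^esub> (s \<odot>\<^bsub>?F\<^esub> single R z) = s \<odot>\<^bsub>tensor_module R M N\<^esub> pure R M N x y"
      unfolding tensor_module_def pure_def z(1) using single z
      by (intro Q.coset_smult[symmetric] single_closed M.is_cring) auto
    also have "\<dots> = pure R M N (s \<odot>\<^bsub>M\<^esub> x) y"
      using single z by (simp add: pure_smult_left)
    finally show ?case using pure[of "s \<odot>\<^bsub>M\<^esub> x" y] single z by simp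
  next
    case (add u v)
    have "tensor_kernel R M N +>\<^bsub>?F\<^esub> (u \<oplus>\<^bsub>?F\<^esub> v) =
      (tensor_kernel R M N +>\<^bsub>?F\<^esub> u) \<oplus>\<^bsub>tensor_module R M N\<^esub> (tensor_kernel R M N +>\<^bsub>?F\<^esub> v)"
      unfolding tensor_module_def using add.hyps by (intro Q.coset_add[symmetric])
    thus ?case
      using assms(3)[OF _ _ add.IH] Q.coset_in_quot add.hyps by (simp add: tensor_module_def)
  qed
  thus ?thesis using u by simp
qed

lemma tensor_eqI:
  assumes "lin_map R (tensor_module R M N) P F" "lin_map R (tensor_module R M N) P G"
    and "\<And>x y. x \<in> carrier M \<Longrightarrow> y \<in> carrier N \<Longrightarrow> F (pure R M N x y) = G (pure R M N x y)"
    and "t \<in> carrier (tensor_module R M N)"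
  shows "F t = G t"
  using assms(4)
  by (induction t rule: tensor_induct)
    (auto simp: assms(3) lin_map_add[OF assms(1)] lin_map_add[OF assms(2)])

text \<open>The kernel of the linear extension of a bilinear map is a submodule that contains the relations.\<close>

lemma linext_tensor_kernel:
  assumes P: "module R P" and f: "bilin_map R M N P f" and "u \<in> tensor_kernel R M N"
  shows "linext R P (\<lambda>(x, y). f x y) u = \<zero>\<^bsub>P\<^esub>"
proof -
  interpret P: module R P by (rule P)
  let ?F = "free_module R (carrier M \<times> carrier N)" and ?h = "linext R P (\<lambda>(x, y). f x y)"
  have s': "\<And>x y. x \<in> carrier M \<Longrightarrow> y \<in> carrier N \<Longrightarrow> single R (x, y) \<in> carrier ?F"
    by (intro single_closed M.is_cring SigmaI)
  note c = bilin_map_closed[OF f]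
  have h: "lin_map R ?F P ?h"
    by (rule lin_map_linext[OF P]) (auto intro: c)
  have h1: "?h (single R (x, y)) = f x y" if "x \<in> carrier M" "y \<in> carrier N" for x y
    using that by (subst linext_single[OF P, of _ "carrier M \<times> carrier N"]) (auto intro: c)
  have h2: "?h (v \<ominus>\<^bsub>?F\<^esub> w) = \<zero>\<^bsub>P\<^esub>" if "v \<in> carrier ?F" "w \<in> carrier ?F" "?h v = ?h w" for v w
  proof -
    have "?h (v \<ominus>\<^bsub>?F\<^esub> w) = ?h v \<oplus>\<^bsub>P\<^esub> \<ominus>\<^bsub>P\<^esub> ?h w"
      unfolding a_minus_def
      by (simp only: lin_map_add[OF h that(1) Q.M.a_inv_closed[OF that(2)]]
          lin_map_minus[OF h Q.module_axioms P that(2)])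
    thus ?thesis
      using P.M.r_neg[OF lin_map_closed[OF h that(2)]] by (simp only: that(3))
  qed
  have "tensor_relations R M N \<subseteq> {u \<in> carrier ?F. ?h u = \<zero>\<^bsub>P\<^esub>}"
  proof (intro subsetI CollectI conjI)
    fix u assume u: "u \<in> tensor_relations R M N"
    thus "u \<in> carrier ?F" using tensor_relations_subset[OF M N] by blast
    have l: "?h (s \<odot>\<^bsub>?F\<^esub> single R (x, y)) = s \<odot>\<^bsub>P\<^esub> f x y"
      if "s \<in> carrier R" "x \<in> carrier M" "y \<in> carrier N" for s x y
      using that by (simp only: lin_map_smult[OF h _ s'] h1)
    have a: "?h (single R (x, y) \<oplus>\<^bsub>?F\<^esub> single R (x', y')) = f x y \<oplus>\<^bsub>P\<^esub> f x' y'"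
      if "x \<in> carrier M" "y \<in> carrier N" "x' \<in> carrier M" "y' \<in> carrier N" for x y x' y'
      using that by (simp only: lin_map_add[OF h s' s'] h1)
    note b = lin_map_add[OF bilin_mapD(1)[OF f]] lin_map_add[OF bilin_mapD(2)[OF f]]
      lin_map_smult[OF bilin_mapD(1)[OF f]] lin_map_smult[OF bilin_mapD(2)[OF f]]
    show "?h u = \<zero>\<^bsub>P\<^esub>"
      using u unfolding tensor_relations_def Let_def
      by (elim UnE CollectE exE conjE; hypsubst; intro h2)
        (simp_all add: s' l a h1 b)
  qed
  hence "tensor_kernel R M N \<subseteq> {u \<in> carrier ?F. ?h u = \<zero>\<^bsub>P\<^esub>}"
    unfolding tensor_kernel_def
    by (intro generated_submodule_least submodule_kernel h Q.module_axioms P)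
  thus ?thesis using assms(3) by blast
qed

lemma tlift_pure:
  assumes P: "module R P" and f: "bilin_map R M N P f" and "x \<in> carrier M" "y \<in> carrier N"
  shows "tlift R P f (pure R M N x y) = f x y"
proof -
  have h: "lin_map R (free_module R (carrier M \<times> carrier N)) P (linext R P (\<lambda>(x, y). f x y))"
    by (rule lin_map_linext[OF P]) (auto intro: bilin_map_closed[OF f])
  have "tlift R P f (pure R M N x y) = linext R P (\<lambda>(x, y). f x y) (single R (x, y))"
    unfolding tlift_def pure_def using assms(3,4)
    by (intro Q.the_elem_coset[OF h P linext_tensor_kernel[OF P f]] single_closed M.is_cring) auto
  also have "\<dots> = f x y"
    using assms(3,4) by (subst linext_single[OF P, of _ "carrier M \<times> carrier N"])
      (auto intro: bilin_map_closed[OF f])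
  finally show ?thesis .
qed

lemma lin_map_tlift:
  assumes P: "module R P" and f: "bilin_map R M N P f"
  shows "lin_map R (tensor_module R M N) P (tlift R P f)"
proof -
  have "lin_map R (free_module R (carrier M \<times> carrier N)) P (linext R P (\<lambda>(x, y). f x y))"
    by (rule lin_map_linext[OF P]) (auto intro: bilin_map_closed[OF f])
  from Q.lin_map_the_elem[OF this P linext_tensor_kernel[OF P f]]
  show ?thesis unfolding tensor_module_def tlift_def by simp
qed

text \<open>
  Every representative of a tensor is supported on the product of the carriers.
\<close>

lemma tlift_cong:
  assumes "t \<in> carrier (tensor_module R M N)"
    and "\<And>x y. x \<in> carrier M \<Longrightarrow> y \<in> carrier N \<Longrightarrow> f x y = g x y"
  shows "tlift R P f t = tlift R P g t"
proof -
  let ?F = "free_module R (carrier M \<times> carrier N)"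
  have "linext R P (\<lambda>(x, y). f x y) u = linext R P (\<lambda>(x, y). g x y) u" if "u \<in> t" for u
  proof -
    obtain v where v: "v \<in> carrier ?F" "t = tensor_kernel R M N +>\<^bsub>?F\<^esub> v"
      using assms(1) unfolding tensor_module_def Q.quot_carrier by blast
    have "u \<in> carrier ?F"
      using that Q.coset_memD[OF v(1)] v by (metis Q.M.a_closed)
    hence "z \<in> carrier M \<times> carrier N" if "u z \<noteq> \<zero>\<^bsub>R\<^esub>" for z
      using that free_module_support(2) by fast
    thus ?thesis
      unfolding linext_def by (intro finsum_cong_any) (auto simp: assms(2))
  qed
  thus ?thesis unfolding tlift_def by (metis (no_types, lifting) image_cong)
qed

end

section \<open>Tensor products over a monoidal Hom-algebra\<close>

text \<open>
  The closure properties under which the relations that define \<^const>\<open>tensorA_module\<close> are relations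
  between elements of the tensor product over the ground ring.
\<close>

definition balance_data :: "('k, 'r) ring_scheme \<Rightarrow> ('k, 'a, 'x) hmod_scheme \<Rightarrow>
    ('k, 'm, 'a, 'y) rmod_scheme \<Rightarrow> ('k, 'n, 'a, 'z) bimod_scheme \<Rightarrow> bool" where
  "balance_data R A M N \<longleftrightarrow> module R M \<and> module R N \<and>
     (\<forall>m \<in> carrier M. aut M m \<in> carrier M) \<and> (\<forall>n \<in> carrier N. ainv N n \<in> carrier N) \<and>
     (\<forall>m \<in> carrier M. \<forall>a \<in> carrier A. ract M m a \<in> carrier M) \<and>
     (\<forall>a \<in> carrier A. \<forall>n \<in> carrier N. lact N a n \<in> carrier N)"

definition balanced :: "('k, 'a, 'x) hmod_scheme \<Rightarrow> ('k, 'm, 'a, 'y) rmod_scheme \<Rightarrow>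
    ('k, 'n, 'a, 'z) bimod_scheme \<Rightarrow> ('m \<Rightarrow> 'n \<Rightarrow> 'p) \<Rightarrow> bool" where
  "balanced A M N f \<longleftrightarrow> (\<forall>m \<in> carrier M. \<forall>a \<in> carrier A. \<forall>n \<in> carrier N.
     f (ract M m a) n = f (aut M m) (lact N a (ainv N n)))"

lemma balancedI:
  "(\<And>m a n. m \<in> carrier M \<Longrightarrow> a \<in> carrier A \<Longrightarrow> n \<in> carrier N \<Longrightarrow>
     f (ract M m a) n = f (aut M m) (lact N a (ainv N n))) \<Longrightarrow> balanced A M N f"
  by (simp add: balanced_def)

context
  fixes R :: "('k, 'r) ring_scheme" and A :: "('k, 'a, 'x) hmod_scheme"
    and M :: "('k, 'm, 'a, 'y) rmod_scheme" and N :: "('k, 'n, 'a, 'z) bimod_scheme"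
  assumes bd: "balance_data R A M N"
begin

lemma bdD:
  "module R M" "module R N"
  "m \<in> carrier M \<Longrightarrow> aut M m \<in> carrier M" "n \<in> carrier N \<Longrightarrow> ainv N n \<in> carrier N"
  "m \<in> carrier M \<Longrightarrow> a \<in> carrier A \<Longrightarrow> ract M m a \<in> carrier M"
  "a \<in> carrier A \<Longrightarrow> n \<in> carrier N \<Longrightarrow> lact N a n \<in> carrier N"
  using bd by (auto simp: balance_data_def)

interpretation T: module R "tensor_module R M N"
  by (rule module_tensor[OF bdD(1,2)])

lemma quotient_module_tensorA: "quotient_module R (tensor_module R M N) (tensorA_kernel R A M N)"
  unfolding tensorA_kernel_def
  by (rule quotient_module_generated[OF T.module_axioms])
    (auto intro!: T.M.minus_closed pure_closed bdD)

interpretation Q: quotient_module R "tensor_module R M N" "tensorA_kernel R A M N"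
  by (rule quotient_module_tensorA)

lemma module_tensorA: "module R (tensorA_module R A M N)"
  unfolding tensorA_module_def by (rule Q.module_quot)

lemma pureA_closed:
  "m \<in> carrier M \<Longrightarrow> n \<in> carrier N \<Longrightarrow> pureA R A M N m n \<in> carrier (tensorA_module R A M N)"
  unfolding tensorA_module_def pureA_def by (intro Q.coset_in_quot pure_closed bdD)

lemma lin_map_coset:
  "lin_map R (tensor_module R M N) (tensorA_module R A M N)
     (\<lambda>t. tensorA_kernel R A M N +>\<^bsub>tensor_module R M N\<^esub> t)"
  unfolding tensorA_module_def by (rule lin_mapI) (simp_all add: Q.coset_add Q.coset_smult Q.coset_in_quot)

lemma bilin_map_pureA: "bilin_map R M N (tensorA_module R A M N) (pureA R A M N)"
  unfolding pureA_def
  by (intro bilin_mapI lin_map_comp[OF lin_map_coset] bilin_mapD[OF bilin_map_pure] bdD)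

lemma pureA_balanced:
  assumes "m \<in> carrier M" "a \<in> carrier A" "n \<in> carrier N"
  shows "pureA R A M N (ract M m a) n = pureA R A M N (aut M m) (lact N a (ainv N n))"
proof -
  have "pure R M N (ract M m a) n \<ominus>\<^bsub>tensor_module R M N\<^esub> pure R M N (aut M m) (lact N a (ainv N n))
      \<in> tensorA_kernel R A M N"
    unfolding tensorA_kernel_def using assms
    by (intro subsetD[OF generated_submodule_incl] CollectI exI conjI) (rule refl)
  thus ?thesis
    unfolding pureA_def using assms by (intro Q.coset_eqI pure_closed bdD)
qed

lemma tensorA_induct [consumes 1, case_names pureA add]:
  assumes "t \<in> carrier (tensorA_module R A M N)"
    and pure: "\<And>x y. x \<in> carrier M \<Longrightarrow> y \<in> carrier N \<Longrightarrow> P (pureA R A M N x y)"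
    and add: "\<And>s t. s \<in> carrier (tensorA_module R A M N) \<Longrightarrow> t \<in> carrier (tensorA_module R A M N) \<Longrightarrow>
      P s \<Longrightarrow> P t \<Longrightarrow> P (s \<oplus>\<^bsub>tensorA_module R A M N\<^esub> t)"
  shows "P t"
proof -
  obtain u where u: "u \<in> carrier (tensor_module R M N)"
    "t = tensorA_kernel R A M N +>\<^bsub>tensor_module R M N\<^esub> u"
    using assms(1) unfolding tensorA_module_def Q.quot_carrier by blast
  have "P (tensorA_kernel R A M N +>\<^bsub>tensor_module R M N\<^esub> u)"
  proof (rule tensor_induct[OF bdD(1,2) u(1)])
    fix x y assume "x \<in> carrier M" "y \<in> carrier N"
    thus "P (tensorA_kernel R A M N +>\<^bsub>tensor_module R M N\<^esub> pure R M N x y)"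
      using assms(2) by (simp add: pureA_def)
  next
    fix s t assume st: "s \<in> carrier (tensor_module R M N)" "t \<in> carrier (tensor_module R M N)"
      "P (tensorA_kernel R A M N +>\<^bsub>tensor_module R M N\<^esub> s)"
      "P (tensorA_kernel R A M N +>\<^bsub>tensor_module R M N\<^esub> t)"
    show "P (tensorA_kernel R A M N +>\<^bsub>tensor_module R M N\<^esub> (s \<oplus>\<^bsub>tensor_module R M N\<^esub> t))"
      using assms(3)[OF _ _ st(3,4)] lin_map_closed[OF lin_map_coset] st(1,2)
      by (simp add: lin_map_add[OF lin_map_coset])
  qed
  thus ?thesis using u by simp
qed

lemma tensorA_eqI:
  assumes "lin_map R (tensorA_module R A M N) P F" "lin_map R (tensorA_module R A M N) P G"
    and "\<And>x y. x \<in> carrier M \<Longrightarrow> y \<in> carrier N \<Longrightarrow> F (pureA R A M N x y) = G (pureA R A M N x y)"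
    and "t \<in> carrier (tensorA_module R A M N)"
  shows "F t = G t"
  using assms(4)
  by (induction t rule: tensorA_induct)
    (auto simp: assms(3) lin_map_add[OF assms(1)] lin_map_add[OF assms(2)])

lemma tlift_tensorA_kernel:
  assumes P: "module R P" and f: "bilin_map R M N P f" and b: "balanced A M N f"
    and t: "t \<in> tensorA_kernel R A M N"
  shows "tlift R P f t = \<zero>\<^bsub>P\<^esub>"
proof -
  interpret P: module R P by (rule P)
  let ?T = "tensor_module R M N" and ?h = "tlift R P f"
  have h: "lin_map R ?T P ?h" by (rule lin_map_tlift[OF bdD(1,2) P f])
  have h1: "?h (pure R M N m n) = f m n" if "m \<in> carrier M" "n \<in> carrier N" for m n
    by (rule tlift_pure[OF bdD(1,2) P f that])
  have "?h (pure R M N (ract M m a) n \<ominus>\<^bsub>?T\<^esub> pure R M N (aut M m) (lact N a (ainv N n))) = \<zero>\<^bsub>P\<^esub>"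
    (is "?h (?u \<ominus>\<^bsub>?T\<^esub> ?v) = _")
    if that: "m \<in> carrier M" "a \<in> carrier A" "n \<in> carrier N" for m a n
  proof -
    have u: "?u \<in> carrier ?T" and v: "?v \<in> carrier ?T"
      by (intro pure_closed bdD that)+
    have "?h (?u \<ominus>\<^bsub>?T\<^esub> ?v) = ?h ?u \<oplus>\<^bsub>P\<^esub> \<ominus>\<^bsub>P\<^esub> ?h ?v"
      unfolding a_minus_def
      by (simp only: lin_map_add[OF h u T.M.a_inv_closed[OF v]]
          lin_map_minus[OF h T.module_axioms P v])
    moreover have "?h ?u = ?h ?v"
      using b that by (simp add: h1 bdD balanced_def)
    ultimately show ?thesis
      using P.M.r_neg[OF lin_map_closed[OF h v]] by simp
  qed
  hence "tensorA_kernel R A M N \<subseteq> {t \<in> carrier ?T. ?h t = \<zero>\<^bsub>P\<^esub>}"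
    unfolding tensorA_kernel_def
    by (intro generated_submodule_least submodule_kernel h T.module_axioms P)
      (auto intro!: T.M.minus_closed pure_closed bdD)
  thus ?thesis using t by blast
qed

lemma tliftA_pureA:
  assumes P: "module R P" and f: "bilin_map R M N P f" and b: "balanced A M N f"
    and "m \<in> carrier M" "n \<in> carrier N"
  shows "tliftA R P f (pureA R A M N m n) = f m n"
proof -
  have "tliftA R P f (pureA R A M N m n) = tlift R P f (pure R M N m n)"
    unfolding tliftA_def pureA_def
    by (intro Q.the_elem_coset[OF lin_map_tlift[OF bdD(1,2) P f] P tlift_tensorA_kernel[OF P f b]]
      pure_closed bdD assms)
  thus ?thesis using tlift_pure[OF bdD(1,2) P f] assms by simp
qed

lemma lin_map_tliftA:
  assumes P: "module R P" and f: "bilin_map R M N P f" and b: "balanced A M N f"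
  shows "lin_map R (tensorA_module R A M N) P (tliftA R P f)"
  using Q.lin_map_the_elem[OF lin_map_tlift[OF bdD(1,2) P f] P tlift_tensorA_kernel[OF P f b]]
  unfolding tensorA_module_def tliftA_def by simp

lemma tliftA_cong:
  assumes "t \<in> carrier (tensorA_module R A M N)"
    and "\<And>x y. x \<in> carrier M \<Longrightarrow> y \<in> carrier N \<Longrightarrow> f x y = g x y"
  shows "tliftA R P f t = tliftA R P g t"
proof -
  obtain v where v: "v \<in> carrier (tensor_module R M N)"
      "t = tensorA_kernel R A M N +>\<^bsub>tensor_module R M N\<^esub> v"
    using assms(1) unfolding tensorA_module_def Q.quot_carrier by blast
  have "tlift R P f u = tlift R P g u" if "u \<in> t" for u
  proof (rule tlift_cong[OF bdD(1,2) _ assms(2)])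
    show "u \<in> carrier (tensor_module R M N)"
      using that Q.coset_memD[OF v(1)] v by (metis T.M.a_closed)
  qed
  thus ?thesis unfolding tliftA_def by (metis (no_types, lifting) image_cong)
qed

end

section \<open>Sweedler sums\<close>

text \<open>
  \<open>sw R M N P f t\<close> is Sweedler's sum of \<open>f t\<^sub>1 t\<^sub>2\<close> for \<open>t \<in> M \<otimes> N\<close>. In contrast to \<^const>\<open>tlift\<close> it
  mentions \<open>M\<close> and \<open>N\<close>, and \<open>f\<close> enters only through its values on the carriers; the first lets rewrite
  rules find their side conditions, the second gives an unconditional congruence rule, so that
  the summand can be rewritten under the assumption that its two arguments lie in the carriers.
\<close>

definition sw :: "('k, 'r) ring_scheme \<Rightarrow> ('k, 'm, 'y) module_scheme \<Rightarrow> ('k, 'n, 'z) module_scheme \<Rightarrow>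
    ('k, 'p, 'w) module_scheme \<Rightarrow> ('m \<Rightarrow> 'n \<Rightarrow> 'p) \<Rightarrow> ('k, 'm, 'n) tens \<Rightarrow> 'p" where
  "sw R M N P f = tlift R P (\<lambda>x y. if x \<in> carrier M \<and> y \<in> carrier N then f x y else undefined)"

definition swA :: "('k, 'r) ring_scheme \<Rightarrow> ('k, 'a, 'x) hmod_scheme \<Rightarrow> ('k, 'm, 'a, 'y) rmod_scheme \<Rightarrow>
    ('k, 'n, 'a, 'z) bimod_scheme \<Rightarrow> ('k, 'p, 'w) module_scheme \<Rightarrow> ('m \<Rightarrow> 'n \<Rightarrow> 'p) \<Rightarrow>
    ('k, 'm, 'n) tensA \<Rightarrow> 'p" where
  "swA R A M N P f = tliftA R P (\<lambda>x y. if x \<in> carrier M \<and> y \<in> carrier N then f x y else undefined)"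

lemma sw_cong [cong]:
  assumes "M = M'" "N = N'" "P = P'"
    and "\<And>x y. x \<in> carrier M' \<Longrightarrow> y \<in> carrier N' \<Longrightarrow> f x y = g x y" "t = t'"
  shows "sw R M N P f t = sw R M' N' P' g t'"
proof -
  have "(\<lambda>x y. if x \<in> carrier M \<and> y \<in> carrier N then f x y else undefined) =
      (\<lambda>x y. if x \<in> carrier M \<and> y \<in> carrier N then g x y else undefined)"
    using assms(1,2,4) by (intro ext) simp
  thus ?thesis using assms by (simp add: sw_def)
qed

lemma swA_cong [cong]:
  assumes "\<And>x y. x \<in> carrier M \<Longrightarrow> y \<in> carrier N \<Longrightarrow> f x y = g x y" "t = t'"
  shows "swA R A M N P f t = swA R A M N P g t'"
proof -
  have "(\<lambda>x y. if x \<in> carrier M \<and> y \<in> carrier N then f x y else undefined) =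
      (\<lambda>x y. if x \<in> carrier M \<and> y \<in> carrier N then g x y else undefined)"
    using assms(1) by (intro ext) simp
  thus ?thesis by (simp add: swA_def assms(2))
qed

lemma tlift_eq_sw:
  assumes "t \<in> carrier (tensor_module R M N)" "module R M" "module R N"
  shows "tlift R P f t = sw R M N P f t"
  unfolding sw_def by (rule tlift_cong[OF assms(2,3,1)]) simp

lemma tliftA_eq_swA:
  assumes "t \<in> carrier (tensorA_module R A M N)" "balance_data R A M N"
  shows "tliftA R P f t = swA R A M N P f t"
  unfolding swA_def by (rule tliftA_cong[OF assms(2,1)]) simp

text \<open>Rewriting inside the function of a linearity statement would hide the form that the rules match.\<close>

lemma lin_map_weak_cong [cong]: "M = M' \<Longrightarrow> N = N' \<Longrightarrow> lin_map R M N f = lin_map R M' N' f"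
  by simp

lemma bilin_map_weak_cong [cong]:
  "M = M' \<Longrightarrow> N = N' \<Longrightarrow> P = P' \<Longrightarrow> bilin_map R M N P f = bilin_map R M' N' P' f"
  by simp

lemma bilin_map_restrict:
  assumes "module R M" "module R N" "bilin_map R M N P f"
  shows "bilin_map R M N P (\<lambda>x y. if x \<in> carrier M \<and> y \<in> carrier N then f x y else undefined)"
  using assms
  by (intro bilin_mapI) (auto intro: lin_map_cong[OF assms(2) _ bilin_mapD(1)[OF assms(3)]]
    lin_map_cong[OF assms(1) _ bilin_mapD(2)[OF assms(3)]])

text \<open>
  With the following rules the simplifier evaluates Sweedler sums. A sum that occurs as an argument
  of a linear operation is pulled outwards, a sum over a pure tensor is replaced by its summand, and
  linearity is decided by following the structure of the term.
\<close>

named_theorems sweedler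

lemmas [sweedler] = module_tensor pure_closed bilin_mapI lin_map_id
declare module_tensorA [sweedler] pureA_closed [sweedler]

lemma lin_map_bilin1:
  "bilin_map R M N P f \<Longrightarrow> lin_map R X M g \<Longrightarrow> y \<in> carrier N \<Longrightarrow> lin_map R X P (\<lambda>x. f (g x) y)"
  by (rule lin_map_comp[OF bilin_mapD(2)])

lemma lin_map_bilin2:
  "bilin_map R M N P f \<Longrightarrow> lin_map R X N g \<Longrightarrow> y \<in> carrier M \<Longrightarrow> lin_map R X P (\<lambda>x. f y (g x))"
  by (rule lin_map_comp[OF bilin_mapD(1)])

lemma bilin_map_smult1:
  "bilin_map R M N P f \<Longrightarrow> s \<in> carrier R \<Longrightarrow> x \<in> carrier M \<Longrightarrow> y \<in> carrier N \<Longrightarrow>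
    f (s \<odot>\<^bsub>M\<^esub> x) y = s \<odot>\<^bsub>P\<^esub> f x y"
  using lin_map_smult[OF bilin_mapD(2)] .

lemma bilin_map_smult2:
  "bilin_map R M N P f \<Longrightarrow> s \<in> carrier R \<Longrightarrow> x \<in> carrier M \<Longrightarrow> y \<in> carrier N \<Longrightarrow>
    f x (s \<odot>\<^bsub>N\<^esub> y) = s \<odot>\<^bsub>P\<^esub> f x y"
  using lin_map_smult[OF bilin_mapD(1)] .

lemma lin_map_pure1 [sweedler]:
  "module R M \<Longrightarrow> module R N \<Longrightarrow> y \<in> carrier N \<Longrightarrow> lin_map R X M g \<Longrightarrow>
    lin_map R X (tensor_module R M N) (\<lambda>x. pure R M N (g x) y)"
  by (rule lin_map_bilin1[OF bilin_map_pure])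

lemma lin_map_pure2 [sweedler]:
  "module R M \<Longrightarrow> module R N \<Longrightarrow> y \<in> carrier M \<Longrightarrow> lin_map R X N g \<Longrightarrow>
    lin_map R X (tensor_module R M N) (\<lambda>x. pure R M N y (g x))"
  by (rule lin_map_bilin2[OF bilin_map_pure])

lemma lin_map_pureA1 [sweedler]:
  "balance_data R A M N \<Longrightarrow> y \<in> carrier N \<Longrightarrow> lin_map R X M g \<Longrightarrow>
    lin_map R X (tensorA_module R A M N) (\<lambda>x. pureA R A M N (g x) y)"
  by (rule lin_map_bilin1[OF bilin_map_pureA])

lemma lin_map_pureA2 [sweedler]:
  "balance_data R A M N \<Longrightarrow> y \<in> carrier M \<Longrightarrow> lin_map R X N g \<Longrightarrow>
    lin_map R X (tensorA_module R A M N) (\<lambda>x. pureA R A M N y (g x))"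
  by (rule lin_map_bilin2[OF bilin_map_pureA])

lemma lin_map_sw:
  "module R M \<Longrightarrow> module R N \<Longrightarrow> module R P \<Longrightarrow> bilin_map R M N P f \<Longrightarrow>
    lin_map R (tensor_module R M N) P (sw R M N P f)"
  unfolding sw_def by (intro lin_map_tlift bilin_map_restrict)

lemma lin_map_sw2 [sweedler]:
  "module R M \<Longrightarrow> module R N \<Longrightarrow> module R P \<Longrightarrow> lin_map R X (tensor_module R M N) g \<Longrightarrow>
    bilin_map R M N P f \<Longrightarrow> lin_map R X P (\<lambda>x. sw R M N P f (g x))"
  by (intro lin_map_comp[OF lin_map_sw])

lemma sw_closed [sweedler]:
  "module R M \<Longrightarrow> module R N \<Longrightarrow> module R P \<Longrightarrow> t \<in> carrier (tensor_module R M N) \<Longrightarrow>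
    bilin_map R M N P f \<Longrightarrow> sw R M N P f t \<in> carrier P"
  by (rule lin_map_closed[OF lin_map_sw])

lemma sw_pure [sweedler]:
  "module R M \<Longrightarrow> module R N \<Longrightarrow> module R P \<Longrightarrow> x \<in> carrier M \<Longrightarrow> y \<in> carrier N \<Longrightarrow>
    bilin_map R M N P f \<Longrightarrow> sw R M N P f (pure R M N x y) = f x y"
  unfolding sw_def by (subst tlift_pure) (auto intro: bilin_map_restrict)

text \<open>
  A linear map can be moved under a Sweedler sum because both sides are linear in \<open>t\<close> and agree on pure
  tensors.
\<close>

lemma sw_push:
  assumes "lin_map R P Q h" "module R M" "module R N" "module R P" "module R Q"
    and "t \<in> carrier (tensor_module R M N)" and f: "bilin_map R M N P f"
  shows "h (sw R M N P f t) = sw R M N Q (\<lambda>x y. h (f x y)) t"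
proof (rule tensor_eqI[OF assms(2,3) _ _ _ assms(6)])
  have b: "bilin_map R M N Q (\<lambda>x y. h (f x y))"
    by (intro bilin_mapI lin_map_comp[OF assms(1)] bilin_mapD[OF f])
  show "lin_map R (tensor_module R M N) Q (\<lambda>t. h (sw R M N P f t))"
    by (intro lin_map_comp[OF assms(1)] lin_map_sw assms)
  show "lin_map R (tensor_module R M N) Q (sw R M N Q (\<lambda>x y. h (f x y)))"
    by (intro lin_map_sw assms b)
  fix x y assume "x \<in> carrier M" "y \<in> carrier N"
  thus "h (sw R M N P f (pure R M N x y)) = sw R M N Q (\<lambda>x y. h (f x y)) (pure R M N x y)"
    using assms b by (simp add: sw_pure)
qed

lemma sw_push1:
  assumes "bilin_map R P K Q h" "y \<in> carrier K" "module R M" "module R N" "module R P" "module R Q"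
    and "t \<in> carrier (tensor_module R M N)" and f: "bilin_map R M N P f"
  shows "h (sw R M N P f t) y = sw R M N Q (\<lambda>u v. h (f u v) y) t"
  using sw_push[OF bilin_mapD(2)[OF assms(1,2)] assms(3-)] .

lemma sw_push2:
  assumes "bilin_map R K P Q h" "y \<in> carrier K" "module R M" "module R N" "module R P" "module R Q"
    and "t \<in> carrier (tensor_module R M N)" and f: "bilin_map R M N P f"
  shows "h y (sw R M N P f t) = sw R M N Q (\<lambda>u v. h y (f u v)) t"
  using sw_push[OF bilin_mapD(1)[OF assms(1,2)] assms(3-)] .

lemma sw_sw [sweedler]:
  "module R M \<Longrightarrow> module R N \<Longrightarrow> module R K \<Longrightarrow> module R L \<Longrightarrow> module R Q \<Longrightarrow>
    t \<in> carrier (tensor_module R M N) \<Longrightarrow> bilin_map R M N (tensor_module R K L) f \<Longrightarrow>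
    bilin_map R K L Q g \<Longrightarrow>
    sw R K L Q g (sw R M N (tensor_module R K L) f t) = sw R M N Q (\<lambda>x y. sw R K L Q g (f x y)) t"
  by (intro sw_push lin_map_sw module_tensor)

lemma pure_sw1 [sweedler]:
  "module R M \<Longrightarrow> module R N \<Longrightarrow> module R P \<Longrightarrow> module R K \<Longrightarrow> y \<in> carrier K \<Longrightarrow>
    t \<in> carrier (tensor_module R M N) \<Longrightarrow> bilin_map R M N P f \<Longrightarrow>
    pure R P K (sw R M N P f t) y = sw R M N (tensor_module R P K) (\<lambda>u v. pure R P K (f u v) y) t"
  by (intro sw_push1[OF bilin_map_pure] module_tensor)

lemma pure_sw2 [sweedler]:
  "module R M \<Longrightarrow> module R N \<Longrightarrow> module R P \<Longrightarrow> module R K \<Longrightarrow> y \<in> carrier K \<Longrightarrow>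
    t \<in> carrier (tensor_module R M N) \<Longrightarrow> bilin_map R M N P f \<Longrightarrow>
    pure R K P y (sw R M N P f t) = sw R M N (tensor_module R K P) (\<lambda>u v. pure R K P y (f u v)) t"
  by (intro sw_push2[OF bilin_map_pure] module_tensor)

lemma lin_map_sw1 [sweedler]:
  assumes "module R M" "module R N" "module R P" "module R X"
    and "t \<in> carrier (tensor_module R M N)"
    and l: "\<And>u v. u \<in> carrier M \<Longrightarrow> v \<in> carrier N \<Longrightarrow> lin_map R X P (\<lambda>x. f x u v)"
    and b: "\<And>x. x \<in> carrier X \<Longrightarrow> bilin_map R M N P (f x)"
  shows "lin_map R X P (\<lambda>x. sw R M N P (f x) t)"
proof (rule lin_mapI)
  interpret X: module R X by fact
  fix x assume x: "x \<in> carrier X"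
  show "sw R M N P (f x) t \<in> carrier P"
    using assms x by (simp add: sw_closed)
  note s = lin_map_sw[OF assms(1-3) b]
  fix y assume y: "y \<in> carrier X"
  show "sw R M N P (f (x \<oplus>\<^bsub>X\<^esub> y)) t = sw R M N P (f x) t \<oplus>\<^bsub>P\<^esub> sw R M N P (f y) t"
  proof (rule tensor_eqI[OF assms(1,2) _ _ _ assms(5)])
    show "lin_map R (tensor_module R M N) P (\<lambda>t. sw R M N P (f x) t \<oplus>\<^bsub>P\<^esub> sw R M N P (f y) t)"
      using x y assms by (intro lin_map_sum s module_tensor)
  qed (use x y assms lin_map_add[OF l] s in \<open>auto simp: sw_pure cong del: sw_cong\<close>)
next
  interpret X: module R X by fact
  fix c x assume x: "c \<in> carrier R" "x \<in> carrier X"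
  note s = lin_map_sw[OF assms(1-3) b]
  show "sw R M N P (f (c \<odot>\<^bsub>X\<^esub> x)) t = c \<odot>\<^bsub>P\<^esub> sw R M N P (f x) t"
  proof (rule tensor_eqI[OF assms(1,2) _ _ _ assms(5)])
    show "lin_map R (tensor_module R M N) P (\<lambda>t. c \<odot>\<^bsub>P\<^esub> sw R M N P (f x) t)"
      using x assms by (intro lin_map_scale s module_tensor)
  qed (use x assms lin_map_smult[OF l] s in \<open>auto simp: sw_pure cong del: sw_cong\<close>)
qed

lemma sw_pure_id:
  assumes "module R M" "module R N" "t \<in> carrier (tensor_module R M N)"
  shows "sw R M N (tensor_module R M N) (pure R M N) t = t"
  by (rule tensor_eqI[OF assms(1,2) _ lin_map_id _ assms(3)])
    (use assms(1,2) in \<open>simp_all add: sweedler bilin_map_pure lin_map_sw\<close>)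

subsection \<open>Balanced sums\<close>

lemma balanced_restrict:
  assumes "balance_data R A M N" "balanced A M N f"
  shows "balanced A M N (\<lambda>x y. if x \<in> carrier M \<and> y \<in> carrier N then f x y else undefined)"
  using assms bdD[OF assms(1)] by (auto simp: balanced_def)

lemma lin_map_swA:
  "balance_data R A M N \<Longrightarrow> module R P \<Longrightarrow> bilin_map R M N P f \<Longrightarrow> balanced A M N f \<Longrightarrow>
    lin_map R (tensorA_module R A M N) P (swA R A M N P f)"
  unfolding swA_def by (intro lin_map_tliftA bilin_map_restrict balanced_restrict) (auto dest: bdD)

lemma lin_map_swA2 [sweedler]:
  "balance_data R A M N \<Longrightarrow> module R P \<Longrightarrow> lin_map R X (tensorA_module R A M N) g \<Longrightarrow>
    bilin_map R M N P f \<Longrightarrow> balanced A M N f \<Longrightarrow> lin_map R X P (\<lambda>x. swA R A M N P f (g x))"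
  by (intro lin_map_comp[OF lin_map_swA])

lemma swA_closed [sweedler]:
  "balance_data R A M N \<Longrightarrow> module R P \<Longrightarrow> t \<in> carrier (tensorA_module R A M N) \<Longrightarrow>
    bilin_map R M N P f \<Longrightarrow> balanced A M N f \<Longrightarrow> swA R A M N P f t \<in> carrier P"
  by (rule lin_map_closed[OF lin_map_swA])

lemma swA_pureA [sweedler]:
  "balance_data R A M N \<Longrightarrow> module R P \<Longrightarrow> x \<in> carrier M \<Longrightarrow> y \<in> carrier N \<Longrightarrow>
    bilin_map R M N P f \<Longrightarrow> balanced A M N f \<Longrightarrow> swA R A M N P f (pureA R A M N x y) = f x y"
  unfolding swA_def
  by (subst tliftA_pureA) (auto intro: bilin_map_restrict[OF bdD(1,2)] balanced_restrict)

lemma lin_map_swA1: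
  assumes "balance_data R A M N" "module R P" "module R X"
    and "t \<in> carrier (tensorA_module R A M N)"
    and l: "\<And>u v. u \<in> carrier M \<Longrightarrow> v \<in> carrier N \<Longrightarrow> lin_map R X P (\<lambda>x. f x u v)"
    and b: "\<And>x. x \<in> carrier X \<Longrightarrow> bilin_map R M N P (f x)"
    and c: "\<And>x. x \<in> carrier X \<Longrightarrow> balanced A M N (f x)"
  shows "lin_map R X P (\<lambda>x. swA R A M N P (f x) t)"
proof (rule lin_mapI)
  interpret X: module R X by fact
  fix x assume x: "x \<in> carrier X"
  show "swA R A M N P (f x) t \<in> carrier P"
    using assms x by (simp add: swA_closed)
  note s = lin_map_swA[OF assms(1,2) b c]
  fix y assume y: "y \<in> carrier X"
  show "swA R A M N P (f (x \<oplus>\<^bsub>X\<^esub> y)) t = swA R A M N P (f x) t \<oplus>\<^bsub>P\<^esub> swA R A M N P (f y) t"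
  proof (rule tensorA_eqI[OF assms(1) _ _ _ assms(4)])
    show "lin_map R (tensorA_module R A M N) P (\<lambda>t. swA R A M N P (f x) t \<oplus>\<^bsub>P\<^esub> swA R A M N P (f y) t)"
      using x y assms by (intro lin_map_sum s module_tensorA)
  qed (use x y assms lin_map_add[OF l] s in \<open>auto simp: swA_pureA cong del: swA_cong\<close>)
next
  interpret X: module R X by fact
  fix d x assume x: "d \<in> carrier R" "x \<in> carrier X"
  note s = lin_map_swA[OF assms(1,2) b c]
  show "swA R A M N P (f (d \<odot>\<^bsub>X\<^esub> x)) t = d \<odot>\<^bsub>P\<^esub> swA R A M N P (f x) t"
  proof (rule tensorA_eqI[OF assms(1) _ _ _ assms(4)])
    show "lin_map R (tensorA_module R A M N) P (\<lambda>t. d \<odot>\<^bsub>P\<^esub> swA R A M N P (f x) t)"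
      using x assms by (intro lin_map_scale s module_tensorA)
  qed (use x assms lin_map_smult[OF l] s in \<open>auto simp: swA_pureA cong del: swA_cong\<close>)
qed

lemmas [sweedler] = bilin_map_pure bilin_map_pureA
declare bilin_mapD(1)[OF bilin_map_pure, sweedler] bilin_mapD(1)[OF bilin_map_pureA, sweedler]

lemma pureA_sw1 [sweedler]:
  assumes "balance_data R A M N" "y \<in> carrier N" "module R K" "module R L" "module R P"
    and "lin_map R P M (\<lambda>x. x)" "t \<in> carrier (tensor_module R K L)" "bilin_map R K L P f"
  shows "pureA R A M N (sw R K L P f t) y =
    sw R K L (tensorA_module R A M N) (\<lambda>u v. pureA R A M N (f u v) y) t"
  using sw_push[OF lin_map_pureA1[OF assms(1,2,6)] assms(3-5) module_tensorA[OF assms(1)] assms(7,8)] .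

lemma pureA_sw2 [sweedler]:
  assumes "balance_data R A M N" "x \<in> carrier M" "module R K" "module R L" "module R P"
    and "lin_map R P N (\<lambda>x. x)" "t \<in> carrier (tensor_module R K L)" "bilin_map R K L P f"
  shows "pureA R A M N x (sw R K L P f t) =
    sw R K L (tensorA_module R A M N) (\<lambda>u v. pureA R A M N x (f u v)) t"
  using sw_push[OF lin_map_pureA2[OF assms(1,2,6)] assms(3-5) module_tensorA[OF assms(1)] assms(7,8)] .

section \<open>Objects with an automorphism\<close>

subsection \<open>Records with the same underlying module\<close>

text \<open>
  The same module occurs below as the underlying module of several records, such as
  \<^const>\<open>tensor_module\<close>, \<^const>\<open>tensor\<close>, \<^const>\<open>AC_bimod\<close> and \<^const>\<open>AC_coring\<close>. What depends only on the
  module structure is rewritten to the plain module.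
\<close>

definition same_module :: "('k, 'm, 'y) module_scheme \<Rightarrow> ('k, 'm, 'z) module_scheme \<Rightarrow> bool" where
  "same_module M N \<longleftrightarrow> carrier M = carrier N \<and> add M = add N \<and> zero M = zero N \<and> smult M = smult N"

lemma same_module_basic:
  assumes "same_module X Y"
  shows "carrier X = carrier Y" "add X = add Y" "zero X = zero Y" "smult X = smult Y"
  using assms by (simp_all add: same_module_def)

lemma same_module_module:
  assumes "same_module X Y"
  shows "module R X = module R Y"
  by (simp add: module_def module_axioms_def abelian_group_def abelian_monoid_def
      abelian_group_axioms_def comm_group_def comm_monoid_def monoid_def
      comm_monoid_axioms_def group_def group_axioms_def Units_def same_module_basic[OF assms])

lemma same_module_finsum:
  assumes "same_module X Y"
  shows "finsum X f A = finsum Y f A"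
  by (simp add: finsum_def finprod_def same_module_basic[OF assms])

lemma same_module_lin_map:
  assumes "same_module X Y"
  shows "lin_map R X N f = lin_map R Y N f" "lin_map R M X g = lin_map R M Y g"
  using assms by (simp_all add: lin_map_def same_module_def)

lemma same_module_bilin_map:
  assumes "same_module X Y"
  shows "bilin_map R X N P f = bilin_map R Y N P f" "bilin_map R M X P g = bilin_map R M Y P g"
    "bilin_map R M N X h = bilin_map R M N Y h"
  using assms by (simp_all add: bilin_map_def same_module_lin_map same_module_basic)

lemma same_module_tensor_relations:
  assumes "same_module X Y"
  shows "tensor_relations R X N = tensor_relations R Y N" "tensor_relations R M X = tensor_relations R M Y"
  using assms by (simp_all only: tensor_relations_def same_module_basic)

lemma same_module_tensor:
  assumes "same_module X Y"
  shows "tensor_module R X N = tensor_module R Y N" "tensor_module R M X = tensor_module R M Y"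
    "pure R X N = pure R Y N" "pure R M X = pure R M Y"
  using assms
  by (simp_all add: tensor_module_def tensor_kernel_def pure_def fun_eq_iff
      same_module_tensor_relations[OF assms] same_module_basic[OF assms])

lemma same_module_tlift:
  assumes "same_module X Y"
  shows "tlift R X = tlift R Y"
  by (simp add: tlift_def linext_def fun_eq_iff same_module_basic[OF assms] same_module_finsum[OF assms])

lemma same_module_tliftA:
  assumes "same_module X Y"
  shows "tliftA R X = tliftA R Y"
  by (simp add: tliftA_def fun_eq_iff same_module_tlift[OF assms])

lemma same_module_sw:
  assumes "same_module X Y"
  shows "sw R X N P f = sw R Y N P f" "sw R M X P g = sw R M Y P g" "sw R M N X h = sw R M N Y h"
    "swA R A K L X h' = swA R A K L Y h'"
  by (simp_all add: sw_def swA_def same_module_basic[OF assms] same_module_tlift[OF assms]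
    same_module_tliftA[OF assms])

lemmas same_module_rules = same_module_basic same_module_module same_module_lin_map
  same_module_bilin_map same_module_tensor same_module_tlift same_module_tliftA same_module_sw

lemma same_module_tensor_record: "same_module (tensor R M N) (tensor_module R M N)"
  by (simp add: same_module_def tensor_def module.defs hmod.defs)

lemma same_module_tensorA: "same_module (tensorA R A M N) (tensorA_module R A M N)"
  by (simp add: same_module_def tensorA_def Let_def module.defs hmod.defs rmod.defs)

lemma same_module_tensorAA: "same_module (tensorAA R A M N) (tensorA_module R A M N)"
  by (simp add: same_module_def tensorAA_def tensorA_def Let_def module.defs hmod.defs rmod.defs bimod.defs)

lemmas tensor_record_rules = same_module_rules[OF same_module_tensor_record]
  same_module_rules[OF same_module_tensorA] same_module_rules[OF same_module_tensorAA]

subsection \<open>The category of modules with an automorphism\<close>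

lemma hom_objectD:
  assumes "hom_object R M"
  shows "module R M" "lin_map R M M (aut M)" "bij_betw (aut M) (carrier M) (carrier M)"
  using assms by (simp_all add: hom_object_def)

lemma aut_closed: "hom_object R M \<Longrightarrow> x \<in> carrier M \<Longrightarrow> aut M x \<in> carrier M"
  by (rule lin_map_closed[OF hom_objectD(2)])

lemma ainv_closed: "hom_object R M \<Longrightarrow> x \<in> carrier M \<Longrightarrow> ainv M x \<in> carrier M"
  unfolding ainv_def by (metis hom_objectD(3) bij_betw_imp_surj_on inv_into_into)

lemma aut_ainv: "hom_object R M \<Longrightarrow> x \<in> carrier M \<Longrightarrow> aut M (ainv M x) = x"
  unfolding ainv_def by (metis hom_objectD(3) bij_betw_inv_into_right)

lemma ainv_aut: "hom_object R M \<Longrightarrow> x \<in> carrier M \<Longrightarrow> ainv M (aut M x) = x"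
  unfolding ainv_def by (metis hom_objectD(3) bij_betw_inv_into_left)

lemma ainv_eqI: "hom_object R M \<Longrightarrow> y \<in> carrier M \<Longrightarrow> aut M y = x \<Longrightarrow> ainv M x = y"
  using ainv_aut[of R M y] by simp

lemma lin_map_ainv:
  assumes "hom_object R M"
  shows "lin_map R M M (ainv M)"
proof -
  interpret M: module R M by (rule hom_objectD[OF assms])
  note [simp] = aut_ainv[OF assms] ainv_closed[OF assms] lin_map_add[OF hom_objectD(2)[OF assms]]
    lin_map_smult[OF hom_objectD(2)[OF assms]]
  show ?thesis by (rule lin_mapI) (auto intro!: ainv_eqI[OF assms])
qed

lemma lin_map_aut_comp: "hom_object R M \<Longrightarrow> lin_map R X M g \<Longrightarrow> lin_map R X M (\<lambda>x. aut M (g x))"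
  by (rule lin_map_comp[OF hom_objectD(2)])

lemma lin_map_ainv_comp: "hom_object R M \<Longrightarrow> lin_map R X M g \<Longrightarrow> lin_map R X M (\<lambda>x. ainv M (g x))"
  by (rule lin_map_comp[OF lin_map_ainv])

lemma aut_sw:
  "hom_object R P \<Longrightarrow> module R M \<Longrightarrow> module R N \<Longrightarrow> t \<in> carrier (tensor_module R M N) \<Longrightarrow>
    bilin_map R M N P f \<Longrightarrow> aut P (sw R M N P f t) = sw R M N P (\<lambda>x y. aut P (f x y)) t"
  by (intro sw_push hom_objectD)

lemma ainv_sw:
  "hom_object R P \<Longrightarrow> module R M \<Longrightarrow> module R N \<Longrightarrow> t \<in> carrier (tensor_module R M N) \<Longrightarrow>
    bilin_map R M N P f \<Longrightarrow> ainv P (sw R M N P f t) = sw R M N P (\<lambda>x y. ainv P (f x y)) t"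
  by (intro sw_push lin_map_ainv hom_objectD(1))

lemmas hom_object_rules = hom_objectD(1) aut_closed ainv_closed aut_ainv ainv_aut
  lin_map_aut_comp lin_map_ainv_comp hom_objectD(2) lin_map_ainv aut_sw ainv_sw
  lin_map_smult[OF hom_objectD(2)] lin_map_smult[OF lin_map_ainv]

lemma aut_inj: "hom_object R M \<Longrightarrow> x \<in> carrier M \<Longrightarrow> y \<in> carrier M \<Longrightarrow> aut M x = aut M y \<longleftrightarrow> x = y"
  by (metis ainv_aut)

lemma hom_objectI:
  assumes "module R M" "lin_map R M M (aut M)" "\<And>x. x \<in> carrier M \<Longrightarrow> g x \<in> carrier M"
    and "\<And>x. x \<in> carrier M \<Longrightarrow> aut M (g x) = x" "\<And>x. x \<in> carrier M \<Longrightarrow> g (aut M x) = x"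
  shows "hom_object R M"
  unfolding hom_object_def using assms lin_map_closed[OF assms(2)]
  by (auto intro!: bij_betw_byWitness[of _ g])

context
  fixes R :: "('k, 'r) ring_scheme" and M :: "('k, 'm, 'y) hmod_scheme" and N :: "('k, 'n, 'z) hmod_scheme"
  assumes M: "hom_object R M" and N: "hom_object R N"
begin

lemmas [simp] = hom_object_rules[OF M] hom_object_rules[OF N]

lemma aut_tensor:
  "t \<in> carrier (tensor_module R M N) \<Longrightarrow> aut (tensor R M N) t =
    sw R M N (tensor_module R M N) (\<lambda>x y. pure R M N (aut M x) (aut N y)) t"
  by (simp add: tensor_def module.defs hmod.defs tlift_eq_sw)

lemma aut_tensor_pure:
  "x \<in> carrier M \<Longrightarrow> y \<in> carrier N \<Longrightarrow>
    aut (tensor R M N) (pure R M N x y) = pure R M N (aut M x) (aut N y)"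
  by (simp add: aut_tensor sweedler)

lemma hom_object_tensor: "hom_object R (tensor R M N)"
proof (rule hom_objectI)
  let ?T = "tensor_module R M N"
  let ?g = "sw R M N ?T (\<lambda>x y. pure R M N (ainv M x) (ainv N y))"
  show "module R (tensor R M N)" by (simp add: tensor_record_rules sweedler)
  have l: "lin_map R ?T ?T (aut (tensor R M N))"
    by (rule lin_map_cong[OF _ aut_tensor[symmetric]]) (simp_all add: sweedler)
  thus "lin_map R (tensor R M N) (tensor R M N) (aut (tensor R M N))"
    by (simp add: tensor_record_rules)
  fix t assume "t \<in> carrier (tensor R M N)"
  hence t: "t \<in> carrier ?T" by (simp add: tensor_record_rules)
  show g: "?g t \<in> carrier (tensor R M N)"
    using t by (simp add: tensor_record_rules sweedler)
  show "aut (tensor R M N) (?g t) = t"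
    by (rule tensor_eqI[OF _ _ _ _ _ t, where P = ?T])
      (simp_all add: sweedler aut_tensor_pure lin_map_comp[OF l])
  show "?g (aut (tensor R M N) t) = t"
    by (rule tensor_eqI[OF _ _ _ _ _ t, where P = ?T])
      (simp_all add: sweedler aut_tensor_pure l)
qed

lemma ainv_tensor_pure:
  "x \<in> carrier M \<Longrightarrow> y \<in> carrier N \<Longrightarrow>
    ainv (tensor R M N) (pure R M N x y) = pure R M N (ainv M x) (ainv N y)"
  by (rule ainv_eqI[OF hom_object_tensor]) (simp_all add: tensor_record_rules sweedler aut_tensor_pure)

end

section \<open>Monoidal Hom-algebras and their modules\<close>

lemma hom_algebraD:
  assumes "hom_algebra R A"
  shows "hom_object R A" "bilin_map R A A A (mult A)" "\<one>\<^bsub>A\<^esub> \<in> carrier A"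
    "a \<in> carrier A \<Longrightarrow> b \<in> carrier A \<Longrightarrow> c \<in> carrier A \<Longrightarrow>
      aut A a \<otimes>\<^bsub>A\<^esub> (b \<otimes>\<^bsub>A\<^esub> c) = (a \<otimes>\<^bsub>A\<^esub> b) \<otimes>\<^bsub>A\<^esub> aut A c"
    "a \<in> carrier A \<Longrightarrow> a \<otimes>\<^bsub>A\<^esub> \<one>\<^bsub>A\<^esub> = aut A a"
    "a \<in> carrier A \<Longrightarrow> \<one>\<^bsub>A\<^esub> \<otimes>\<^bsub>A\<^esub> a = aut A a"
    "a \<in> carrier A \<Longrightarrow> b \<in> carrier A \<Longrightarrow> aut A (a \<otimes>\<^bsub>A\<^esub> b) = aut A a \<otimes>\<^bsub>A\<^esub> aut A b"
    "aut A \<one>\<^bsub>A\<^esub> = \<one>\<^bsub>A\<^esub>"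
  using assms by (simp_all add: hom_algebra_def)

lemma right_hom_moduleD:
  assumes "right_hom_module R A M"
  shows "hom_object R M" "bilin_map R M A M (ract M)"
    "m \<in> carrier M \<Longrightarrow> a \<in> carrier A \<Longrightarrow> b \<in> carrier A \<Longrightarrow>
      ract M (aut M m) (a \<otimes>\<^bsub>A\<^esub> b) = ract M (ract M m a) (aut A b)"
    "m \<in> carrier M \<Longrightarrow> ract M m \<one>\<^bsub>A\<^esub> = aut M m"
    "m \<in> carrier M \<Longrightarrow> a \<in> carrier A \<Longrightarrow> aut M (ract M m a) = ract M (aut M m) (aut A a)"
  using assms by (simp_all add: right_hom_module_def)

lemma left_hom_moduleD:
  assumes "left_hom_module R A M"
  shows "hom_object R M" "bilin_map R A M M (lact M)"
    "m \<in> carrier M \<Longrightarrow> a \<in> carrier A \<Longrightarrow> b \<in> carrier A \<Longrightarrow>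
      lact M (aut A a) (lact M b m) = lact M (a \<otimes>\<^bsub>A\<^esub> b) (aut M m)"
    "m \<in> carrier M \<Longrightarrow> lact M \<one>\<^bsub>A\<^esub> m = aut M m"
    "m \<in> carrier M \<Longrightarrow> a \<in> carrier A \<Longrightarrow> aut M (lact M a m) = lact M (aut A a) (aut M m)"
  using assms by (simp_all add: left_hom_module_def)

lemma hom_bimoduleD:
  assumes "hom_bimodule R A M"
  shows "left_hom_module R A M" "right_hom_module R A M"
    "m \<in> carrier M \<Longrightarrow> a \<in> carrier A \<Longrightarrow> b \<in> carrier A \<Longrightarrow>
      ract M (lact M a m) (aut A b) = lact M (aut A a) (ract M m b)"
  using assms by (simp_all add: hom_bimodule_def)

text \<open>
  The rules collected below rewrite every expression in Hom-associative operations to a normal form: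
  automorphisms are moved to the leaves, products are bracketed to the right, and an element that
  acts from the right on \<open>a m\<close> is moved past \<open>a\<close>.
\<close>

context
  fixes R :: "('k, 'r) ring_scheme" and A :: "('k, 'a, 'x) hmod_scheme"
  assumes A: "hom_algebra R A"
begin

lemmas [simp] = hom_object_rules[OF hom_algebraD(1)[OF A]] hom_algebraD(3,5-)[OF A]

lemma mult_closed [simp]: "a \<in> carrier A \<Longrightarrow> b \<in> carrier A \<Longrightarrow> a \<otimes>\<^bsub>A\<^esub> b \<in> carrier A"
  by (rule bilin_map_closed[OF hom_algebraD(2)[OF A]])

lemma ainv_one: "ainv A \<one>\<^bsub>A\<^esub> = \<one>\<^bsub>A\<^esub>"
  by (rule ainv_eqI[OF hom_algebraD(1)[OF A]]) simp_all

lemma ainv_mult [simp]: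
  "a \<in> carrier A \<Longrightarrow> b \<in> carrier A \<Longrightarrow> ainv A (a \<otimes>\<^bsub>A\<^esub> b) = ainv A a \<otimes>\<^bsub>A\<^esub> ainv A b"
  by (rule ainv_eqI[OF hom_algebraD(1)[OF A]]) simp_all

lemma mult_assoc:
  "a \<in> carrier A \<Longrightarrow> b \<in> carrier A \<Longrightarrow> c \<in> carrier A \<Longrightarrow>
    (a \<otimes>\<^bsub>A\<^esub> b) \<otimes>\<^bsub>A\<^esub> c = aut A a \<otimes>\<^bsub>A\<^esub> (b \<otimes>\<^bsub>A\<^esub> ainv A c)"
  using hom_algebraD(4)[OF A, of a b "ainv A c"] by simp

lemmas hom_algebra_rules = hom_object_rules[OF hom_algebraD(1)[OF A]] hom_algebraD(3,5-)[OF A]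
  mult_closed ainv_one ainv_mult mult_assoc
  lin_map_bilin1[OF hom_algebraD(2)[OF A]] lin_map_bilin2[OF hom_algebraD(2)[OF A]]
  sw_push1[OF hom_algebraD(2)[OF A]] sw_push2[OF hom_algebraD(2)[OF A]]
  bilin_map_smult1[OF hom_algebraD(2)[OF A]] bilin_map_smult2[OF hom_algebraD(2)[OF A]]

context
  fixes M :: "('k, 'm, 'a, 'y) rmod_scheme"
  assumes M: "right_hom_module R A M"
begin

lemmas [simp] = hom_object_rules[OF right_hom_moduleD(1)[OF M]] right_hom_moduleD(4-)[OF M]

lemma ract_closed [simp]: "m \<in> carrier M \<Longrightarrow> a \<in> carrier A \<Longrightarrow> ract M m a \<in> carrier M"
  by (rule bilin_map_closed[OF right_hom_moduleD(2)[OF M]])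

lemma ainv_ract:
  "m \<in> carrier M \<Longrightarrow> a \<in> carrier A \<Longrightarrow> ainv M (ract M m a) = ract M (ainv M m) (ainv A a)"
  by (rule ainv_eqI[OF right_hom_moduleD(1)[OF M]]) simp_all

lemma ract_assoc:
  "m \<in> carrier M \<Longrightarrow> a \<in> carrier A \<Longrightarrow> b \<in> carrier A \<Longrightarrow>
    ract M (ract M m a) b = ract M (aut M m) (a \<otimes>\<^bsub>A\<^esub> ainv A b)"
  using right_hom_moduleD(3)[OF M, of m a "ainv A b"] by simp

lemmas right_hom_module_rules = hom_object_rules[OF right_hom_moduleD(1)[OF M]]
  right_hom_moduleD(4-)[OF M] ract_closed ainv_ract ract_assoc
  lin_map_bilin1[OF right_hom_moduleD(2)[OF M]] lin_map_bilin2[OF right_hom_moduleD(2)[OF M]]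
  sw_push1[OF right_hom_moduleD(2)[OF M]] sw_push2[OF right_hom_moduleD(2)[OF M]]
  bilin_map_smult1[OF right_hom_moduleD(2)[OF M]] bilin_map_smult2[OF right_hom_moduleD(2)[OF M]]

end

context
  fixes M :: "('k, 'm, 'a, 'y) bimod_scheme"
  assumes M: "left_hom_module R A M"
begin

lemmas [simp] = hom_object_rules[OF left_hom_moduleD(1)[OF M]] left_hom_moduleD(4-)[OF M]

lemma lact_closed [simp]: "a \<in> carrier A \<Longrightarrow> m \<in> carrier M \<Longrightarrow> lact M a m \<in> carrier M"
  by (rule bilin_map_closed[OF left_hom_moduleD(2)[OF M]])

lemma ainv_lact:
  "a \<in> carrier A \<Longrightarrow> m \<in> carrier M \<Longrightarrow> ainv M (lact M a m) = lact M (ainv A a) (ainv M m)"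
  by (rule ainv_eqI[OF left_hom_moduleD(1)[OF M]]) simp_all

lemma lact_assoc:
  "m \<in> carrier M \<Longrightarrow> a \<in> carrier A \<Longrightarrow> b \<in> carrier A \<Longrightarrow>
    lact M a (lact M b m) = lact M (ainv A a \<otimes>\<^bsub>A\<^esub> b) (aut M m)"
  using left_hom_moduleD(3)[OF M, of m "ainv A a" b] by simp

lemmas left_hom_module_rules = hom_object_rules[OF left_hom_moduleD(1)[OF M]]
  left_hom_moduleD(4-)[OF M] lact_closed ainv_lact lact_assoc
  lin_map_bilin1[OF left_hom_moduleD(2)[OF M]] lin_map_bilin2[OF left_hom_moduleD(2)[OF M]]
  sw_push1[OF left_hom_moduleD(2)[OF M]] sw_push2[OF left_hom_moduleD(2)[OF M]]
  bilin_map_smult1[OF left_hom_moduleD(2)[OF M]] bilin_map_smult2[OF left_hom_moduleD(2)[OF M]]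

end

context
  fixes M :: "('k, 'm, 'a, 'y) bimod_scheme"
  assumes M: "hom_bimodule R A M"
begin

lemma lact_ract:
  "m \<in> carrier M \<Longrightarrow> a \<in> carrier A \<Longrightarrow> b \<in> carrier A \<Longrightarrow>
    ract M (lact M a m) b = lact M (aut A a) (ract M m (ainv A b))"
  using hom_bimoduleD(3)[OF M, of m a "ainv A b"] by simp

lemmas hom_bimodule_rules = right_hom_module_rules[OF hom_bimoduleD(2)[OF M]]
  left_hom_module_rules[OF hom_bimoduleD(1)[OF M]] lact_ract

end

end

section \<open>The structure of the tensor product over a Hom-algebra\<close>

locale right_module_bimodule =
  fixes R :: "('k, 'r) ring_scheme" and A :: "('k, 'a, 'x) hmod_scheme"
    and M :: "('k, 'm, 'a, 'y) rmod_scheme" and N :: "('k, 'n, 'a, 'z) bimod_scheme"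
  assumes A: "hom_algebra R A" and M: "right_hom_module R A M" and N: "hom_bimodule R A N"
begin

lemmas [simp] = hom_algebra_rules[OF A] right_hom_module_rules[OF A M] hom_bimodule_rules[OF A N]

lemma balance_data: "balance_data R A M N"
  by (simp add: balance_data_def)

lemmas [simp] = balance_data

abbreviation "MN \<equiv> tensorA_module R A M N"
abbreviation "p \<equiv> pureA R A M N"

lemma pureA_ract [simp]:
  "m \<in> carrier M \<Longrightarrow> a \<in> carrier A \<Longrightarrow> n \<in> carrier N \<Longrightarrow> p (ract M m a) n = p (aut M m) (lact N a (ainv N n))"
  by (rule pureA_balanced) simp_all

lemma aut_tensorA:
  "t \<in> carrier MN \<Longrightarrow> aut (tensorA R A M N) t = swA R A M N MN (\<lambda>m n. p (aut M m) (aut N n)) t"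
  by (simp add: tensorA_def Let_def module.defs hmod.defs rmod.defs tliftA_eq_swA)

lemma ract_tensorA:
  "t \<in> carrier MN \<Longrightarrow> ract (tensorA R A M N) t a =
    swA R A M N MN (\<lambda>m n. p (aut M m) (ract N n (ainv A a))) t"
  by (simp add: tensorA_def Let_def module.defs hmod.defs rmod.defs tliftA_eq_swA)

lemma balanced_aut [simp]: "balanced A M N (\<lambda>m n. p (aut M m) (aut N n))"
  by (rule balancedI) simp

lemma balanced_ainv [simp]: "balanced A M N (\<lambda>m n. p (ainv M m) (ainv N n))"
  by (rule balancedI) simp

lemma balanced_ract [simp]: "a \<in> carrier A \<Longrightarrow> balanced A M N (\<lambda>m n. p (aut M m) (ract N n (ainv A a)))"
  by (rule balancedI) simp

lemma aut_tensorA_pureA [simp]: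
  "m \<in> carrier M \<Longrightarrow> n \<in> carrier N \<Longrightarrow> aut (tensorA R A M N) (p m n) = p (aut M m) (aut N n)"
  by (simp add: aut_tensorA sweedler)

lemma ract_tensorA_pureA [simp]:
  "m \<in> carrier M \<Longrightarrow> n \<in> carrier N \<Longrightarrow> a \<in> carrier A \<Longrightarrow>
    ract (tensorA R A M N) (p m n) a = p (aut M m) (ract N n (ainv A a))"
  by (simp add: ract_tensorA sweedler)

lemma lin_map_aut_tensorA: "lin_map R MN MN (aut (tensorA R A M N))"
  by (rule lin_map_cong[OF _ aut_tensorA[symmetric]]) (simp_all add: sweedler)

lemma lin_map_ract_tensorA:
  "a \<in> carrier A \<Longrightarrow> lin_map R MN MN (\<lambda>t. ract (tensorA R A M N) t a)"
  by (rule lin_map_cong[OF _ ract_tensorA[symmetric]]) (simp_all add: sweedler)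

lemma hom_object_tensorA: "hom_object R (tensorA R A M N)"
proof (rule hom_objectI)
  let ?g = "swA R A M N MN (\<lambda>x y. p (ainv M x) (ainv N y))"
  show "module R (tensorA R A M N)" by (simp add: tensor_record_rules sweedler)
  note l = lin_map_aut_tensorA
  thus "lin_map R (tensorA R A M N) (tensorA R A M N) (aut (tensorA R A M N))"
    by (simp add: tensor_record_rules)
  fix t assume "t \<in> carrier (tensorA R A M N)"
  hence t: "t \<in> carrier MN" by (simp add: tensor_record_rules)
  show g: "?g t \<in> carrier (tensorA R A M N)"
    using t by (simp add: tensor_record_rules sweedler)
  show "aut (tensorA R A M N) (?g t) = t"
    by (rule tensorA_eqI[OF _ _ _ _ t, where P = MN])
      (simp_all add: sweedler lin_map_comp[OF l])
  show "?g (aut (tensorA R A M N) t) = t"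
    by (rule tensorA_eqI[OF _ _ _ _ t, where P = MN])
      (simp_all add: sweedler l)
qed

lemma ainv_tensorA_pureA [simp]:
  "m \<in> carrier M \<Longrightarrow> n \<in> carrier N \<Longrightarrow> ainv (tensorA R A M N) (p m n) = p (ainv M m) (ainv N n)"
  by (rule ainv_eqI[OF hom_object_tensorA]) (simp_all add: tensor_record_rules sweedler)

end

locale bimodule_bimodule = right_module_bimodule R A M N
  for R :: "('k, 'r) ring_scheme" and A :: "('k, 'a, 'x) hmod_scheme"
    and M :: "('k, 'm, 'a, 'y) bimod_scheme" and N :: "('k, 'n, 'a, 'z) bimod_scheme" +
  assumes M': "hom_bimodule R A M"
begin

lemmas [simp] = hom_bimodule_rules[OF A M']

lemma tensorAA_fields:
  "aut (tensorAA R A M N) = aut (tensorA R A M N)" "ract (tensorAA R A M N) = ract (tensorA R A M N)"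
  by (simp_all add: tensorAA_def tensorA_def Let_def module.defs hmod.defs rmod.defs bimod.defs)

lemma ainv_tensorAA: "ainv (tensorAA R A M N) = ainv (tensorA R A M N)"
  by (simp add: ainv_def tensorAA_fields tensor_record_rules)

lemma lact_tensorAA:
  "t \<in> carrier MN \<Longrightarrow> lact (tensorAA R A M N) a t =
    swA R A M N MN (\<lambda>m n. p (lact M (ainv A a) m) (aut N n)) t"
  by (simp add: tensorAA_def tensorA_def Let_def module.defs hmod.defs rmod.defs bimod.defs tliftA_eq_swA)

lemma balanced_lact [simp]: "a \<in> carrier A \<Longrightarrow> balanced A M N (\<lambda>m n. p (lact M (ainv A a) m) (aut N n))"
proof (rule balancedI)
  fix m b n assume *: "a \<in> carrier A" "m \<in> carrier M" "b \<in> carrier A" "n \<in> carrier N"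
  \<comment> \<open>To move \<open>b\<close> across the tensor sign it must act last.\<close>
  have "lact M (ainv A a) (ract M m b) = ract M (lact M (ainv A (ainv A a)) m) (aut A b)"
    using * by simp
  hence "p (lact M (ainv A a) (ract M m b)) (aut N n) =
      p (ract M (lact M (ainv A (ainv A a)) m) (aut A b)) (aut N n)" by simp
  thus "p (lact M (ainv A a) (ract M m b)) (aut N n) = p (lact M (ainv A a) (aut M m)) (aut N (lact N b (ainv N n)))"
    using * by (simp del: lact_ract[OF A M'])
qed

lemma lact_tensorAA_pureA [simp]:
  "m \<in> carrier M \<Longrightarrow> n \<in> carrier N \<Longrightarrow> a \<in> carrier A \<Longrightarrow>
    lact (tensorAA R A M N) a (p m n) = p (lact M (ainv A a) m) (aut N n)"
  by (simp add: lact_tensorAA sweedler)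

lemma bilin_map_lact_tensorAA: "bilin_map R A MN MN (lact (tensorAA R A M N))"
proof (rule bilin_mapI)
  show "lin_map R MN MN (lact (tensorAA R A M N) a)" if "a \<in> carrier A" for a
    using that by (intro lin_map_cong[OF _ lact_tensorAA[symmetric]]) (simp_all add: sweedler)
  show "lin_map R A MN (\<lambda>a. lact (tensorAA R A M N) a t)" if "t \<in> carrier MN" for t
    using that by (simp add: lact_tensorAA lin_map_swA1 sweedler cong del: lin_map_weak_cong)
qed

end

section \<open>Monoidal Hom-coalgebras and their comodules\<close>

lemma lin_map_scalar:
  assumes "module R P" "lin_map R X (self_module R) h" "y \<in> carrier P"
  shows "lin_map R X P (\<lambda>x. h x \<odot>\<^bsub>P\<^esub> y)"
proof -
  interpret P: module R P by fact
  show ?thesis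
    using assms(2,3)
    by (auto simp: lin_map_def self_module_def Pi_iff P.smult_l_distr P.smult_assoc1)
qed

lemma smult_closed: "module R P \<Longrightarrow> s \<in> carrier R \<Longrightarrow> x \<in> carrier P \<Longrightarrow> s \<odot>\<^bsub>P\<^esub> x \<in> carrier P"
  by (rule module.smult_closed)

lemmas [sweedler] = lin_map_scalar lin_map_scale smult_closed

lemma pure_smult1 [sweedler]:
  "module R M \<Longrightarrow> module R N \<Longrightarrow> s \<in> carrier R \<Longrightarrow> x \<in> carrier M \<Longrightarrow> y \<in> carrier N \<Longrightarrow>
    pure R M N (s \<odot>\<^bsub>M\<^esub> x) y = s \<odot>\<^bsub>tensor_module R M N\<^esub> pure R M N x y"
  by (rule pure_smult_left)

lemma hom_coalgebraD:
  assumes "hom_coalgebra R C"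
  shows "hom_object R C" "lin_map R C (tensor_module R C C) (comult C)"
    "lin_map R C (self_module R) (counit C)"
    "c \<in> carrier C \<Longrightarrow> counit C (aut C c) = counit C c"
  using assms by (simp_all add: hom_coalgebra_def tensor_record_rules)

lemma counit_closed: "hom_coalgebra R C \<Longrightarrow> c \<in> carrier C \<Longrightarrow> counit C c \<in> carrier R"
  using lin_map_closed[OF hom_coalgebraD(3)] by (fastforce simp: self_module_def)

lemma comult_closed: "hom_coalgebra R C \<Longrightarrow> c \<in> carrier C \<Longrightarrow> comult C c \<in> carrier (tensor_module R C C)"
  by (rule lin_map_closed[OF hom_coalgebraD(2)])

lemma counit_ainv: "hom_coalgebra R C \<Longrightarrow> c \<in> carrier C \<Longrightarrow> counit C (ainv C c) = counit C c"
  by (metis hom_coalgebraD(1,4) aut_ainv ainv_closed)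

lemmas hom_coalgebra_basic = hom_object_rules[OF hom_coalgebraD(1)] hom_coalgebraD(2-4)
  counit_closed counit_ainv comult_closed
  lin_map_comp[OF hom_coalgebraD(2)] lin_map_comp[OF hom_coalgebraD(3)]

lemma comodule_over_itself:
  assumes "hom_coalgebra R C"
  shows "hom_comodule R C C (comult C)"
  using assms by (simp add: hom_coalgebra_def hom_comodule_def)

context
  fixes R :: "('k, 'r) ring_scheme" and C :: "('k, 'c, 'x) coalg_scheme"
  assumes C: "hom_coalgebra R C"
begin

lemmas [simp] = hom_coalgebra_basic[OF C]

lemma hom_comoduleI:
  fixes M :: "('k, 'm, 'y) hmod_scheme"
  assumes [simp]: "hom_object R M" and \<rho>: "lin_map R M (tensor_module R M C) \<rho>"
    and "\<And>m. m \<in> carrier M \<Longrightarrow>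
      sw R M C (tensor_module R M (tensor_module R C C))
        (\<lambda>m0 m1. pure R M (tensor_module R C C) (ainv M m0) (comult C m1)) (\<rho> m) =
      sw R M C (tensor_module R M (tensor_module R C C))
        (\<lambda>m0 m1. sw R M C (tensor_module R M (tensor_module R C C))
          (\<lambda>m00 m01. pure R M (tensor_module R C C) m00 (pure R C C m01 (ainv C m1))) (\<rho> m0)) (\<rho> m)"
    and "\<And>m. m \<in> carrier M \<Longrightarrow> sw R M C M (\<lambda>m0 m1. counit C m1 \<odot>\<^bsub>M\<^esub> m0) (\<rho> m) = ainv M m"
    and "\<And>m. m \<in> carrier M \<Longrightarrow>
      \<rho> (aut M m) = sw R M C (tensor_module R M C) (\<lambda>m0 m1. pure R M C (aut M m0) (aut C m1)) (\<rho> m)"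
  shows "hom_comodule R C M \<rho>"
proof -
  note [simp] = hom_object_rules[OF assms(1)]
  have [simp]: "\<rho> m \<in> carrier (tensor_module R M C)" if "m \<in> carrier M" for m
    using lin_map_closed[OF \<rho> that] .
  show ?thesis
    unfolding hom_comodule_def
    using assms by (simp add: tensor_record_rules tlift_eq_sw[where M = M and N = C])
qed

context
  fixes M :: "('k, 'm, 'y) hmod_scheme" and \<rho>
  assumes M: "hom_comodule R C M \<rho>"
begin

lemma hom_comoduleD: "hom_object R M" "lin_map R M (tensor_module R M C) \<rho>"
  using M by (simp_all add: hom_comodule_def tensor_record_rules)

lemmas [simp] = hom_object_rules[OF hom_comoduleD(1)]

lemma coaction_closed [simp]: "m \<in> carrier M \<Longrightarrow> \<rho> m \<in> carrier (tensor_module R M C)"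
  by (rule lin_map_closed[OF hom_comoduleD(2)])

lemma lin_map_coaction [simp]: "lin_map R X M g \<Longrightarrow> lin_map R X (tensor_module R M C) (\<lambda>x. \<rho> (g x))"
  by (rule lin_map_comp[OF hom_comoduleD(2)])

lemma coaction_aut:
  "m \<in> carrier M \<Longrightarrow>
    \<rho> (aut M m) = sw R M C (tensor_module R M C) (\<lambda>m0 m1. pure R M C (aut M m0) (aut C m1)) (\<rho> m)"
  using M by (simp add: hom_comodule_def tensor_record_rules tlift_eq_sw[where M = M and N = C])

lemma coaction_ainv:
  assumes m: "m \<in> carrier M"
  shows "\<rho> (ainv M m) = sw R M C (tensor_module R M C) (\<lambda>m0 m1. pure R M C (ainv M m0) (ainv C m1)) (\<rho> m)"
proof -
  have "\<rho> m = \<rho> (aut M (ainv M m))" using m by simp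
  also have "\<dots> = sw R M C (tensor_module R M C) (\<lambda>m0 m1. pure R M C (aut M m0) (aut C m1)) (\<rho> (ainv M m))"
    using m by (intro coaction_aut) simp
  finally show ?thesis
    using m by (simp add: sweedler sw_pure_id)
qed

lemma coaction_counit_raw:
  "m \<in> carrier M \<Longrightarrow> sw R M C M (\<lambda>m0 m1. counit C m1 \<odot>\<^bsub>M\<^esub> m0) (\<rho> m) = ainv M m"
  using M by (simp add: hom_comodule_def tensor_record_rules tlift_eq_sw[where M = M and N = C])

lemma coaction_coassoc_raw:
  "m \<in> carrier M \<Longrightarrow>
      sw R M C (tensor_module R M (tensor_module R C C))
        (\<lambda>m0 m1. pure R M (tensor_module R C C) (ainv M m0) (comult C m1)) (\<rho> m) =
      sw R M C (tensor_module R M (tensor_module R C C))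
        (\<lambda>m0 m1. sw R M C (tensor_module R M (tensor_module R C C))
          (\<lambda>m00 m01. pure R M (tensor_module R C C) m00 (pure R C C m01 (ainv C m1))) (\<rho> m0)) (\<rho> m)"
  using M by (simp add: hom_comodule_def tensor_record_rules tlift_eq_sw[where M = M and N = C])

text \<open>
  Applying a linear map to the counit or coassociativity law gives the form in which Sweedler
  notation uses it, with an arbitrary (tri)linear expression in the components.
\<close>

lemma coaction_counit:
  assumes [simp]: "module R Q" and h: "lin_map R M Q h" and m: "m \<in> carrier M"
  shows "sw R M C Q (\<lambda>m0 m1. counit C m1 \<odot>\<^bsub>Q\<^esub> h m0) (\<rho> m) = h (ainv M m)"
proof -
  have "h (ainv M m) = h (sw R M C M (\<lambda>m0 m1. counit C m1 \<odot>\<^bsub>M\<^esub> m0) (\<rho> m))"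
    using coaction_counit_raw[OF m] by simp
  also have "\<dots> = sw R M C Q (\<lambda>m0 m1. h (counit C m1 \<odot>\<^bsub>M\<^esub> m0)) (\<rho> m)"
    using m by (intro sw_push h) (simp_all add: sweedler)
  finally show ?thesis by (simp add: lin_map_smult[OF h])
qed

lemma coaction_coassoc:
  assumes [simp]: "module R Q"
    and g1: "\<And>y z. y \<in> carrier C \<Longrightarrow> z \<in> carrier C \<Longrightarrow> lin_map R M Q (\<lambda>x. g x y z)"
    and g2: "\<And>x z. x \<in> carrier M \<Longrightarrow> z \<in> carrier C \<Longrightarrow> lin_map R C Q (\<lambda>y. g x y z)"
    and g3: "\<And>x y. x \<in> carrier M \<Longrightarrow> y \<in> carrier C \<Longrightarrow> lin_map R C Q (\<lambda>z. g x y z)"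
    and m: "m \<in> carrier M"
  shows "sw R M C Q (\<lambda>m0 m1. sw R C C Q (\<lambda>c1 c2. g (ainv M m0) c1 c2) (comult C m1)) (\<rho> m) =
    sw R M C Q (\<lambda>m0 m1. sw R M C Q (\<lambda>m00 m01. g m00 m01 (ainv C m1)) (\<rho> m0)) (\<rho> m)"
proof -
  let ?CC = "tensor_module R C C"
  let ?h = "sw R M ?CC Q (\<lambda>x t. sw R C C Q (\<lambda>c1 c2. g x c1 c2) t)"
  note [simp] = lin_map_comp[OF g1] lin_map_comp[OF g2] lin_map_comp[OF g3] g1 g2 g3
  have "?h (sw R M C (tensor_module R M ?CC) (\<lambda>m0 m1. pure R M ?CC (ainv M m0) (comult C m1)) (\<rho> m)) =
    ?h (sw R M C (tensor_module R M ?CC) (\<lambda>m0 m1. sw R M C (tensor_module R M ?CC)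
          (\<lambda>m00 m01. pure R M ?CC m00 (pure R C C m01 (ainv C m1))) (\<rho> m0)) (\<rho> m))"
    by (simp only: coaction_coassoc_raw[OF m])
  thus ?thesis
    using m by (simp add: sweedler)
qed

end

lemma counit_left:
  assumes [simp]: "module R Q" and h: "lin_map R C Q h" and c: "c \<in> carrier C"
  shows "sw R C C Q (\<lambda>c1 c2. counit C c1 \<odot>\<^bsub>Q\<^esub> h c2) (comult C c) = h (ainv C c)"
proof -
  have "ainv C c = sw R C C C (\<lambda>c1 c2. counit C c1 \<odot>\<^bsub>C\<^esub> c2) (comult C c)"
    using C c by (simp add: hom_coalgebra_def tensor_record_rules tlift_eq_sw[where M = C and N = C])
  hence "h (ainv C c) = h (sw R C C C (\<lambda>c1 c2. counit C c1 \<odot>\<^bsub>C\<^esub> c2) (comult C c))"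
    by simp
  also have "\<dots> = sw R C C Q (\<lambda>c1 c2. h (counit C c1 \<odot>\<^bsub>C\<^esub> c2)) (comult C c)"
    using c by (intro sw_push h) (simp_all add: sweedler)
  finally show ?thesis by (simp add: lin_map_smult[OF h])
qed

lemmas counit_right = coaction_counit[OF comodule_over_itself[OF C]]
lemmas comult_coassoc = coaction_coassoc[OF comodule_over_itself[OF C]]
lemmas comult_aut = coaction_aut[OF comodule_over_itself[OF C]]
lemmas comult_ainv = coaction_ainv[OF comodule_over_itself[OF C]]

end

section \<open>The Hom-bimodule \<open>A \<otimes> C\<close>\<close>

lemma same_module_AC_bimod: "same_module (AC_bimod R A C r) (tensor_module R A C)"
  by (simp add: same_module_def AC_bimod_def tensor_def module.defs hmod.defs rmod.defs bimod.defs)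

lemma AC_bimod_fields:
  "aut (AC_bimod R A C r) = aut (tensor R A C)" "ract (AC_bimod R A C r) = r"
  "lact (AC_bimod R A C r) a = tlift R (tensor_module R A C) (\<lambda>a' c. pure R A C (ainv A a \<otimes>\<^bsub>A\<^esub> a') (aut C c))"
  by (simp_all add: AC_bimod_def tensor_record_rules hmod.defs)

lemma ainv_AC_bimod: "ainv (AC_bimod R A C r) = ainv (tensor R A C)"
  by (simp add: ainv_def AC_bimod_fields tensor_record_rules same_module_rules[OF same_module_AC_bimod])

lemmas AC_bimod_rules = tensor_record_rules same_module_rules[OF same_module_AC_bimod]
  AC_bimod_fields(1,2) ainv_AC_bimod

locale algebra_coalgebra =
  fixes R :: "('k, 'r) ring_scheme" and A :: "('k, 'a, 'x) hmod_scheme" and C :: "('k, 'c, 'y) coalg_scheme"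
    and r :: "('k, 'a, 'c) tens \<Rightarrow> 'a \<Rightarrow> ('k, 'a, 'c) tens"
  assumes A: "hom_algebra R A" and C: "hom_coalgebra R C"
begin

lemmas [simp] = hom_algebra_rules[OF A] hom_coalgebra_basic[OF C] sweedler

abbreviation "AC \<equiv> tensor_module R A C"
abbreviation "D \<equiv> AC_bimod R A C r"
abbreviation "pAC \<equiv> pure R A C"
abbreviation "pCA \<equiv> pure R C A"

lemma hom_object_AC: "hom_object R (tensor R A C)"
  by (rule hom_object_tensor[OF hom_algebraD(1)[OF A] hom_coalgebraD(1)[OF C]])

lemma hom_object_D: "hom_object R D"
  using hom_object_AC by (simp add: hom_object_def AC_bimod_rules cong del: lin_map_weak_cong)

lemmas [simp] = hom_object_rules[OF hom_object_AC, unfolded tensor_record_rules]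
  aut_tensor_pure[OF hom_algebraD(1)[OF A] hom_coalgebraD(1)[OF C]]
  ainv_tensor_pure[OF hom_algebraD(1)[OF A] hom_coalgebraD(1)[OF C]]

lemma lact_D: "t \<in> carrier AC \<Longrightarrow>
    lact D a t = sw R A C AC (\<lambda>a' c. pAC (ainv A a \<otimes>\<^bsub>A\<^esub> a') (aut C c)) t"
  by (simp add: AC_bimod_fields(3) tlift_eq_sw[where M = A and N = C])

lemma lact_D_pure [simp]: "a \<in> carrier A \<Longrightarrow> a' \<in> carrier A \<Longrightarrow> c \<in> carrier C \<Longrightarrow>
    lact D a (pAC a' c) = pAC (ainv A a \<otimes>\<^bsub>A\<^esub> a') (aut C c)"
  by (simp add: lact_D)

lemma bilin_map_lact: "bilin_map R A AC AC (lact D)"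
proof (rule bilin_mapI)
  show "lin_map R AC AC (lact D a)" if "a \<in> carrier A" for a
    using that by (intro lin_map_cong[OF _ lact_D[symmetric]]) simp_all
  show "lin_map R A AC (\<lambda>a. lact D a t)" if "t \<in> carrier AC" for t
    using that by (intro lin_map_cong[OF _ lact_D[symmetric]]) simp_all
qed

lemmas [simp] = lin_map_bilin1[OF bilin_map_lact] lin_map_bilin2[OF bilin_map_lact]
  bilin_map_closed[OF bilin_map_lact] sw_push1[OF bilin_map_lact] sw_push2[OF bilin_map_lact]

lemma left_hom_module_D: "left_hom_module R A D"
  unfolding left_hom_module_def
proof (intro conjI ballI)
  show "hom_object R D" by (rule hom_object_D)
  show "bilin_map R A D D (lact D)" using bilin_map_lact by (simp add: AC_bimod_rules)
  fix m assume "m \<in> carrier D"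
  hence m: "m \<in> carrier AC" by (simp add: AC_bimod_rules)
  show "lact D \<one>\<^bsub>A\<^esub> m = aut D m"
    unfolding AC_bimod_rules by (rule tensor_eqI[OF _ _ _ _ _ m, where P = AC]) simp_all
  fix a assume a: "a \<in> carrier A"
  show "aut D (lact D a m) = lact D (aut A a) (aut D m)"
    unfolding AC_bimod_rules by (rule tensor_eqI[OF _ _ _ _ _ m, where P = AC]) (use a in simp_all)
next
  fix a b m assume ab: "a \<in> carrier A" "b \<in> carrier A" and "m \<in> carrier D"
  hence m: "m \<in> carrier AC" by (simp add: AC_bimod_rules)
  show "lact D (aut A a) (lact D b m) = lact D (a \<otimes>\<^bsub>A\<^esub> b) (aut D m)"
    unfolding AC_bimod_rules by (rule tensor_eqI[OF _ _ _ _ _ m, where P = AC]) (use ab in simp_all)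
qed

end

text \<open>
  Here \<open>r\<close> is given by \<open>\<psi>\<close> through the formula of an entwining structure, while \<open>\<psi>\<close> is merely linear and
  equivariant. This is the common ground of both directions: \<open>\<psi>\<close> may come from an entwining
  structure or from the right action of a coring.
\<close>

locale twisted_bimodule = algebra_coalgebra R A C r
  for R :: "('k, 'r) ring_scheme" and A :: "('k, 'a, 'x) hmod_scheme" and C :: "('k, 'c, 'y) coalg_scheme"
    and \<psi> :: "('k, 'c, 'a) tens \<Rightarrow> ('k, 'a, 'c) tens"
    and r :: "('k, 'a, 'c) tens \<Rightarrow> 'a \<Rightarrow> ('k, 'a, 'c) tens" +
  assumes psi: "hom_morphism R (tensor R C A) (tensor R A C) \<psi>"
    and bilin_map_r: "bilin_map R (tensor_module R A C) A (tensor_module R A C) r"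
    and r_pure_raw: "\<And>a a' c. a \<in> carrier A \<Longrightarrow> a' \<in> carrier A \<Longrightarrow> c \<in> carrier C \<Longrightarrow>
      r (pure R A C a' c) a = sw R A C (tensor_module R A C) (\<lambda>b d. pure R A C (a' \<otimes>\<^bsub>A\<^esub> b) (aut C d))
        (\<psi> (pure R C A c (ainv A a)))"
begin

lemma lin_map_psi: "lin_map R (tensor_module R C A) AC \<psi>"
  using psi by (simp add: hom_morphism_def tensor_record_rules)

lemma psi_closed [simp]: "t \<in> carrier (tensor_module R C A) \<Longrightarrow> \<psi> t \<in> carrier AC"
  by (rule lin_map_closed[OF lin_map_psi])

lemmas [simp] = lin_map_psi lin_map_comp[OF lin_map_psi] sw_push[OF lin_map_psi]

lemma psi_aut_aut:
  assumes "c \<in> carrier C" "a \<in> carrier A"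
  shows "\<psi> (pCA (aut C c) (aut A a)) = sw R A C AC (\<lambda>b d. pAC (aut A b) (aut C d)) (\<psi> (pCA c a))"
proof -
  have "aut (tensor R A C) (\<psi> (pCA c a)) = \<psi> (aut (tensor R C A) (pCA c a))"
    using psi assms by (simp add: hom_morphism_def tensor_record_rules)
  thus ?thesis
    using assms by (simp add: aut_tensor aut_tensor_pure hom_algebraD(1)[OF A] hom_coalgebraD(1)[OF C])
qed

text \<open>With these two rules the element of \<open>C\<close> to which \<open>\<psi>\<close> is applied carries no automorphism.\<close>

lemma psi_aut [simp]:
  assumes "c \<in> carrier C" "a \<in> carrier A"
  shows "\<psi> (pCA (aut C c) a) = sw R A C AC (\<lambda>b d. pAC (aut A b) (aut C d)) (\<psi> (pCA c (ainv A a)))"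
  using psi_aut_aut[of c "ainv A a"] assms by simp

lemma psi_ainv [simp]:
  assumes "c \<in> carrier C" "a \<in> carrier A"
  shows "\<psi> (pCA (ainv C c) a) = sw R A C AC (\<lambda>b d. pAC (ainv A b) (ainv C d)) (\<psi> (pCA c (aut A a)))"
proof -
  have "\<psi> (pCA c (aut A a)) = \<psi> (pCA (aut C (ainv C c)) (aut A a))" using assms by simp
  also have "\<dots> = sw R A C AC (\<lambda>b d. pAC (aut A b) (aut C d)) (\<psi> (pCA (ainv C c) a))"
    using assms by (intro psi_aut_aut) simp_all
  finally show ?thesis using assms by (simp add: sw_pure_id del: psi_aut)
qed

lemmas [simp] = r_pure_raw lin_map_bilin1[OF bilin_map_r] lin_map_bilin2[OF bilin_map_r]
  bilin_map_closed[OF bilin_map_r] sw_push1[OF bilin_map_r] sw_push2[OF bilin_map_r] bilin_map_r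

end

lemma bilin_map_entwining_ract:
  assumes A: "hom_algebra R A" and C: "hom_coalgebra R C"
    and psi: "hom_morphism R (tensor R C A) (tensor R A C) \<psi>"
  shows "bilin_map R (tensor_module R A C) A (tensor_module R A C) (entwining_ract R A C \<psi>)" (is ?b)
    and "\<And>a a' c. a \<in> carrier A \<Longrightarrow> a' \<in> carrier A \<Longrightarrow> c \<in> carrier C \<Longrightarrow>
      entwining_ract R A C \<psi> (pure R A C a' c) a = sw R A C (tensor_module R A C)
        (\<lambda>b d. pure R A C (a' \<otimes>\<^bsub>A\<^esub> b) (aut C d)) (\<psi> (pure R C A c (ainv A a)))"
proof -
  note [simp] = hom_algebra_rules[OF A] hom_coalgebra_basic[OF C] sweedler
  let ?AC = "tensor_module R A C"
  have l: "lin_map R (tensor_module R C A) ?AC \<psi>"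
    using psi by (simp add: hom_morphism_def tensor_record_rules)
  note [simp] = lin_map_closed[OF l] l lin_map_comp[OF l]
  have e: "entwining_ract R A C \<psi> t a = sw R A C ?AC (\<lambda>a' c. sw R A C ?AC
        (\<lambda>b d. pure R A C (a' \<otimes>\<^bsub>A\<^esub> b) (aut C d)) (\<psi> (pure R C A c (ainv A a)))) t"
    if "t \<in> carrier ?AC" "a \<in> carrier A" for t a
    using that by (simp add: entwining_ract_def tensor_record_rules tlift_eq_sw[where M = A and N = C])
  show ?b
  proof (rule bilin_mapI)
    show "lin_map R A ?AC (entwining_ract R A C \<psi> t)" if "t \<in> carrier ?AC" for t
      using that by (intro lin_map_cong[OF _ e[symmetric]]) simp_all
    show "lin_map R ?AC ?AC (\<lambda>t. entwining_ract R A C \<psi> t a)" if "a \<in> carrier A" for a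
      using that by (intro lin_map_cong[OF _ e[symmetric]]) simp_all
  qed
  fix a a' c assume "a \<in> carrier A" "a' \<in> carrier A" "c \<in> carrier C"
  thus "entwining_ract R A C \<psi> (pure R A C a' c) a = sw R A C ?AC
        (\<lambda>b d. pure R A C (a' \<otimes>\<^bsub>A\<^esub> b) (aut C d)) (\<psi> (pure R C A c (ainv A a)))"
    by (simp add: e)
qed

section \<open>Hom-entwining structures\<close>

context twisted_bimodule
begin

lemma hom_entwining_iff:
  "hom_entwining R A C \<psi> \<longleftrightarrow>
     (\<forall>a \<in> carrier A. \<forall>a' \<in> carrier A. \<forall>c \<in> carrier C.
        \<psi> (pCA (aut C c) (a \<otimes>\<^bsub>A\<^esub> a')) =
        sw R A C AC (\<lambda>b d. sw R A C AC (\<lambda>b' d'. pAC (b \<otimes>\<^bsub>A\<^esub> b') (aut C d')) (\<psi> (pCA d a'))) (\<psi> (pCA c a))) \<and>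
     (\<forall>a \<in> carrier A. \<forall>c \<in> carrier C.
        sw R A C (tensor_module R A (tensor_module R C C))
          (\<lambda>b d. pure R A (tensor_module R C C) (ainv A b) (comult C d)) (\<psi> (pCA c a)) =
        sw R C C (tensor_module R A (tensor_module R C C))
          (\<lambda>c1 c2. sw R A C (tensor_module R A (tensor_module R C C))
             (\<lambda>b d. sw R A C (tensor_module R A (tensor_module R C C))
                (\<lambda>b' d'. pure R A (tensor_module R C C) b' (pure R C C d' d)) (\<psi> (pCA c1 b)))
             (\<psi> (pCA c2 (ainv A a)))) (comult C c)) \<and>
     (\<forall>c \<in> carrier C. \<psi> (pCA c \<one>\<^bsub>A\<^esub>) = pAC \<one>\<^bsub>A\<^esub> c) \<and>
     (\<forall>a \<in> carrier A. \<forall>c \<in> carrier C.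
        sw R A C A (\<lambda>b d. counit C d \<odot>\<^bsub>A\<^esub> b) (\<psi> (pCA c a)) = counit C c \<odot>\<^bsub>A\<^esub> a)"
  unfolding hom_entwining_def
  by (simp add: A C psi tensor_record_rules tlift_eq_sw[where M = A and N = C]
      tlift_eq_sw[where M = C and N = C] del: psi_aut cong: ball_cong)

end

locale entwined_bimodule = twisted_bimodule R A C \<psi> r
  for R :: "('k, 'r) ring_scheme" and A :: "('k, 'a, 'x) hmod_scheme" and C :: "('k, 'c, 'y) coalg_scheme"
    and \<psi> r +
  assumes ent: "hom_entwining R A C \<psi>"
begin

text \<open>
  The defining law on products concerns \<open>\<gamma>(c)\<close>; at \<open>\<gamma>\<^sup>-\<^sup>1(c)\<close> it becomes a rewrite rule for \<open>c\<close>, in agreement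
  with the normal form of arguments of \<open>\<psi>\<close>.
\<close>

lemma psi_mult [simp]:
  assumes "a \<in> carrier A" "a' \<in> carrier A" "c \<in> carrier C"
  shows "\<psi> (pCA c (a \<otimes>\<^bsub>A\<^esub> a')) =
    sw R A C AC (\<lambda>b d. sw R A C AC (\<lambda>b' d'. pAC (ainv A b \<otimes>\<^bsub>A\<^esub> ainv A b') d')
      (\<psi> (pCA d (aut A a')))) (\<psi> (pCA c (aut A a)))"
proof -
  have "\<psi> (pCA (aut C (ainv C c)) (a \<otimes>\<^bsub>A\<^esub> a')) =
    sw R A C AC (\<lambda>b d. sw R A C AC (\<lambda>b' d'. pAC (b \<otimes>\<^bsub>A\<^esub> b') (aut C d')) (\<psi> (pCA d a')))
      (\<psi> (pCA (ainv C c) a))"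
    using ent assms unfolding hom_entwining_iff by (blast intro: ainv_closed[OF hom_coalgebraD(1)[OF C]])
  thus ?thesis using assms by (simp del: psi_aut)
qed

lemma psi_one [simp]: "c \<in> carrier C \<Longrightarrow> \<psi> (pCA c \<one>\<^bsub>A\<^esub>) = pAC \<one>\<^bsub>A\<^esub> c"
  using ent unfolding hom_entwining_iff by blast

text \<open>
  As for comodules, the laws that relate \<open>\<psi>\<close> to \<open>\<epsilon>\<close> and \<open>\<Delta>\<close> are used after the application of an arbitrary
  linear or trilinear map.
\<close>

lemma psi_counit:
  assumes [simp]: "module R Q" and h: "lin_map R A Q h" and ac: "a \<in> carrier A" "c \<in> carrier C"
  shows "sw R A C Q (\<lambda>b d. counit C d \<odot>\<^bsub>Q\<^esub> h b) (\<psi> (pCA c a)) = counit C c \<odot>\<^bsub>Q\<^esub> h a"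
proof -
  have "sw R A C A (\<lambda>b d. counit C d \<odot>\<^bsub>A\<^esub> b) (\<psi> (pCA c a)) = counit C c \<odot>\<^bsub>A\<^esub> a"
    using ent ac unfolding hom_entwining_iff by blast
  hence "counit C c \<odot>\<^bsub>Q\<^esub> h a = h (sw R A C A (\<lambda>b d. counit C d \<odot>\<^bsub>A\<^esub> b) (\<psi> (pCA c a)))"
    using ac by (simp add: lin_map_smult[OF h])
  also have "\<dots> = sw R A C Q (\<lambda>b d. h (counit C d \<odot>\<^bsub>A\<^esub> b)) (\<psi> (pCA c a))"
    using ac by (intro sw_push h) simp_all
  finally show ?thesis by (simp add: lin_map_smult[OF h])
qed

lemma psi_comult:
  assumes [simp]: "module R Q"
    and g1: "\<And>y z. y \<in> carrier C \<Longrightarrow> z \<in> carrier C \<Longrightarrow> lin_map R A Q (\<lambda>x. g x y z)"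
    and g2: "\<And>x z. x \<in> carrier A \<Longrightarrow> z \<in> carrier C \<Longrightarrow> lin_map R C Q (\<lambda>y. g x y z)"
    and g3: "\<And>x y. x \<in> carrier A \<Longrightarrow> y \<in> carrier C \<Longrightarrow> lin_map R C Q (\<lambda>z. g x y z)"
    and ac: "a \<in> carrier A" "c \<in> carrier C"
  shows "sw R A C Q (\<lambda>b d. sw R C C Q (\<lambda>d1 d2. g (ainv A b) d1 d2) (comult C d)) (\<psi> (pCA c a)) =
    sw R C C Q (\<lambda>c1 c2. sw R A C Q (\<lambda>b d. sw R A C Q (\<lambda>b' d'. g b' d' d) (\<psi> (pCA c1 b)))
      (\<psi> (pCA c2 (ainv A a)))) (comult C c)"
proof -
  let ?CC = "tensor_module R C C"
  let ?h = "sw R A ?CC Q (\<lambda>x t. sw R C C Q (\<lambda>c1 c2. g x c1 c2) t)"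
  note [simp] = lin_map_comp[OF g1] lin_map_comp[OF g2] lin_map_comp[OF g3] g1 g2 g3
  have "sw R A C (tensor_module R A ?CC) (\<lambda>b d. pure R A ?CC (ainv A b) (comult C d)) (\<psi> (pCA c a)) =
      sw R C C (tensor_module R A ?CC) (\<lambda>c1 c2. sw R A C (tensor_module R A ?CC)
             (\<lambda>b d. sw R A C (tensor_module R A ?CC)
                (\<lambda>b' d'. pure R A ?CC b' (pure R C C d' d)) (\<psi> (pCA c1 b)))
             (\<psi> (pCA c2 (ainv A a)))) (comult C c)" (is "?u = ?v")
    using ent ac unfolding hom_entwining_iff by blast
  hence "?h ?u = ?h ?v" by (simp only:)
  thus ?thesis
    using ac by simp
qed

text \<open>
  Associativity of the right action is the law for \<open>\<psi>\<close> on products, and its unit law is the one for \<open>\<psi>\<close>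
  on \<open>1\<close>.
\<close>

lemma hom_bimodule_D: "hom_bimodule R A D"
  unfolding hom_bimodule_def right_hom_module_def
proof (intro conjI ballI)
  show "left_hom_module R A D" by (rule left_hom_module_D)
  show "hom_object R D" by (rule hom_object_D)
  show "bilin_map R D A D (ract D)" unfolding AC_bimod_rules by (rule bilin_map_r)
  fix m assume "m \<in> carrier D"
  hence m: "m \<in> carrier AC" by (simp add: AC_bimod_rules)
  show "ract D m \<one>\<^bsub>A\<^esub> = aut D m"
    unfolding AC_bimod_rules by (rule tensor_eqI[OF _ _ _ _ _ m, where P = AC]) simp_all
  fix a assume a: "a \<in> carrier A"
  show "aut D (ract D m a) = ract D (aut D m) (aut A a)"
    unfolding AC_bimod_rules by (rule tensor_eqI[OF _ _ _ _ _ m, where P = AC]) (use a in simp_all)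
next
  fix a b m assume ab: "a \<in> carrier A" "b \<in> carrier A" and "m \<in> carrier D"
  hence m: "m \<in> carrier AC" by (simp add: AC_bimod_rules)
  show "ract D (aut D m) (a \<otimes>\<^bsub>A\<^esub> b) = ract D (ract D m a) (aut A b)"
    unfolding AC_bimod_rules by (rule tensor_eqI[OF _ _ _ _ _ m, where P = AC]) (use ab in simp_all)
  show "ract D (lact D a m) (aut A b) = lact D (aut A a) (ract D m b)"
    unfolding AC_bimod_rules by (rule tensor_eqI[OF _ _ _ _ _ m, where P = AC]) (use ab in simp_all)
qed

end

section \<open>The isomorphism between \<open>M \<otimes> C\<close> and \<open>M \<otimes>\<^sub>A (A \<otimes> C)\<close>\<close>

text \<open>
  The map \<open>\<psi>\<close> is equivariant for \<open>\<alpha>\<close> and \<open>\<gamma>\<close> jointly, but in general not for \<open>\<gamma>\<close> alone, so the power of \<open>\<gamma>\<close>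
  matters: with \<open>\<gamma>\<^sup>-\<^sup>1\<close> the right action on the target corresponds to the one in the definition of
  entwined modules.
\<close>

definition theta :: "('k, 'r) ring_scheme \<Rightarrow> ('k, 'a, 'x) hmod_scheme \<Rightarrow> ('k, 'c, 'y) hmod_scheme \<Rightarrow>
    ('k, 'm, 'a, 'z) rmod_scheme \<Rightarrow> ('k, ('k, 'a, 'c) tens, 'a, 'w) bimod_scheme \<Rightarrow>
    ('k, 'm, 'c) tens \<Rightarrow> ('k, 'm, ('k, 'a, 'c) tens) tensA" where
  "theta R A C M D = sw R M C (tensorA_module R A M D)
     (\<lambda>m c. pureA R A M D m (pure R A C \<one>\<^bsub>A\<^esub> (ainv C c)))"

definition theta_inv :: "('k, 'r) ring_scheme \<Rightarrow> ('k, 'a, 'x) hmod_scheme \<Rightarrow> ('k, 'c, 'y) hmod_scheme \<Rightarrow>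
    ('k, 'm, 'a, 'z) rmod_scheme \<Rightarrow> ('k, ('k, 'a, 'c) tens, 'a, 'w) bimod_scheme \<Rightarrow>
    ('k, 'm, ('k, 'a, 'c) tens) tensA \<Rightarrow> ('k, 'm, 'c) tens" where
  "theta_inv R A C M D = swA R A M D (tensor_module R M C) (\<lambda>m x.
     sw R A C (tensor_module R M C) (\<lambda>a c. pure R M C (ract M (ainv M m) a) (aut C c)) x)"

text \<open>
  In the transfer of comodules the laws for \<open>\<psi>\<close> enter only through the bimodule axioms of \<open>A \<otimes> C\<close>.
\<close>

locale twisted_coring = twisted_bimodule +
  assumes D: "hom_bimodule R A D"
begin

lemmas [simp] = sweedler AC_bimod_rules hom_bimodule_rules[OF A D, unfolded AC_bimod_rules]
  hom_bimodule_rules[OF A D, unfolded same_module_rules[OF same_module_AC_bimod]]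

end

locale twisted_coring_module = twisted_coring R A C \<psi> r
  for R :: "('k, 'r) ring_scheme" and A :: "('k, 'a, 'x) hmod_scheme" and C :: "('k, 'c, 'y) coalg_scheme"
    and \<psi> r +
  fixes M :: "('k, 'm, 'a, 'z) rmod_scheme"
  assumes M: "right_hom_module R A M"
begin

sublocale MD: right_module_bimodule R A M D
  by (rule right_module_bimodule.intro[OF A M D])

abbreviation "MC \<equiv> tensor_module R M C"
abbreviation "pMC \<equiv> pure R M C"
abbreviation "pMD \<equiv> pureA R A M D"
abbreviation "MD \<equiv> tensorA_module R A M D"
abbreviation "\<theta> \<equiv> theta R A C M D"
abbreviation "\<theta>' \<equiv> theta_inv R A C M D"

lemma lin_map_theta: "lin_map R MC MD \<theta>"
  unfolding theta_def by simp

lemmas [simp] = lin_map_theta lin_map_comp[OF lin_map_theta] lin_map_closed[OF lin_map_theta]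
  sw_push[OF lin_map_theta]

lemma theta_pure [simp]:
  "m \<in> carrier M \<Longrightarrow> c \<in> carrier C \<Longrightarrow> \<theta> (pMC m c) = pMD m (pAC \<one>\<^bsub>A\<^esub> (ainv C c))"
  unfolding theta_def by simp

lemma balanced_theta_inv [simp]:
  "balanced A M D (\<lambda>m x. sw R A C MC (\<lambda>a c. pMC (ract M (ainv M m) a) (aut C c)) x)"
proof (rule balancedI)
  fix m b n assume mb: "m \<in> carrier M" "b \<in> carrier A" and "n \<in> carrier D"
  hence n: "n \<in> carrier AC" by simp
  show "sw R A C MC (\<lambda>a c. pMC (ract M (ainv M (ract M m b)) a) (aut C c)) n =
    sw R A C MC (\<lambda>a c. pMC (ract M (ainv M (aut M m)) a) (aut C c)) (lact D b (ainv D n))"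
    by (rule tensor_eqI[OF _ _ _ _ _ n, where P = MC]) (use mb in simp_all)
qed

lemma lin_map_theta_inv: "lin_map R MD MC \<theta>'"
  unfolding theta_inv_def by simp

lemmas [simp] = lin_map_theta_inv lin_map_comp[OF lin_map_theta_inv] lin_map_closed[OF lin_map_theta_inv]
  sw_push[OF lin_map_theta_inv]

lemma theta_inv_pureA [simp]:
  "m \<in> carrier M \<Longrightarrow> x \<in> carrier AC \<Longrightarrow>
    \<theta>' (pMD m x) = sw R A C MC (\<lambda>a c. pMC (ract M (ainv M m) a) (aut C c)) x"
  unfolding theta_inv_def by simp

lemma theta_inv_theta [simp]: "t \<in> carrier MC \<Longrightarrow> \<theta>' (\<theta> t) = t"
  by (rule tensor_eqI[where P = MC]) simp_all

lemma theta_theta_inv [simp]: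
  assumes "s \<in> carrier MD"
  shows "\<theta> (\<theta>' s) = s"
proof (rule tensorA_eqI[OF MD.balance_data _ _ _ assms, where P = MD])
  fix m x assume m: "m \<in> carrier M" and "x \<in> carrier D"
  hence x: "x \<in> carrier AC" by simp
  show "\<theta> (\<theta>' (pMD m x)) = pMD m x"
    by (rule tensor_eqI[OF _ _ _ _ _ x, where P = MD]) (use m in simp_all)
qed simp_all

lemma theta_inj: "s \<in> carrier MC \<Longrightarrow> t \<in> carrier MC \<Longrightarrow> \<theta> s = \<theta> t \<longleftrightarrow> s = t"
  by (metis theta_inv_theta)

text \<open>
  Replaces sums over \<open>M \<otimes>\<^sub>A (A \<otimes> C)\<close>, whose summands have to be balanced, by sums over \<open>M \<otimes> C\<close>.
\<close>

lemma swA_theta: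
  assumes [simp]: "module R P" and f: "bilin_map R M AC P f" "balanced A M D f" and t: "t \<in> carrier MC"
  shows "swA R A M D P f (\<theta> t) = sw R M C P (\<lambda>m c. f m (pAC \<one>\<^bsub>A\<^esub> (ainv C c))) t"
proof (rule tensor_eqI[OF _ _ _ _ _ t, where P = P])
  have f': "bilin_map R M D P f" using f by simp
  note [simp] = f lin_map_bilin1[OF f(1)] lin_map_bilin2[OF f(1)] f'
  show "lin_map R MC P (\<lambda>t. swA R A M D P f (\<theta> t))" by (simp del: bilin_mapI)
  show "lin_map R MC P (sw R M C P (\<lambda>m c. f m (pAC \<one>\<^bsub>A\<^esub> (ainv C c))))" by simp
  fix m c assume "m \<in> carrier M" "c \<in> carrier C"
  thus "swA R A M D P f (\<theta> (pMC m c)) = sw R M C P (\<lambda>m c. f m (pAC \<one>\<^bsub>A\<^esub> (ainv C c))) (pMC m c)"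
    by (simp add: swA_pureA[OF MD.balance_data _ _ _ f'] del: swA_pureA)
qed simp_all

lemma aut_theta:
  assumes t: "t \<in> carrier MC"
  shows "aut (tensorA R A M D) (\<theta> t) = \<theta> (sw R M C MC (\<lambda>m c. pMC (aut M m) (aut C c)) t)"
  by (rule tensor_eqI[OF _ _ _ _ _ t, where P = MD]) (simp_all add: lin_map_comp[OF MD.lin_map_aut_tensorA])

lemma ract_theta:
  assumes t: "t \<in> carrier MC" and a: "a \<in> carrier A"
  shows "ract (tensorA R A M D) (\<theta> t) a =
    \<theta> (sw R M C MC (\<lambda>m c. sw R A C MC (\<lambda>b d. pMC (ract M m b) (aut C d)) (\<psi> (pCA c (ainv A a)))) t)"
proof (rule tensor_eqI[OF _ _ _ _ _ t, where P = MD])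
  fix m c assume "m \<in> carrier M" "c \<in> carrier C"
  thus "ract (tensorA R A M D) (\<theta> (pMC m c)) a = \<theta> (sw R M C MC
      (\<lambda>m c. sw R A C MC (\<lambda>b d. pMC (ract M m b) (aut C d)) (\<psi> (pCA c (ainv A a)))) (pMC m c))"
    using a by simp
qed (use a in \<open>simp_all add: lin_map_comp[OF MD.lin_map_ract_tensorA]\<close>)

end

section \<open>The coring \<open>A \<otimes> C\<close>\<close>

lemma same_module_AC_coring: "same_module (AC_coring R A C r) (tensor_module R A C)"
  using same_module_AC_bimod[of R A C r]
  by (simp add: same_module_def AC_coring_def Let_def bimod.defs)

lemma AC_coring_fields:
  "aut (AC_coring R A C r) = aut (AC_bimod R A C r)" "ract (AC_coring R A C r) = ract (AC_bimod R A C r)"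
  "lact (AC_coring R A C r) = lact (AC_bimod R A C r)"
  by (simp_all add: AC_coring_def Let_def bimod.defs)

lemma ainv_AC_coring: "ainv (AC_coring R A C r) = ainv (AC_bimod R A C r)"
  by (simp add: ainv_def AC_coring_fields same_module_rules[OF same_module_AC_bimod]
      same_module_rules[OF same_module_AC_coring])

lemmas AC_coring_basic = same_module_rules[OF same_module_AC_coring] AC_coring_fields ainv_AC_coring

lemma AC_coring_kernel:
  "tensorA_kernel R A M (AC_coring R A C r) = tensorA_kernel R A M (AC_bimod R A C r)"
  "tensorA_kernel R A (AC_coring R A C r) N = tensorA_kernel R A (AC_bimod R A C r) N"
  by (simp_all add: tensorA_kernel_def AC_coring_basic same_module_rules[OF same_module_AC_bimod])

lemma AC_coring_tensorA_module:
  "tensorA_module R A M (AC_coring R A C r) = tensorA_module R A M (AC_bimod R A C r)"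
  "tensorA_module R A (AC_coring R A C r) N = tensorA_module R A (AC_bimod R A C r) N"
  "pureA R A M (AC_coring R A C r) = pureA R A M (AC_bimod R A C r)"
  "pureA R A (AC_coring R A C r) N = pureA R A (AC_bimod R A C r) N"
  by (simp_all add: tensorA_module_def pureA_def fun_eq_iff AC_coring_kernel AC_coring_basic
      same_module_rules[OF same_module_AC_bimod])

lemma AC_coring_tensorA:
  "tensorA R A M (AC_coring R A C r) = tensorA R A M (AC_bimod R A C r)"
  "tensorA R A (AC_coring R A C r) N = tensorA R A (AC_bimod R A C r) N"
  "tensorAA R A K (AC_coring R A C r) = tensorAA R A K (AC_bimod R A C r)"
  "tensorAA R A (AC_coring R A C r) N = tensorAA R A (AC_bimod R A C r) N"
  by (simp_all add: tensorA_def tensorAA_def AC_coring_tensorA_module AC_coring_basic)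

lemmas AC_coring_rules = AC_coring_basic AC_coring_kernel AC_coring_tensorA_module AC_coring_tensorA

lemma hom_object_AC_coring: "hom_object R (AC_coring R A C r) = hom_object R (AC_bimod R A C r)"
  by (simp add: hom_object_def AC_coring_rules same_module_rules[OF same_module_AC_bimod] cong del: lin_map_weak_cong)

lemma hom_bimodule_AC_coring:
  "hom_bimodule R A (AC_coring R A C r) = hom_bimodule R A (AC_bimod R A C r)"
  by (simp add: hom_bimodule_def left_hom_module_def right_hom_module_def hom_object_AC_coring
      AC_coring_rules same_module_rules[OF same_module_AC_bimod] cong del: bilin_map_weak_cong)

lemma right_linear_AC_coring:
  "right_linear R A (AC_coring R A C r) N f = right_linear R A (AC_bimod R A C r) N f"
  by (simp add: right_linear_def hom_morphism_def AC_coring_rules same_module_rules[OF same_module_AC_bimod])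

lemma left_linear_AC_coring:
  "left_linear R A (AC_coring R A C r) N f = left_linear R A (AC_bimod R A C r) N f"
  by (simp add: left_linear_def hom_morphism_def AC_coring_rules same_module_rules[OF same_module_AC_bimod])

text \<open>
  The right \<open>C\<close>-coaction on \<open>A \<otimes> C\<close> that corresponds under \<^const>\<open>theta\<close> to the comultiplication
  of the coring.
\<close>

definition AC_coaction :: "('k, 'r) ring_scheme \<Rightarrow> ('k, 'a, 'x) hmod_scheme \<Rightarrow> ('k, 'c, 'y) coalg_scheme \<Rightarrow>
    ('k, 'a, 'c) tens \<Rightarrow> ('k, ('k, 'a, 'c) tens, 'c) tens" where
  "AC_coaction R A C = sw R A C (tensor_module R (tensor_module R A C) C) (\<lambda>a c.
     sw R C C (tensor_module R (tensor_module R A C) C)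
       (\<lambda>c1 c2. pure R (tensor_module R A C) C (pure R A C (ainv A a) c1) (aut C c2)) (comult C c))"

context twisted_coring
begin

text \<open>
  The unit law of the right action at \<open>1 \<otimes> \<gamma>\<^sup>-\<^sup>1(c)\<close>.
\<close>

lemma psi_unit:
  assumes c: "c \<in> carrier C"
  shows "\<psi> (pCA c \<one>\<^bsub>A\<^esub>) = pAC \<one>\<^bsub>A\<^esub> c"
proof -
  have "r (pAC \<one>\<^bsub>A\<^esub> (ainv C c)) \<one>\<^bsub>A\<^esub> = aut (tensor R A C) (pAC \<one>\<^bsub>A\<^esub> (ainv C c))"
    using c by (intro right_hom_moduleD(4)[OF hom_bimoduleD(2)[OF D], unfolded AC_bimod_rules]) simp
  moreover have "r (pAC \<one>\<^bsub>A\<^esub> (ainv C c)) \<one>\<^bsub>A\<^esub> = \<psi> (pCA c \<one>\<^bsub>A\<^esub>)"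
    using c by (subst r_pure_raw) (simp_all add: sw_pure_id)
  ultimately show ?thesis using c by simp
qed

lemmas [simp] = psi_unit

sublocale DD: bimodule_bimodule R A D D
  by (intro bimodule_bimodule.intro right_module_bimodule.intro bimodule_bimodule_axioms.intro
      A D hom_bimoduleD(2)[OF D])

sublocale DC: twisted_coring_module R A C \<psi> r D
  by (intro twisted_coring_module.intro twisted_coring_axioms twisted_coring_module_axioms.intro
      hom_bimoduleD(2)[OF D])

abbreviation "E \<equiv> AC_coring R A C r"
abbreviation "DD \<equiv> tensorAA R A D D"
abbreviation "pDD \<equiv> pureA R A D D"
abbreviation "mDD \<equiv> tensorA_module R A D D"
abbreviation "DC \<equiv> tensor_module R AC C"
abbreviation "pDC \<equiv> pure R AC C"
abbreviation "\<theta>D \<equiv> theta R A C D D"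
abbreviation "\<theta>D' \<equiv> theta_inv R A C D D"

lemmas [simp] = AC_coring_rules DD.tensorAA_fields DD.ainv_tensorAA
  DC.lin_map_theta[unfolded AC_bimod_rules] lin_map_comp[OF DC.lin_map_theta[unfolded AC_bimod_rules]]
  lin_map_closed[OF DC.lin_map_theta[unfolded AC_bimod_rules]]
  sw_push[OF DC.lin_map_theta[unfolded AC_bimod_rules]] DC.theta_pure[unfolded AC_bimod_rules]
  DC.lin_map_theta_inv[unfolded AC_bimod_rules] lin_map_comp[OF DC.lin_map_theta_inv[unfolded AC_bimod_rules]]
  lin_map_closed[OF DC.lin_map_theta_inv[unfolded AC_bimod_rules]]
  sw_push[OF DC.lin_map_theta_inv[unfolded AC_bimod_rules]] DC.theta_inv_pureA[unfolded AC_bimod_rules]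
  DD.pureA_ract[unfolded AC_bimod_rules]
  DD.aut_tensorA_pureA[unfolded AC_bimod_rules] DD.ainv_tensorA_pureA[unfolded AC_bimod_rules]
  DD.ract_tensorA_pureA[unfolded AC_bimod_rules] DD.lact_tensorAA_pureA[unfolded AC_bimod_rules]
  DC.theta_inv_theta[unfolded AC_bimod_rules]

lemmas [simp] = hom_object_rules[OF DD.hom_object_tensorA, unfolded AC_bimod_rules]
  lin_map_bilin1[OF DD.bilin_map_lact_tensorAA] lin_map_bilin2[OF DD.bilin_map_lact_tensorAA]
  bilin_map_closed[OF DD.bilin_map_lact_tensorAA]

lemmas [simp] = sw_push1[OF DD.bilin_map_lact_tensorAA] sw_push2[OF DD.bilin_map_lact_tensorAA]

lemma ccomult_raw: "ccomult E = tlift R mDD (\<lambda>a c. tlift R mDD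
    (\<lambda>c1 c2. pDD (pAC (ainv A a) c1) (pAC \<one>\<^bsub>A\<^esub> c2)) (comult C c))"
  by (simp add: AC_coring_def Let_def bimod.defs tensor_record_rules del: AC_coring_rules)

lemma ccounit_raw: "ccounit E = tlift R A (\<lambda>a c. counit C c \<odot>\<^bsub>A\<^esub> aut A a)"
  by (simp add: AC_coring_def Let_def bimod.defs del: AC_coring_rules)

lemma lin_map_coact: "lin_map R AC DC (AC_coaction R A C)"
  unfolding AC_coaction_def by simp

lemmas [simp] = lin_map_coact lin_map_closed[OF lin_map_coact] lin_map_comp[OF lin_map_coact]
  sw_push[OF lin_map_coact]

lemma coact_pure [simp]: "a \<in> carrier A \<Longrightarrow> c \<in> carrier C \<Longrightarrow>
    AC_coaction R A C (pAC a c) = sw R C C DC (\<lambda>c1 c2. pDC (pAC (ainv A a) c1) (aut C c2)) (comult C c)"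
  unfolding AC_coaction_def by simp

lemma ccomult_theta: "x \<in> carrier AC \<Longrightarrow> ccomult E x = \<theta>D (AC_coaction R A C x)"
  unfolding ccomult_raw AC_coaction_def
  by (simp add: tlift_eq_sw[where M = A and N = C] tlift_eq_sw[where M = C and N = C])

lemma ccounit_sw: "x \<in> carrier AC \<Longrightarrow> ccounit E x = sw R A C A (\<lambda>a c. counit C c \<odot>\<^bsub>A\<^esub> aut A a) x"
  unfolding ccounit_raw by (simp add: tlift_eq_sw[where M = A and N = C])

lemma lin_map_ccomult: "lin_map R AC mDD (ccomult E)"
  by (rule lin_map_cong[OF _ ccomult_theta[symmetric]]) simp_all

lemma lin_map_ccounit: "lin_map R AC A (ccounit E)"
  by (rule lin_map_cong[OF _ ccounit_sw[symmetric]]) simp_all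

lemmas [simp] = lin_map_ccomult lin_map_closed[OF lin_map_ccomult] lin_map_comp[OF lin_map_ccomult]
  lin_map_ccounit lin_map_closed[OF lin_map_ccounit] lin_map_comp[OF lin_map_ccounit]

lemma ccomult_pure [simp]: "a \<in> carrier A \<Longrightarrow> c \<in> carrier C \<Longrightarrow>
    ccomult E (pAC a c) = sw R C C mDD (\<lambda>c1 c2. pDD (pAC (ainv A a) c1) (pAC \<one>\<^bsub>A\<^esub> c2)) (comult C c)"
  by (simp add: ccomult_theta)

lemma ccounit_pure [simp]: "a \<in> carrier A \<Longrightarrow> c \<in> carrier C \<Longrightarrow>
    ccounit E (pAC a c) = counit C c \<odot>\<^bsub>A\<^esub> aut A a"
  by (simp add: ccounit_sw)

text \<open>
  Left linearity of the comultiplication makes the left-hand side of the coassociativity law a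
  balanced sum.
\<close>

lemma ccomult_lact:
  assumes a: "a \<in> carrier A" and x: "x \<in> carrier AC"
  shows "ccomult E (lact D a x) = lact DD a (ccomult E x)"
  by (rule tensor_eqI[OF _ _ _ _ _ x, where P = mDD]) (use a in \<open>simp_all add: comult_aut[OF C]\<close>)

lemma ccomult_ainv:
  assumes x: "x \<in> carrier AC"
  shows "ccomult E (ainv (tensor R A C) x) = ainv (tensorA R A D D) (ccomult E x)"
  by (rule tensor_eqI[OF _ _ _ _ _ x, where P = mDD]) (simp_all add: comult_ainv[OF C])

end

context twisted_coring_module
begin

abbreviation "CC \<equiv> tensor_module R C C"
abbreviation "MCC \<equiv> tensor_module R M CC"
abbreviation "MDD \<equiv> tensorA_module R A M DD"
abbreviation "pMDD \<equiv> pureA R A M DD"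

lemma balance_data_MDD [simp]: "balance_data R A M DD"
  by (simp add: balance_data_def)

lemma pMDD_ract [simp]:
  "m \<in> carrier M \<Longrightarrow> a \<in> carrier A \<Longrightarrow> t \<in> carrier mDD \<Longrightarrow>
    pMDD (ract M m a) t = pMDD (aut M m) (lact DD a (ainv (tensorA R A D D) t))"
  using pureA_balanced[OF balance_data_MDD, of m a t] by simp

text \<open>
  This map carries the coassociativity law of a \<open>C\<close>-comodule to that of a coring comodule. It applies \<open>\<mu>\<close> to
  the first factor because \<open>\<mu>\<^sup>-\<^sup>1\<close> occurs on the left-hand side of the former and \<open>\<mu>\<close> on the right-hand
  side of the latter.
\<close>

definition theta2 where
  "theta2 = sw R M CC MDD (\<lambda>m t. sw R C C MDD (\<lambda>c d.
     pMDD (aut M m) (pDD (pAC \<one>\<^bsub>A\<^esub> (ainv C c)) (pAC \<one>\<^bsub>A\<^esub> (ainv C d)))) t)"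

text \<open>
  Moves the factor from \<open>A\<close> in \<open>M \<otimes>\<^sub>A ((A \<otimes> C) \<otimes> C)\<close> to \<open>M\<close>. The powers of \<open>\<mu>\<close> and \<open>\<gamma>\<close> are those that
  make \<open>theta2_inv\<close> undo \<open>theta2\<close>.
\<close>

definition move_factor where
  "move_factor m x d = sw R A C MCC
     (\<lambda>a c. pure R M CC (ract M (ainv M (ainv M m)) a) (pure R C C (aut C c) d)) x"

definition theta2_inv where
  "theta2_inv = swA R A M DD MCC (\<lambda>m t. sw R AC C MCC (move_factor m) (\<theta>D' t))"

lemma lin_map_theta2 [simp]: "lin_map R MCC MDD theta2"
  unfolding theta2_def by simp

lemma move_factor_linear [simp]:
  "x \<in> carrier AC \<Longrightarrow> d \<in> carrier C \<Longrightarrow> lin_map R M MCC (\<lambda>m. move_factor m x d)"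
  "m \<in> carrier M \<Longrightarrow> bilin_map R AC C MCC (move_factor m)"
  unfolding move_factor_def by simp_all

lemma move_factor_pure [simp]:
  "m \<in> carrier M \<Longrightarrow> a \<in> carrier A \<Longrightarrow> c \<in> carrier C \<Longrightarrow> d \<in> carrier C \<Longrightarrow> move_factor m (pAC a c) d =
    pure R M CC (ract M (ainv M (ainv M m)) a) (pure R C C (aut C c) d)"
  unfolding move_factor_def by simp

lemma move_factor_ract:
  assumes "m \<in> carrier M" "b \<in> carrier A" "x \<in> carrier AC" "d \<in> carrier C"
  shows "move_factor (ract M m b) x d =
    move_factor (aut M m) (lact D (ainv A b) (ainv (tensor R A C) x)) d"
  unfolding move_factor_def
  by (rule tensor_eqI[OF _ _ _ _ _ assms(3), where P = MCC]) (use assms in simp_all)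

lemma balanced_theta2_inv: "balanced A M DD (\<lambda>m t. sw R AC C MCC (move_factor m) (\<theta>D' t))"
proof (rule balancedI)
  fix m b t assume mb: "m \<in> carrier M" "b \<in> carrier A" and "t \<in> carrier DD"
  hence t: "t \<in> carrier mDD" by simp
  have f: "move_factor (ract M m b) (r z a) d =
      move_factor (aut M m) (lact D (ainv A b) (r (ainv (tensor R A C) z) (ainv A a))) d"
    if "z \<in> carrier AC" "a \<in> carrier A" "d \<in> carrier C" for z a d
    using move_factor_ract[of m b "r z a" d] mb that by simp
  show "sw R AC C MCC (move_factor (ract M m b)) (\<theta>D' t) =
      sw R AC C MCC (move_factor (aut M m)) (\<theta>D' (lact DD b (ainv DD t)))"
  proof (rule tensorA_eqI[OF DD.balance_data _ _ _ t, where P = MCC])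
    fix x y assume "x \<in> carrier D" "y \<in> carrier D"
    hence x: "x \<in> carrier AC" and y: "y \<in> carrier AC" by simp_all
    show "sw R AC C MCC (move_factor (ract M m b)) (\<theta>D' (pDD x y)) =
        sw R AC C MCC (move_factor (aut M m)) (\<theta>D' (lact DD b (ainv DD (pDD x y))))"
      unfolding DD.ainv_tensorAA
      by (rule tensor_eqI[OF _ _ _ _ _ y, where P = MCC]) (use mb x in \<open>simp_all add: f\<close>)
  qed (use mb in \<open>simp_all add: DD.ainv_tensorAA cong del: lin_map_weak_cong\<close>)
qed

lemma lin_map_theta2_inv [simp]: "lin_map R MDD MCC theta2_inv"
  unfolding theta2_inv_def using balanced_theta2_inv by (simp add: lin_map_comp[OF move_factor_linear(1)])

lemma theta2_inv_pureA [simp]: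
  assumes "m \<in> carrier M" "t \<in> carrier mDD"
  shows "theta2_inv (pMDD m t) = sw R AC C MCC (move_factor m) (\<theta>D' t)"
  unfolding theta2_inv_def
  by (rule swA_pureA[OF balance_data_MDD _ _ _ _ balanced_theta2_inv])
    (use assms in \<open>simp_all add: lin_map_comp[OF move_factor_linear(1)]\<close>)

lemma theta2_pure [simp]:
  "m \<in> carrier M \<Longrightarrow> t \<in> carrier CC \<Longrightarrow>
    theta2 (pure R M CC m t) = sw R C C MDD (\<lambda>c d.
      pMDD (aut M m) (pDD (pAC \<one>\<^bsub>A\<^esub> (ainv C c)) (pAC \<one>\<^bsub>A\<^esub> (ainv C d)))) t"
  unfolding theta2_def by simp

lemmas [simp] = lin_map_comp[OF lin_map_theta2] lin_map_comp[OF lin_map_theta2_inv]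
  sw_push[OF lin_map_theta2] lin_map_closed[OF lin_map_theta2]

lemma theta2_inj:
  assumes "s \<in> carrier MCC" "t \<in> carrier MCC"
  shows "theta2 s = theta2 t \<longleftrightarrow> s = t"
proof -
  have "theta2_inv (theta2 t) = t" if t: "t \<in> carrier MCC" for t
  proof (rule tensor_eqI[OF _ _ _ _ _ t, where P = MCC])
    fix m u assume m: "m \<in> carrier M" and u: "u \<in> carrier CC"
    show "theta2_inv (theta2 (pure R M CC m u)) = pure R M CC m u"
      by (rule tensor_eqI[OF _ _ _ _ _ u, where P = MCC]) (use m in simp_all)
  qed simp_all
  thus ?thesis using assms by metis
qed

section \<open>Comodules over the coring and entwined modules\<close>

definition compatible where
  "compatible \<rho> \<longleftrightarrow> (\<forall>m \<in> carrier M. \<forall>a \<in> carrier A. \<rho> (ract M m a) =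
     sw R M C MC (\<lambda>m c. sw R A C MC (\<lambda>b d. pMC (ract M m b) (aut C d)) (\<psi> (pCA c (ainv A a)))) (\<rho> m))"

definition equivariant where
  "equivariant \<rho> \<longleftrightarrow> (\<forall>m \<in> carrier M.
     \<rho> (aut M m) = sw R M C MC (\<lambda>m c. pMC (aut M m) (aut C c)) (\<rho> m))"

context
  fixes \<rho> \<sigma>
  assumes \<rho>: "lin_map R M MC \<rho>" and \<sigma>: "\<And>m. m \<in> carrier M \<Longrightarrow> \<sigma> m = \<theta> (\<rho> m)"
begin

lemmas [simp] = \<rho> lin_map_closed[OF \<rho>] lin_map_comp[OF \<rho>]

lemma lin_map_sigma: "lin_map R M MD \<sigma>"
  by (rule lin_map_cong[OF _ \<sigma>[symmetric]]) simp_all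

lemma right_linear_sigma:
  "right_linear R A M (tensorA R A M D) \<sigma> \<longleftrightarrow> equivariant \<rho> \<and> compatible \<rho>"
proof -
  have "aut (tensorA R A M D) (\<sigma> m) = \<sigma> (aut M m) \<longleftrightarrow>
      \<rho> (aut M m) = sw R M C MC (\<lambda>m c. pMC (aut M m) (aut C c)) (\<rho> m)" if m: "m \<in> carrier M" for m
  proof -
    let ?s = "sw R M C MC (\<lambda>m c. pMC (aut M m) (aut C c)) (\<rho> m)"
    have "aut (tensorA R A M D) (\<sigma> m) = \<theta> ?s"
      using m by (simp only: \<sigma> aut_theta lin_map_closed[OF \<rho>])
    moreover have "\<sigma> (aut M m) = \<theta> (\<rho> (aut M m))" using m by (simp add: \<sigma>)
    moreover have "\<theta> ?s = \<theta> (\<rho> (aut M m)) \<longleftrightarrow> ?s = \<rho> (aut M m)"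
      using m by (intro theta_inj) simp_all
    ultimately show ?thesis by metis
  qed
  hence "(\<forall>m \<in> carrier M. aut (tensorA R A M D) (\<sigma> m) = \<sigma> (aut M m)) \<longleftrightarrow> equivariant \<rho>"
    unfolding equivariant_def by blast
  moreover
  have "\<sigma> (ract M m a) = ract (tensorA R A M D) (\<sigma> m) a \<longleftrightarrow> \<rho> (ract M m a) =
      sw R M C MC (\<lambda>m c. sw R A C MC (\<lambda>b d. pMC (ract M m b) (aut C d)) (\<psi> (pCA c (ainv A a)))) (\<rho> m)"
    if m: "m \<in> carrier M" and a: "a \<in> carrier A" for m a
  proof -
    let ?s = "sw R M C MC
      (\<lambda>m c. sw R A C MC (\<lambda>b d. pMC (ract M m b) (aut C d)) (\<psi> (pCA c (ainv A a)))) (\<rho> m)"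
    have "ract (tensorA R A M D) (\<sigma> m) a = \<theta> ?s"
      using m a by (simp only: \<sigma> ract_theta lin_map_closed[OF \<rho>])
    moreover have "\<sigma> (ract M m a) = \<theta> (\<rho> (ract M m a))" using m a by (simp add: \<sigma>)
    moreover have "\<theta> (\<rho> (ract M m a)) = \<theta> ?s \<longleftrightarrow> \<rho> (ract M m a) = ?s"
      using m a by (intro theta_inj) simp_all
    ultimately show ?thesis by metis
  qed
  hence "(\<forall>m \<in> carrier M. \<forall>a \<in> carrier A. \<sigma> (ract M m a) = ract (tensorA R A M D) (\<sigma> m) a)
      \<longleftrightarrow> compatible \<rho>"
    unfolding compatible_def by blast
  ultimately show ?thesis
    using lin_map_sigma by (simp add: right_linear_def hom_morphism_def)
qed

lemma counit_sigma:
  assumes "m \<in> carrier M"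
  shows "tliftA R M (\<lambda>m0 m1. ract M m0 (ccounit E m1)) (\<sigma> m) =
    aut M (sw R M C M (\<lambda>m0 m1. counit C m1 \<odot>\<^bsub>M\<^esub> m0) (\<rho> m))"
proof -
  have b: "balanced A M D (\<lambda>m0 m1. ract M m0 (ccounit E m1))"
  proof (rule balancedI)
    fix m b x assume mb: "m \<in> carrier M" "b \<in> carrier A" and "x \<in> carrier D"
    hence x: "x \<in> carrier AC" by simp
    show "ract M (ract M m b) (ccounit E x) = ract M (aut M m) (ccounit E (lact D b (ainv D x)))"
      unfolding ainv_AC_bimod
      by (rule tensor_eqI[OF _ _ _ _ _ x, where P = M])
        (use mb in simp_all)
  qed
  have "tliftA R M (\<lambda>m0 m1. ract M m0 (ccounit E m1)) (\<sigma> m) =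
      swA R A M D M (\<lambda>m0 m1. ract M m0 (ccounit E m1)) (\<theta> (\<rho> m))"
    using assms by (simp add: \<sigma> tliftA_eq_swA[OF _ MD.balance_data])
  also have "\<dots> = sw R M C M (\<lambda>m c. ract M m (ccounit E (pAC \<one>\<^bsub>A\<^esub> (ainv C c)))) (\<rho> m)"
    using assms b by (intro swA_theta) simp_all
  also have "\<dots> = aut M (sw R M C M (\<lambda>m0 m1. counit C m1 \<odot>\<^bsub>M\<^esub> m0) (\<rho> m))"
    using assms by simp
  finally show ?thesis .
qed

lemma coassoc_left_sigma:
  assumes "m \<in> carrier M"
  shows "tliftA R MDD (\<lambda>m0 m1. pMDD m0 (ccomult E m1)) (\<sigma> m) =
    theta2 (sw R M C MCC (\<lambda>m0 m1. pure R M CC (ainv M m0) (comult C m1)) (\<rho> m))"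
proof -
  have b: "balanced A M D (\<lambda>m0 m1. pMDD m0 (ccomult E m1))"
    by (rule balancedI) (simp add: ccomult_lact ccomult_ainv)
  have "tliftA R MDD (\<lambda>m0 m1. pMDD m0 (ccomult E m1)) (\<sigma> m) =
      swA R A M D MDD (\<lambda>m0 m1. pMDD m0 (ccomult E m1)) (\<theta> (\<rho> m))"
    using assms by (simp add: \<sigma> tliftA_eq_swA[OF _ MD.balance_data])
  also have "\<dots> = sw R M C MDD (\<lambda>m0 c. pMDD m0 (ccomult E (pAC \<one>\<^bsub>A\<^esub> (ainv C c)))) (\<rho> m)"
    using assms b by (intro swA_theta) simp_all
  also have "\<dots> = theta2 (sw R M C MCC (\<lambda>m0 m1. pure R M CC (ainv M m0) (comult C m1)) (\<rho> m))"
    using assms by (simp add: comult_ainv[OF C])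
  finally show ?thesis .
qed

text \<open>
  The relation \<open>xa \<otimes>\<^sub>A y = \<chi>(x) \<otimes>\<^sub>A a\<chi>\<^sup>-\<^sup>1(y)\<close> read from right to left, against the direction in which it is
  used for rewriting.
\<close>

lemma pDD_lact:
  assumes "c \<in> carrier C" "a \<in> carrier A" "y \<in> carrier AC"
  shows "pDD (pAC \<one>\<^bsub>A\<^esub> c) (lact D a (ainv (tensor R A C) (ainv (tensor R A C) y))) =
    sw R A C mDD (\<lambda>b d. pDD (pAC b d) (ainv (tensor R A C) y)) (\<psi> (pCA c a))"
proof -
  have "pDD (r (pAC \<one>\<^bsub>A\<^esub> (ainv C c)) a) (ainv (tensor R A C) y) =
    pDD (aut (tensor R A C) (pAC \<one>\<^bsub>A\<^esub> (ainv C c)))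
      (lact D a (ainv (tensor R A C) (ainv (tensor R A C) y)))"
    using assms by (intro DD.pureA_ract[unfolded AC_bimod_rules]) simp_all
  thus ?thesis using assms by simp
qed

text \<open>
  The outer sum on the right-hand side of the coassociativity law is balanced because \<open>\<rho>\<close> is
  equivariant and compatible, that is, because \<open>\<sigma>\<close> is right linear.
\<close>

lemma coassoc_right_sigma:
  assumes eq: "equivariant \<rho>" and comp: "compatible \<rho>" and m: "m \<in> carrier M"
  shows "tliftA R MDD (\<lambda>m0 m1. tliftA R MDD
      (\<lambda>m00 m01. pMDD (aut M m00) (pDD m01 (ainv E m1))) (\<sigma> m0)) (\<sigma> m) =
    theta2 (sw R M C MCC (\<lambda>m0 m1. sw R M C MCC
      (\<lambda>m00 m01. pure R M CC m00 (pure R C C m01 (ainv C m1))) (\<rho> m0)) (\<rho> m))"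
proof -
  define F where "F m0 y = sw R M C MDD
    (\<lambda>m00 c. pMDD (aut M m00) (pDD (pAC \<one>\<^bsub>A\<^esub> (ainv C c)) (ainv (tensor R A C) y))) (\<rho> m0)" for m0 y
  have inner: "tliftA R MDD (\<lambda>m00 m01. pMDD (aut M m00) (pDD m01 (ainv (tensor R A C) y))) (\<sigma> m0) = F m0 y"
    if "m0 \<in> carrier M" "y \<in> carrier AC" for m0 y
  proof -
    have b: "balanced A M D (\<lambda>m00 m01. pMDD (aut M m00) (pDD m01 (ainv (tensor R A C) y)))"
      using that by (intro balancedI) simp
    have "tliftA R MDD (\<lambda>m00 m01. pMDD (aut M m00) (pDD m01 (ainv (tensor R A C) y))) (\<sigma> m0) =
        swA R A M D MDD (\<lambda>m00 m01. pMDD (aut M m00) (pDD m01 (ainv (tensor R A C) y))) (\<theta> (\<rho> m0))"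
      using that by (simp add: \<sigma> tliftA_eq_swA[OF _ MD.balance_data])
    also have "\<dots> = F m0 y"
      unfolding F_def using that b by (intro swA_theta) simp_all
    finally show ?thesis .
  qed
  have lF: "bilin_map R M AC MDD F"
    unfolding F_def by simp
  have bF: "balanced A M D F"
  proof (rule balancedI)
    fix m a y assume ma: "m \<in> carrier M" "a \<in> carrier A" and "y \<in> carrier D"
    hence y: "y \<in> carrier AC" by simp
    have e: "\<rho> (aut M m) = sw R M C MC (\<lambda>m c. pMC (aut M m) (aut C c)) (\<rho> m)"
      using eq ma by (simp add: equivariant_def)
    have c: "\<rho> (ract M m a) = sw R M C MC
        (\<lambda>m c. sw R A C MC (\<lambda>b d. pMC (ract M m b) (aut C d)) (\<psi> (pCA c (ainv A a)))) (\<rho> m)"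
      using comp ma by (simp add: compatible_def)
    show "F (ract M m a) y = F (aut M m) (lact D a (ainv D y))"
      unfolding F_def e c ainv_AC_bimod using ma y by (simp add: pDD_lact)
  qed
  have "tliftA R MDD (\<lambda>m0 m1. tliftA R MDD
      (\<lambda>m00 m01. pMDD (aut M m00) (pDD m01 (ainv E m1))) (\<sigma> m0)) (\<sigma> m) = swA R A M D MDD F (\<theta> (\<rho> m))"
  proof -
    have "tliftA R MDD (\<lambda>m0 m1. tliftA R MDD
        (\<lambda>m00 m01. pMDD (aut M m00) (pDD m01 (ainv E m1))) (\<sigma> m0)) (\<sigma> m) =
      swA R A M D MDD (\<lambda>m0 m1. tliftA R MDD
        (\<lambda>m00 m01. pMDD (aut M m00) (pDD m01 (ainv (tensor R A C) m1))) (\<sigma> m0)) (\<theta> (\<rho> m))"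
      using m by (simp add: \<sigma>[OF m] tliftA_eq_swA[OF _ MD.balance_data])
    also have "\<dots> = swA R A M D MDD F (\<theta> (\<rho> m))"
      by (rule swA_cong) (simp_all add: inner)
    finally show ?thesis .
  qed
  also have "\<dots> = sw R M C MDD (\<lambda>m c. F m (pAC \<one>\<^bsub>A\<^esub> (ainv C c))) (\<rho> m)"
    using m lF bF by (intro swA_theta) simp_all
  also have "\<dots> = theta2 (sw R M C MCC (\<lambda>m0 m1. sw R M C MCC
      (\<lambda>m00 m01. pure R M CC m00 (pure R C C m01 (ainv C m1))) (\<rho> m0)) (\<rho> m))"
    unfolding F_def using m by simp
  finally show ?thesis .
qed

text \<open>
  Each axiom of a coring comodule for \<open>\<sigma>\<close> is the image of one axiom for \<open>\<rho>\<close> under an injective map: under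
  \<open>\<theta>\<close> for equivariance and compatibility, under \<open>\<mu>\<close> for the counit law, and under \<open>theta2\<close> for
  coassociativity.
\<close>

theorem coring_comodule_iff:
  "coring_comodule R A E M \<sigma> \<longleftrightarrow> hom_comodule R C M \<rho> \<and> compatible \<rho>"
proof -
  note MM = right_hom_moduleD(1)[OF M]
  have coun: "tliftA R M (\<lambda>m0 m1. ract M m0 (ccounit E m1)) (\<sigma> m) = m \<longleftrightarrow>
      sw R M C M (\<lambda>m0 m1. counit C m1 \<odot>\<^bsub>M\<^esub> m0) (\<rho> m) = ainv M m" if m: "m \<in> carrier M" for m
  proof -
    have "sw R M C M (\<lambda>m0 m1. counit C m1 \<odot>\<^bsub>M\<^esub> m0) (\<rho> m) \<in> carrier M"
      using m by simp
    thus ?thesis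
      unfolding counit_sigma[OF m] using m by (metis aut_ainv[OF MM] ainv_aut[OF MM])
  qed
  have last: "\<sigma> (aut M m) = tliftA R (tensorA R A M D) (\<lambda>m0 m1. pMD (aut M m0) (aut D m1)) (\<sigma> m) \<longleftrightarrow>
      aut (tensorA R A M D) (\<sigma> m) = \<sigma> (aut M m)" if m: "m \<in> carrier M" for m
  proof -
    have s: "\<sigma> m \<in> carrier MD" using lin_map_closed[OF lin_map_sigma m] .
    have "aut (tensorA R A M D) (\<sigma> m) =
        tliftA R (tensorA R A M D) (\<lambda>m0 m1. pMD (aut M m0) (aut D m1)) (\<sigma> m)"
      by (simp only: MD.aut_tensorA[OF s] tliftA_eq_swA[OF s MD.balance_data] tensor_record_rules)
    thus ?thesis by metis
  qed
  have raw: "coring_comodule R A E M \<sigma> \<longleftrightarrow> right_linear R A M (tensorA R A M D) \<sigma> \<and>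
     (\<forall>m \<in> carrier M.
        tliftA R MDD (\<lambda>m0 m1. pMDD m0 (ccomult E m1)) (\<sigma> m) =
        tliftA R MDD (\<lambda>m0 m1. tliftA R MDD
          (\<lambda>m00 m01. pMDD (aut M m00) (pDD m01 (ainv E m1))) (\<sigma> m0)) (\<sigma> m)) \<and>
     (\<forall>m \<in> carrier M. tliftA R M (\<lambda>m0 m1. ract M m0 (ccounit E m1)) (\<sigma> m) = m) \<and>
     (\<forall>m \<in> carrier M. \<sigma> (aut M m) =
        tliftA R (tensorA R A M D) (\<lambda>m0 m1. pMD (aut M m0) (aut D m1)) (\<sigma> m))"
    unfolding coring_comodule_def Let_def using M
    by (simp only: AC_coring_rules tensor_record_rules simp_thms)
  show ?thesis
  proof
    assume L: "coring_comodule R A E M \<sigma>"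
    hence eq: "equivariant \<rho>" and comp: "compatible \<rho>"
      unfolding raw right_linear_sigma by blast+
    have "hom_comodule R C M \<rho>"
    proof (rule hom_comoduleI[OF C MM \<rho>])
      fix m assume m: "m \<in> carrier M"
      show "\<rho> (aut M m) = sw R M C MC (\<lambda>m c. pMC (aut M m) (aut C c)) (\<rho> m)"
        using eq m by (simp add: equivariant_def)
      show "sw R M C M (\<lambda>m0 m1. counit C m1 \<odot>\<^bsub>M\<^esub> m0) (\<rho> m) = ainv M m"
        using L m unfolding raw by (simp only: coun[OF m, symmetric])
      let ?X = "sw R M C MCC (\<lambda>m0 m1. pure R M CC (ainv M m0) (comult C m1)) (\<rho> m)"
      let ?Y = "sw R M C MCC (\<lambda>m0 m1. sw R M C MCC
          (\<lambda>m00 m01. pure R M CC m00 (pure R C C m01 (ainv C m1))) (\<rho> m0)) (\<rho> m)"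
      have "theta2 ?X = theta2 ?Y"
        using L m unfolding raw coassoc_left_sigma[OF m, symmetric] coassoc_right_sigma[OF eq comp m, symmetric]
        by blast
      thus "?X = ?Y"
        using m by (subst (asm) theta2_inj) simp_all
    qed
    with comp show "hom_comodule R C M \<rho> \<and> compatible \<rho>" by blast
  next
    assume Rt: "hom_comodule R C M \<rho> \<and> compatible \<rho>"
    hence comp: "compatible \<rho>" and H: "hom_comodule R C M \<rho>" by blast+
    have eq: "equivariant \<rho>"
      unfolding equivariant_def using coaction_aut[OF C H] by simp
    have rl: "right_linear R A M (tensorA R A M D) \<sigma>"
      using right_linear_sigma eq comp by blast
    show "coring_comodule R A E M \<sigma>"
      unfolding raw
    proof (intro conjI ballI rl)
      fix m assume m: "m \<in> carrier M"
      show "tliftA R M (\<lambda>m0 m1. ract M m0 (ccounit E m1)) (\<sigma> m) = m"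
        unfolding coun[OF m] by (rule coaction_counit_raw[OF C H m])
      show "\<sigma> (aut M m) = tliftA R (tensorA R A M D) (\<lambda>m0 m1. pMD (aut M m0) (aut D m1)) (\<sigma> m)"
        unfolding last[OF m] using rl m by (simp only: right_linear_def hom_morphism_def)
      show "tliftA R MDD (\<lambda>m0 m1. pMDD m0 (ccomult E m1)) (\<sigma> m) =
        tliftA R MDD (\<lambda>m0 m1. tliftA R MDD
          (\<lambda>m00 m01. pMDD (aut M m00) (pDD m01 (ainv E m1))) (\<sigma> m0)) (\<sigma> m)"
        unfolding coassoc_left_sigma[OF m] coassoc_right_sigma[OF eq comp m]
        by (simp only: coaction_coassoc_raw[OF C H m])
    qed
  qed
qed

end

end

section \<open>From entwining structures to corings\<close>

context twisted_coring
begin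

lemmas [simp] = sw_push[OF lin_map_ccounit] sw_push[OF lin_map_ccomult]

lemma ccounit_aut:
  assumes x: "x \<in> carrier AC"
  shows "ccounit E (aut (tensor R A C) x) = aut A (ccounit E x)"
  by (rule tensor_eqI[OF _ _ _ _ _ x, where P = A]) simp_all

lemma ccounit_lact:
  assumes x: "x \<in> carrier AC" and a: "a \<in> carrier A"
  shows "ccounit E (lact D a x) = a \<otimes>\<^bsub>A\<^esub> ccounit E x"
  by (rule tensor_eqI[OF _ _ _ _ _ x, where P = A]) (use a in simp_all)

end

context entwined_bimodule
begin

sublocale twisted_coring R A C \<psi> r
  by (intro twisted_coring.intro twisted_coring_axioms.intro twisted_bimodule_axioms hom_bimodule_D)

text \<open>
  Coassociativity of the coaction is coassociativity of \<open>C\<close>, applied to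
  \<open>x \<otimes> y \<otimes> z \<mapsto> (\<alpha>\<^sup>-\<^sup>2(a) \<otimes> x) \<otimes> (\<gamma>(y) \<otimes> \<gamma>(z))\<close>; its counit law is the right counit law of \<open>C\<close>.
\<close>

lemma coact_comodule: "hom_comodule R C D (AC_coaction R A C)"
proof (rule hom_comoduleI[OF C hom_object_D])
  show "lin_map R D (tensor_module R D C) (AC_coaction R A C)" by simp
  fix m assume "m \<in> carrier D"
  hence m: "m \<in> carrier AC" by simp
  let ?CC = "tensor_module R C C" and ?\<rho> = "AC_coaction R A C"
  let ?T = "tensor_module R AC ?CC"
  let ?l = "\<lambda>m. sw R AC C ?T (\<lambda>m0 m1. pure R AC ?CC (ainv (tensor R A C) m0) (comult C m1)) (?\<rho> m)"
  let ?r = "\<lambda>m. sw R AC C ?T (\<lambda>m0 m1. sw R AC C ?T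
      (\<lambda>m00 m01. pure R AC ?CC m00 (pure R C C m01 (ainv C m1))) (?\<rho> m0)) (?\<rho> m)"
  have "?l m = ?r m"
  proof (rule tensor_eqI[OF _ _ _ _ _ m, where P = ?T])
    fix a c assume ac: "a \<in> carrier A" "c \<in> carrier C"
    show "?l (pAC a c) = ?r (pAC a c)"
      using ac comult_coassoc[OF C, where Q = ?T and m = c and
        g = "\<lambda>x y z. pure R AC ?CC (pAC (ainv A (ainv A a)) x) (pure R C C (aut C y) (aut C z))"]
      by (simp add: comult_aut[OF C])
  qed simp_all
  thus "sw R D C (tensor_module R D ?CC)
        (\<lambda>m0 m1. pure R D ?CC (ainv D m0) (comult C m1)) (?\<rho> m) =
      sw R D C (tensor_module R D ?CC)
        (\<lambda>m0 m1. sw R D C (tensor_module R D ?CC)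
          (\<lambda>m00 m01. pure R D ?CC m00 (pure R C C m01 (ainv C m1))) (?\<rho> m0)) (?\<rho> m)"
    by simp
  let ?e = "\<lambda>m. sw R AC C AC (\<lambda>m0 m1. counit C m1 \<odot>\<^bsub>AC\<^esub> m0) (?\<rho> m)"
  have "?e m = ainv (tensor R A C) m"
  proof (rule tensor_eqI[OF _ _ _ _ _ m, where P = AC])
    fix a c assume ac: "a \<in> carrier A" "c \<in> carrier C"
    show "?e (pAC a c) = ainv (tensor R A C) (pAC a c)"
      using ac counit_right[OF C, where Q = AC and m = c and h = "\<lambda>x. pAC (ainv A a) x"] by simp
  qed simp_all
  thus "sw R D C D (\<lambda>m0 m1. counit C m1 \<odot>\<^bsub>D\<^esub> m0) (?\<rho> m) = ainv D m" by simp
  have "?\<rho> (aut (tensor R A C) m) =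
      sw R AC C DC (\<lambda>m0 m1. pDC (aut (tensor R A C) m0) (aut C m1)) (?\<rho> m)"
    by (rule tensor_eqI[OF _ _ _ _ _ m, where P = DC]) (simp_all add: comult_aut[OF C])
  thus "?\<rho> (aut D m) = sw R D C (tensor_module R D C)
      (\<lambda>m0 m1. pure R D C (aut D m0) (aut C m1)) (?\<rho> m)" by simp
qed

text \<open>
  On \<open>a' \<otimes> c\<close> this is the law for \<open>\<psi>\<close> and \<open>\<Delta>\<close>, applied to
  \<open>x \<otimes> y \<otimes> z \<mapsto> (\<alpha>\<^sup>-\<^sup>1(a')x \<otimes> \<gamma>(y)) \<otimes> \<gamma>\<^sup>2(z)\<close>.
\<close>

lemma coact_compatible: "DC.compatible (AC_coaction R A C)"
proof -
  have "AC_coaction R A C (r x a) = sw R AC C DC (\<lambda>m c. sw R A C DC (\<lambda>b d. pDC (r m b) (aut C d))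
      (\<psi> (pCA c (ainv A a)))) (AC_coaction R A C x)" if x: "x \<in> carrier AC" and a: "a \<in> carrier A" for x a
  proof (rule tensor_eqI[OF _ _ _ _ _ x, where P = DC])
    fix a' c assume ac: "a' \<in> carrier A" "c \<in> carrier C"
    show "AC_coaction R A C (r (pAC a' c) a) = sw R AC C DC (\<lambda>m c. sw R A C DC
        (\<lambda>b d. pDC (r m b) (aut C d)) (\<psi> (pCA c (ainv A a)))) (AC_coaction R A C (pAC a' c))"
      using ac a psi_comult[where Q = DC and a = "ainv A a" and c = c and
        g = "\<lambda>x y z. pDC (pAC (ainv A a' \<otimes>\<^bsub>A\<^esub> x) (aut C y)) (aut C (aut C z))"]
      by (simp add: comult_aut[OF C])
  qed (use a in simp_all)
  thus ?thesis unfolding DC.compatible_def by simp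
qed

lemma coring_comodule_D: "coring_comodule R A E D (ccomult E)"
  using coact_comodule coact_compatible
  by (subst DC.coring_comodule_iff[where \<rho> = "AC_coaction R A C"]) (simp_all add: ccomult_theta)

lemma ccounit_ract:
  assumes x: "x \<in> carrier AC" and a: "a \<in> carrier A"
  shows "ccounit E (r x a) = ccounit E x \<otimes>\<^bsub>A\<^esub> a"
proof (rule tensor_eqI[OF _ _ _ _ _ x, where P = A])
  fix a' c assume ac: "a' \<in> carrier A" "c \<in> carrier C"
  show "ccounit E (r (pAC a' c) a) = ccounit E (pAC a' c) \<otimes>\<^bsub>A\<^esub> a"
    using ac a psi_counit[where Q = A and a = "ainv A a" and c = c and h = "\<lambda>b. aut A a' \<otimes>\<^bsub>A\<^esub> aut A b"]
    by simp
qed (use a in simp_all)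

text \<open>
  The left counit law is not among the axioms of a right comodule; it follows from the left counit law
  of \<open>C\<close>, the sum being balanced because the counit of \<open>A \<otimes> C\<close> is right linear.
\<close>

lemma left_counit:
  assumes x: "x \<in> carrier AC"
  shows "swA R A D D AC (\<lambda>x1 x2. lact D (ccounit E x1) x2) (ccomult E x) = x"
proof -
  have b: "balanced A D D (\<lambda>x1 x2. lact D (ccounit E x1) x2)"
    by (rule balancedI) (simp add: ccounit_ract ccounit_aut)
  have "swA R A D D AC (\<lambda>x1 x2. lact D (ccounit E x1) x2) (ccomult E x) =
    sw R AC C AC (\<lambda>m c. lact D (ccounit E m) (pAC \<one>\<^bsub>A\<^esub> (ainv C c))) (AC_coaction R A C x)"
    using x b by (simp only: ccomult_theta, intro DC.swA_theta[unfolded AC_bimod_rules]) simp_all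
  also have "\<dots> = x"
  proof (rule tensor_eqI[OF _ _ _ _ _ x, where P = AC])
    fix a c assume ac: "a \<in> carrier A" "c \<in> carrier C"
    show "sw R AC C AC (\<lambda>m c. lact D (ccounit E m) (pAC \<one>\<^bsub>A\<^esub> (ainv C c))) (AC_coaction R A C (pAC a c)) = pAC a c"
      using ac counit_left[OF C, where Q = AC and c = c and h = "\<lambda>x. pAC a (aut C x)"]
      by (simp add: bilin_map_smult1[OF bilin_map_lact])
  qed simp_all
  finally show ?thesis .
qed

theorem hom_coring_E: "hom_coring R A E"
proof -
  have cd: "right_linear R A D (tensorA R A D D) (ccomult E)"
    "\<And>x. x \<in> carrier AC \<Longrightarrow> tliftA R (tensorA R A D DD) (\<lambda>x1 x2. pureA R A D DD x1 (ccomult E x2)) (ccomult E x) =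
        tliftA R (tensorA R A D DD) (\<lambda>x1 x2. tliftA R (tensorA R A D DD)
          (\<lambda>x11 x12. pureA R A D DD (aut D x11) (pureA R A D D x12 (ainv D x2))) (ccomult E x1)) (ccomult E x)"
    "\<And>x. x \<in> carrier AC \<Longrightarrow> tliftA R D (\<lambda>x1 x2. r x1 (ccounit E x2)) (ccomult E x) = x"
    "\<And>x. x \<in> carrier AC \<Longrightarrow> ccomult E (aut D x) =
        tliftA R (tensorA R A D D) (\<lambda>x1 x2. pureA R A D D (aut D x1) (aut D x2)) (ccomult E x)"
    using coring_comodule_D unfolding coring_comodule_def Let_def by simp_all
  have "bilinear R A E DD (ccomult E)"
    unfolding bilinear_def left_linear_AC_coring right_linear_AC_coring
    using cd(1) by (simp add: left_linear_def right_linear_def hom_morphism_def ccomult_lact)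
  moreover have "bilinear R A E (regular_bimod A) (ccounit E)"
  proof -
    have "same_module (regular_bimod A) A"
      by (simp add: same_module_def regular_bimod_def hmod.defs)
    note s = same_module_rules[OF this]
    show ?thesis
      by (simp add: bilinear_def left_linear_def right_linear_def hom_morphism_def s
        ccounit_aut ccounit_ract ccounit_lact) (simp add: regular_bimod_def hmod.defs)
  qed
  moreover have "tliftA R E (\<lambda>x1 x2. lact E (ccounit E x1) x2) (ccomult E x) = x" if "x \<in> carrier AC" for x
    using left_counit[OF that] that by (simp add: tliftA_eq_swA[OF _ DD.balance_data])
  ultimately show ?thesis
    unfolding hom_coring_def Let_def using cd(2-4)
    by (simp add: hom_bimodule_AC_coring hom_bimodule_D ccounit_aut)
qed

end

section \<open>From corings to entwining structures\<close>

locale coring_structure = algebra_coalgebra +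
  assumes coring: "hom_coring R A (AC_coring R A C r)"
begin

lemma hom_bimodule_D: "hom_bimodule R A D"
  using coring by (simp add: hom_coring_def Let_def hom_bimodule_AC_coring)

lemmas [simp] = AC_bimod_rules hom_bimodule_rules[OF A hom_bimodule_D, unfolded AC_bimod_rules]
  hom_bimodule_rules[OF A hom_bimodule_D, unfolded same_module_rules[OF same_module_AC_bimod]]

abbreviation "\<Psi> \<equiv> coring_psi R A C r"

lemma bilin_map_r: "bilin_map R AC A AC r"
  using right_hom_moduleD(2)[OF hom_bimoduleD(2)[OF hom_bimodule_D]] unfolding AC_bimod_rules .

lemma coring_psi_pure:
  assumes "c \<in> carrier C" "a \<in> carrier A"
  shows "\<Psi> (pCA c a) = r (pAC \<one>\<^bsub>A\<^esub> (ainv C c)) a"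
  unfolding coring_psi_def tensor_record_rules using assms by (intro tlift_pure) simp_all

lemma lin_map_coring_psi: "lin_map R (tensor_module R C A) AC \<Psi>"
  unfolding coring_psi_def tensor_record_rules by (intro lin_map_tlift) simp_all

text \<open>
  Since \<open>a' \<otimes> c = a'(1 \<otimes> \<gamma>\<^sup>-\<^sup>1(c))\<close>, the compatibility of the two actions determines the right action from
  its values on \<open>1 \<otimes> c\<close>.
\<close>

lemma r_psi:
  assumes "a \<in> carrier A" "a' \<in> carrier A" "c \<in> carrier C"
  shows "r (pAC a' c) a = sw R A C AC (\<lambda>b d. pAC (a' \<otimes>\<^bsub>A\<^esub> b) (aut C d)) (\<Psi> (pCA c (ainv A a)))"
proof -
  have "r (pAC a' c) a = r (lact D a' (pAC \<one>\<^bsub>A\<^esub> (ainv C c))) a"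
    using assms by simp
  also have "\<dots> = lact D (aut A a') (r (pAC \<one>\<^bsub>A\<^esub> (ainv C c)) (ainv A a))"
    using assms by (simp del: lact_D_pure)
  also have "\<dots> = sw R A C AC (\<lambda>b d. pAC (ainv A (aut A a') \<otimes>\<^bsub>A\<^esub> b) (aut C d)) (\<Psi> (pCA c (ainv A a)))"
    using assms by (simp add: lact_D coring_psi_pure)
  finally show ?thesis using assms by simp
qed

lemma hom_morphism_coring_psi: "hom_morphism R (tensor R C A) (tensor R A C) \<Psi>"
  unfolding hom_morphism_def
proof (intro conjI ballI)
  note objs = hom_coalgebraD(1)[OF C] hom_algebraD(1)[OF A]
  show "lin_map R (tensor R C A) (tensor R A C) \<Psi>"
    using lin_map_coring_psi by simp
  fix t assume "t \<in> carrier (tensor R C A)"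
  hence t: "t \<in> carrier (tensor_module R C A)" by simp
  show "aut (tensor R A C) (\<Psi> t) = \<Psi> (aut (tensor R C A) t)"
    by (rule tensor_eqI[OF _ _ _ _ _ t, where P = AC])
      (simp_all add: lin_map_comp[OF lin_map_coring_psi] aut_tensor_pure[OF objs] coring_psi_pure
        lin_map_coring_psi hom_object_rules[OF hom_object_tensor[OF objs], unfolded tensor_record_rules])
qed

sublocale twisted_coring R A C \<Psi> r
  by (intro twisted_coring.intro twisted_bimodule.intro algebra_coalgebra_axioms
      twisted_bimodule_axioms.intro twisted_coring_axioms.intro hom_bimodule_D hom_morphism_coring_psi
      bilin_map_r r_psi)

lemma psi_expand: "t \<in> carrier AC \<Longrightarrow> a \<in> carrier A \<Longrightarrow> r t a = sw R A C AC (\<lambda>b d. r (pAC b d) a) t"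
  using sw_push1[OF bilin_map_r, of a A C t pAC] by (simp add: sw_pure_id)

text \<open>
  The laws for \<open>\<psi>\<close> on \<open>1\<close> and on products are the unit law and the associativity of the right
  action at \<open>1 \<otimes> \<gamma>\<^sup>-\<^sup>1(c)\<close>. The laws that involve \<open>\<epsilon>\<close> and \<open>\<Delta>\<close> express that the counit and the
  comultiplication of the coring are right linear at this element.
\<close>

theorem hom_entwining_coring_psi: "hom_entwining R A C \<Psi>"
  unfolding hom_entwining_iff
proof (intro conjI ballI)
  fix c assume "c \<in> carrier C"
  thus "\<Psi> (pCA c \<one>\<^bsub>A\<^esub>) = pAC \<one>\<^bsub>A\<^esub> c" by (rule psi_unit)
next
  fix a a' c assume ac: "a \<in> carrier A" "a' \<in> carrier A" "c \<in> carrier C"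
  have "\<Psi> (pCA (aut C c) (a \<otimes>\<^bsub>A\<^esub> a')) = r (aut (tensor R A C) (pAC \<one>\<^bsub>A\<^esub> (ainv C c))) (a \<otimes>\<^bsub>A\<^esub> a')"
    using ac by (simp add: coring_psi_pure del: psi_aut r_pure_raw)
  also have "\<dots> = r (r (pAC \<one>\<^bsub>A\<^esub> (ainv C c)) a) (aut A a')"
    using ac by (intro right_hom_moduleD(3)[OF hom_bimoduleD(2)[OF D], unfolded AC_bimod_rules]) simp_all
  also have "r (pAC \<one>\<^bsub>A\<^esub> (ainv C c)) a = \<Psi> (pCA c a)"
    using ac by (simp only: coring_psi_pure)
  also have "r (\<Psi> (pCA c a)) (aut A a') = sw R A C AC (\<lambda>b d. r (pAC b d) (aut A a')) (\<Psi> (pCA c a))"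
    using ac by (intro psi_expand) simp_all
  also have "\<dots> = sw R A C AC (\<lambda>b d. sw R A C AC (\<lambda>b' d'. pAC (b \<otimes>\<^bsub>A\<^esub> b') (aut C d')) (\<Psi> (pCA d a'))) (\<Psi> (pCA c a))"
    using ac by simp
  finally show "\<Psi> (pCA (aut C c) (a \<otimes>\<^bsub>A\<^esub> a')) = \<dots>" .
next
  fix a c assume ac: "a \<in> carrier A" "c \<in> carrier C"
  have er: "ccounit E (r x a) = ccounit E x \<otimes>\<^bsub>A\<^esub> a" if "x \<in> carrier AC" for x
  proof -
    have "right_linear R A E (regular_bimod A) (ccounit E)"
      using coring unfolding hom_coring_def Let_def bilinear_def by blast
    thus ?thesis using that ac by (simp add: right_linear_def regular_bimod_def hmod.defs)
  qed
  let ?x = "sw R A C A (\<lambda>b d. counit C d \<odot>\<^bsub>A\<^esub> b) (\<Psi> (pCA c a))"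
  have x: "?x \<in> carrier A" using ac by simp
  have "aut A ?x = ccounit E (\<Psi> (pCA c a))"
    using ac by (simp add: ccounit_sw)
  also have "\<dots> = ccounit E (pAC \<one>\<^bsub>A\<^esub> (ainv C c)) \<otimes>\<^bsub>A\<^esub> a"
    using ac by (simp only: coring_psi_pure, intro er) simp_all
  also have "\<dots> = aut A (counit C c \<odot>\<^bsub>A\<^esub> a)"
    using ac by simp
  finally have e: "aut A ?x = aut A (counit C c \<odot>\<^bsub>A\<^esub> a)" .
  have y: "counit C c \<odot>\<^bsub>A\<^esub> a \<in> carrier A"
    using ac by (intro smult_closed[of R]) simp_all
  show "?x = counit C c \<odot>\<^bsub>A\<^esub> a"
    using e unfolding aut_inj[OF hom_algebraD(1)[OF A] x y] .
next
  fix a c assume ac: "a \<in> carrier A" "c \<in> carrier C"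
  let ?CC = "tensor_module R C C"
  let ?T = "tensor_module R A ?CC"
  have "right_linear R A E DD (ccomult E)"
    using coring unfolding hom_coring_def Let_def bilinear_def by simp
  hence "right_linear R A D (tensorA R A D D) (ccomult E)"
    unfolding right_linear_AC_coring by (simp add: right_linear_def hom_morphism_def)
  hence "DC.compatible (AC_coaction R A C)"
    using DC.right_linear_sigma[where \<rho> = "AC_coaction R A C" and \<sigma> = "ccomult E"]
    by (simp add: ccomult_theta)
  hence "AC_coaction R A C (r (pAC \<one>\<^bsub>A\<^esub> (ainv C c)) a) = sw R AC C DC (\<lambda>m c.
      sw R A C DC (\<lambda>b d. pDC (r m b) (aut C d)) (\<Psi> (pCA c (ainv A a))))
      (AC_coaction R A C (pAC \<one>\<^bsub>A\<^esub> (ainv C c)))" (is "?u = ?v")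
    unfolding DC.compatible_def AC_bimod_rules using ac by (simp del: r_pure_raw coact_pure)
  \<comment> \<open>\<open>h\<close> identifies \<open>(A \<otimes> C) \<otimes> C\<close> with \<open>A \<otimes> (C \<otimes> C)\<close> and removes the \<open>\<gamma>\<close> that the coaction applies to the last factor.\<close>
  moreover define h where "h = sw R AC C ?T (\<lambda>x d. sw R A C ?T
    (\<lambda>b e. pure R A ?CC b (pure R C C e (ainv C d))) x)"
  have lh: "lin_map R DC ?T h" unfolding h_def by simp
  ultimately have "h ?u = h ?v" by simp
  hence "h (AC_coaction R A C (\<Psi> (pCA c a))) = h ?v"
    using ac by (simp only: coring_psi_pure)
  moreover have "pure R A ?CC x (comult C d) =
      sw R C C ?T (\<lambda>c1 c2. pure R A ?CC x (pure R C C c1 c2)) (comult C d)"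
    if "x \<in> carrier A" "d \<in> carrier C" for x d
    using pure_sw2[where P = ?CC and K = A and f = "pure R C C" and M = C and N = C and t = "comult C d" and R = R and y = x]
      that by (simp add: sw_pure_id)
  ultimately show "sw R A C ?T (\<lambda>b d. pure R A ?CC (ainv A b) (comult C d)) (\<Psi> (pCA c a)) =
      sw R C C ?T (\<lambda>c1 c2. sw R A C ?T (\<lambda>b d. sw R A C ?T
        (\<lambda>b' d'. pure R A ?CC b' (pure R C C d' d)) (\<Psi> (pCA c1 b))) (\<Psi> (pCA c2 (ainv A a)))) (comult C c)"
    unfolding h_def AC_coaction_def using ac by (simp add: comult_ainv[OF C])
qed

end

section \<open>The isomorphism of categories\<close>

text \<open>
  If a bijection on objects identifies the sets of morphisms literally, \<open>L\<close> inherits the category axioms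
  from \<open>K\<close>, and the identity on morphisms completes the bijection to a functor.
\<close>

lemma isomorphic_categoriesI:
  assumes K: "is_category K"
    and F: "F \<in> Obj K \<rightarrow> Obj L" and G: "G \<in> Obj L \<rightarrow> Obj K"
    and GF: "\<And>X. X \<in> Obj K \<Longrightarrow> G (F X) = X" and FG: "\<And>X. X \<in> Obj L \<Longrightarrow> F (G X) = X"
    and Hom: "\<And>X Y. X \<in> Obj K \<Longrightarrow> Y \<in> Obj K \<Longrightarrow> Hom L (F X) (F Y) = Hom K X Y"
    and Idn: "\<And>X. X \<in> Obj K \<Longrightarrow> Idn L (F X) = Idn K X"
    and Cmp: "\<And>X Y Z. X \<in> Obj K \<Longrightarrow> Y \<in> Obj K \<Longrightarrow> Z \<in> Obj K \<Longrightarrow>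
      Cmp L (F X) (F Y) (F Z) = Cmp K X Y Z"
  shows "isomorphic_categories K L"
proof -
  have L: "Obj L = F ` Obj K"
    using F G FG by (auto intro!: image_eqI[where x = "G _"])
  have catL: "is_category L"
    using K unfolding is_category_def L by (simp add: Hom Idn Cmp)
  have "is_functor K L F (\<lambda>X Y f. f)"
    using F by (simp add: is_functor_def Hom Idn Cmp)
  moreover have "is_functor L K G (\<lambda>X Y f. f)"
    unfolding is_functor_def L using G by (simp add: Hom Idn Cmp GF Pi_iff)
  ultimately show ?thesis
    unfolding isomorphic_categories_def using K catL GF FG by fastforce
qed

lemma right_linear_comp:
  assumes "right_linear R A M N f" "right_linear R A N P g" "module R M"
    "\<And>m a. m \<in> carrier M \<Longrightarrow> a \<in> carrier A \<Longrightarrow> ract M m a \<in> carrier M"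
    "\<And>m. m \<in> carrier M \<Longrightarrow> aut M m \<in> carrier M"
  shows "right_linear R A M P (compose (carrier M) g f)"
proof -
  have f: "lin_map R M N f" and g: "lin_map R N P g"
    using assms by (simp_all add: right_linear_def hom_morphism_def)
  note [simp] = lin_map_closed[OF f]
  have "lin_map R M P (compose (carrier M) g f)"
    by (rule lin_map_cong[OF assms(3) _ lin_map_comp[OF g f]]) (simp add: compose_eq)
  thus ?thesis
    using assms by (simp add: right_linear_def hom_morphism_def compose_eq)
qed

lemma colinear_sw:
  assumes C: "hom_coalgebra R C" and M: "hom_comodule R C M \<rho>"
  shows "colinear R C M \<rho> N \<tau> f \<longleftrightarrow> hom_morphism R M N f \<and>
     (\<forall>m \<in> carrier M. \<tau> (f m) = sw R M C (tensor_module R N C) (\<lambda>m0 m1. pure R N C (f m0) m1) (\<rho> m))"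
proof -
  note [simp] = hom_object_rules[OF hom_comoduleD(1)[OF C M]] hom_coalgebra_basic[OF C] coaction_closed[OF C M]
  show ?thesis
    by (simp add: colinear_def tlift_eq_sw[where M = M and N = C] tensor_record_rules)
qed

lemma colinear_comp:
  assumes C: "hom_coalgebra R C" and M: "hom_comodule R C M \<rho>" and N: "hom_comodule R C N \<tau>"
    and P: "hom_comodule R C P \<upsilon>"
    and f: "colinear R C M \<rho> N \<tau> f" and g: "colinear R C N \<tau> P \<upsilon> g"
  shows "colinear R C M \<rho> P \<upsilon> (compose (carrier M) g f)"
proof -
  note [simp] = hom_object_rules[OF hom_comoduleD(1)[OF C M]] hom_object_rules[OF hom_comoduleD(1)[OF C N]]
    hom_object_rules[OF hom_comoduleD(1)[OF C P]] hom_coalgebra_basic[OF C] sweedler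
    coaction_closed[OF C M] coaction_closed[OF C N]
  have lf: "lin_map R M N f" and lg: "lin_map R N P g"
    using f g by (simp_all add: colinear_def hom_morphism_def)
  note [simp] = lin_map_closed[OF lf] lin_map_closed[OF lg] lin_map_comp[OF lf] lin_map_comp[OF lg]
  have "lin_map R M P (compose (carrier M) g f)"
    by (rule lin_map_cong[OF _ _ lin_map_comp[OF lg lf]]) (simp_all add: compose_eq)
  thus ?thesis
    using f g unfolding colinear_sw[OF C M] colinear_sw[OF C N]
    by (simp add: hom_morphism_def compose_eq)
qed

lemma colinear_id:
  assumes C: "hom_coalgebra R C" and M: "hom_comodule R C M \<rho>"
  shows "colinear R C M \<rho> M \<rho> (restrict id (carrier M))"
proof -
  note [simp] = hom_object_rules[OF hom_comoduleD(1)[OF C M]] hom_coalgebra_basic[OF C] coaction_closed[OF C M]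
  have "lin_map R M M (restrict id (carrier M))"
    by (rule lin_map_cong[OF _ _ lin_map_id]) simp_all
  thus ?thesis
    unfolding colinear_sw[OF C M] by (simp add: hom_morphism_def sw_pure_id)
qed

lemma right_linear_id:
  assumes A: "hom_algebra R A" and M: "right_hom_module R A M"
  shows "right_linear R A M M (restrict id (carrier M))"
proof -
  note [simp] = right_hom_module_rules[OF A M]
  have "lin_map R M M (restrict id (carrier M))"
    by (rule lin_map_cong[OF _ _ lin_map_id]) simp_all
  thus ?thesis by (simp add: right_linear_def hom_morphism_def)
qed

context entwined_bimodule
begin

lemma module_locale: "right_hom_module R A M \<Longrightarrow> twisted_coring_module R A C \<psi> r M"
  by (intro twisted_coring_module.intro twisted_coring_axioms twisted_coring_module_axioms.intro)

lemma entwined_module_iff: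
  fixes M :: "('k, 'm, 'a, 'v) rmod_scheme"
  assumes M: "right_hom_module R A M"
  shows "entwined_module R A C \<psi> M \<rho> \<longleftrightarrow>
    hom_comodule R C M \<rho> \<and> twisted_coring_module.compatible R A C \<psi> M \<rho>"
proof (cases "hom_comodule R C M \<rho>")
  case True
  interpret M: twisted_coring_module R A C \<psi> r M by (rule module_locale[OF M])
  note [simp] = coaction_closed[OF C True]
  have "tlift R (tensor R M C) (\<lambda>m0 m1. tlift R (tensor R M C) (\<lambda>b d. pure R M C (ract M m0 b) (aut C d))
      (\<psi> (pure R C A m1 (ainv A a)))) (\<rho> m) = sw R M C M.MC (\<lambda>m c. sw R A C M.MC
      (\<lambda>b d. pure R M C (ract M m b) (aut C d)) (\<psi> (pCA c (ainv A a)))) (\<rho> m)"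
    if "m \<in> carrier M" "a \<in> carrier A" for m a
    using that by (simp add: tlift_eq_sw[where M = M and N = C] tlift_eq_sw[where M = A and N = C])
  thus ?thesis using True M by (simp add: entwined_module_def M.compatible_def)
next
  case False
  thus ?thesis by (simp add: entwined_module_def)
qed

lemma coring_comodule_of_entwined:
  assumes "entwined_module R A C \<psi> M \<rho>"
  shows "coring_comodule R A E M (restrict (\<lambda>m. theta R A C M D (\<rho> m)) (carrier M))"
proof -
  have M: "right_hom_module R A M" using assms by (simp add: entwined_module_def)
  interpret M: twisted_coring_module R A C \<psi> r M by (rule module_locale[OF M])
  have e: "hom_comodule R C M \<rho>" "M.compatible \<rho>"
    using assms entwined_module_iff[OF M] by blast+
  show ?thesis
    using e by (subst M.coring_comodule_iff[OF hom_comoduleD(2)[OF C e(1)]]) simp_all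
qed

lemma entwined_of_coring_comodule:
  assumes "coring_comodule R A E M \<sigma>"
  shows "entwined_module R A C \<psi> M (restrict (\<lambda>m. theta_inv R A C M D (\<sigma> m)) (carrier M))"
    and "lin_map R M (tensorA_module R A M D) \<sigma>"
proof -
  have M: "right_hom_module R A M" using assms by (simp add: coring_comodule_def Let_def)
  interpret M: twisted_coring_module R A C \<psi> r M by (rule module_locale[OF M])
  show s: "lin_map R M (tensorA_module R A M D) \<sigma>"
    using assms by (simp add: coring_comodule_def Let_def right_linear_def hom_morphism_def)
  let ?\<rho> = "restrict (\<lambda>m. theta_inv R A C M D (\<sigma> m)) (carrier M)"
  have r: "lin_map R M M.MC ?\<rho>"
    by (rule lin_map_cong[OF _ _ lin_map_comp[OF M.lin_map_theta_inv s]]) simp_all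
  have "\<sigma> m = theta R A C M D (?\<rho> m)" if "m \<in> carrier M" for m
    using that lin_map_closed[OF s that] by simp
  from M.coring_comodule_iff[OF r this] show "entwined_module R A C \<psi> M ?\<rho>"
    using assms entwined_module_iff[OF M] by blast
qed

text \<open>
  For a right linear map \<open>f\<close>, naturality of \<^const>\<open>theta\<close> turns the colinearity condition over the coring
  into the image under \<^const>\<open>theta\<close> of the one over \<open>C\<close>.
\<close>

lemma morphism_iff:
  assumes M: "right_hom_module R A M" and N: "right_hom_module R A N"
    and \<rho>: "lin_map R M (tensor_module R M C) \<rho>" and \<tau>: "lin_map R N (tensor_module R N C) \<tau>"
  shows "coring_comodule_morphism R A E
      M (restrict (\<lambda>m. theta R A C M D (\<rho> m)) (carrier M))
      N (restrict (\<lambda>m. theta R A C N D (\<tau> m)) (carrier N)) f \<longleftrightarrow>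
    right_linear R A M N f \<and> colinear R C M \<rho> N \<tau> f"
proof (cases "right_linear R A M N f")
  case True
  interpret M: twisted_coring_module R A C \<psi> r M by (rule module_locale[OF M])
  interpret N: twisted_coring_module R A C \<psi> r N by (rule module_locale[OF N])
  have f: "lin_map R M N f" "\<And>m. m \<in> carrier M \<Longrightarrow> f (aut M m) = aut N (f m)"
    "\<And>m a. m \<in> carrier M \<Longrightarrow> a \<in> carrier A \<Longrightarrow> f (ract M m a) = ract N (f m) a"
    using True by (simp_all add: right_linear_def hom_morphism_def)
  note [simp] = f lin_map_closed[OF f(1)] lin_map_comp[OF f(1)] lin_map_closed[OF \<rho>] lin_map_closed[OF \<tau>]
  let ?ND = "tensorA_module R A N D"
  have b: "balanced A M D (\<lambda>m0 m1. pureA R A N D (f m0) m1)"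
    by (rule balancedI) simp
  have "tliftA R ?ND (\<lambda>m0 m1. pureA R A N D (f m0) m1) (theta R A C M D (\<rho> m)) =
      theta R A C N D (sw R M C N.MC (\<lambda>m0 m1. pure R N C (f m0) m1) (\<rho> m))" if m: "m \<in> carrier M" for m
  proof -
    have "tliftA R ?ND (\<lambda>m0 m1. pureA R A N D (f m0) m1) (theta R A C M D (\<rho> m)) =
        swA R A M D ?ND (\<lambda>m0 m1. pureA R A N D (f m0) m1) (theta R A C M D (\<rho> m))"
      using m by (intro tliftA_eq_swA M.MD.balance_data) simp
    also have "\<dots> = sw R M C ?ND (\<lambda>m c. pureA R A N D (f m) (pAC \<one>\<^bsub>A\<^esub> (ainv C c))) (\<rho> m)"
      using m b by (intro M.swA_theta) simp_all
    also have "\<dots> = theta R A C N D (sw R M C N.MC (\<lambda>m0 m1. pure R N C (f m0) m1) (\<rho> m))"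
      using m by simp
    finally show ?thesis .
  qed
  moreover have "theta R A C N D (\<tau> (f m)) = theta R A C N D (sw R M C N.MC (\<lambda>m0 m1. pure R N C (f m0) m1) (\<rho> m))
      \<longleftrightarrow> \<tau> (f m) = sw R M C N.MC (\<lambda>m0 m1. pure R N C (f m0) m1) (\<rho> m)" if m: "m \<in> carrier M" for m
    using m by (intro N.theta_inj) simp_all
  moreover have "tlift R (tensor R N C) (\<lambda>m0 m1. pure R N C (f m0) m1) (\<rho> m) =
      sw R M C N.MC (\<lambda>m0 m1. pure R N C (f m0) m1) (\<rho> m)" if m: "m \<in> carrier M" for m
    using m by (simp add: tlift_eq_sw[where M = M and N = C])
  ultimately show ?thesis
    using True by (simp add: coring_comodule_morphism_def colinear_def right_linear_def)
next
  case False
  thus ?thesis by (simp add: coring_comodule_morphism_def)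
qed

lemma is_category_entwined:
  "is_category (entwined_category R A C \<psi> ::
    (('k, 'm, 'a) rmod \<times> ('m \<Rightarrow> ('k, 'm, 'c) tens), 'm \<Rightarrow> 'm) cat)" (is "is_category ?K")
proof -
  have obj: "right_hom_module R A M" "hom_comodule R C M \<rho>" if "(M, \<rho>) \<in> Obj ?K"
    for M :: "('k, 'm, 'a) rmod" and \<rho>
    using that by (simp_all add: entwined_category_def entwined_module_def)
  have hom: "f \<in> Hom ?K (M, \<rho>) (N, \<tau>) \<longleftrightarrow>
      f \<in> extensional (carrier M) \<and> right_linear R A M N f \<and> colinear R C M \<rho> N \<tau> f" for M \<rho> N \<tau> f
    by (simp add: entwined_category_def)
  have fc: "f \<in> carrier M \<rightarrow> carrier N" if "f \<in> Hom ?K (M, \<rho>) (N, \<tau>)" for M \<rho> N \<tau> f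
    using that lin_map_closed by (fastforce simp: hom right_linear_def hom_morphism_def)
  have ops: "Idn ?K (M, \<rho>) = restrict id (carrier M)" "Cmp ?K (M, \<rho>) Y Z g f = compose (carrier M) g f"
    for M \<rho> Y Z f g
    by (simp_all add: entwined_category_def)
  show ?thesis
    unfolding is_category_def
  proof (intro conjI ballI)
    fix X assume "X \<in> Obj ?K"
    thus "Idn ?K X \<in> Hom ?K X X"
      using obj by (cases X) (auto simp: ops hom right_linear_id[OF A] colinear_id[OF C])
  next
    fix X Y Z f g assume XYZ: "X \<in> Obj ?K" "Y \<in> Obj ?K" "Z \<in> Obj ?K"
      and fg: "f \<in> Hom ?K X Y" "g \<in> Hom ?K Y Z"
    obtain M \<rho> N \<tau> P \<upsilon> where e: "X = (M, \<rho>)" "Y = (N, \<tau>)" "Z = (P, \<upsilon>)"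
      by (cases X, cases Y, cases Z) auto
    note o = obj[OF XYZ(1)[unfolded e]] obj[OF XYZ(2)[unfolded e]] obj[OF XYZ(3)[unfolded e]]
    show "Cmp ?K X Y Z g f \<in> Hom ?K X Z"
      using fg unfolding e ops hom
      by (auto intro!: colinear_comp[OF C o(2,4,6)] right_linear_comp
          simp: right_hom_module_rules[OF A o(1)])
  next
    fix X Y f assume XY: "X \<in> Obj ?K" "Y \<in> Obj ?K" and f: "f \<in> Hom ?K X Y"
    obtain M \<rho> N \<tau> where e: "X = (M, \<rho>)" "Y = (N, \<tau>)" by (cases X, cases Y) auto
    note c = fc[OF f[unfolded e]]
    have x: "f \<in> extensional (carrier M)" using f by (simp add: e hom)
    show "Cmp ?K X X Y f (Idn ?K X) = f"
      unfolding e ops by (rule extensionalityI[OF compose_extensional x]) (simp add: compose_eq)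
    show "Cmp ?K X Y Y (Idn ?K Y) f = f"
      unfolding e ops using c by (intro extensionalityI[OF compose_extensional x]) (auto simp: compose_eq)
  next
    fix W X Y Z f g h assume f: "f \<in> Hom ?K W X" and g: "g \<in> Hom ?K X Y" and h: "h \<in> Hom ?K Y Z"
    obtain M \<rho> N \<tau> P \<upsilon> Q \<omega> where e: "W = (M, \<rho>)" "X = (N, \<tau>)" "Y = (P, \<upsilon>)" "Z = (Q, \<omega>)"
      by (cases W, cases X, cases Y, cases Z) auto
    have "f \<in> carrier M \<rightarrow> carrier N" using f unfolding e by (rule fc)
    thus "Cmp ?K W X Z (Cmp ?K X Y Z h g) f = Cmp ?K W Y Z h (Cmp ?K W X Y g f)"
      unfolding e ops by (simp add: compose_assoc)
  qed
qed

theorem entwined_category_iso: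
  "isomorphic_categories
    (entwined_category R A C \<psi> :: (('k, 'm, 'a) rmod \<times> ('m \<Rightarrow> ('k, 'm, 'c) tens), 'm \<Rightarrow> 'm) cat)
    (coring_comodule_category R A E ::
      (('k, 'm, 'a) rmod \<times> ('m \<Rightarrow> ('k, 'm, ('k, 'a, 'c) tens) tensA), 'm \<Rightarrow> 'm) cat)"
  (is "isomorphic_categories ?K ?L")
proof (rule isomorphic_categoriesI[where
    F = "\<lambda>(M, \<rho>). (M, restrict (\<lambda>m. theta R A C M D (\<rho> m)) (carrier M))" and
    G = "\<lambda>(M, \<sigma>). (M, restrict (\<lambda>m. theta_inv R A C M D (\<sigma> m)) (carrier M))"])
  let ?F = "\<lambda>(M :: ('k, 'm, 'a) rmod, \<rho>). (M, restrict (\<lambda>m. theta R A C M D (\<rho> m)) (carrier M))"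
  let ?G = "\<lambda>(M :: ('k, 'm, 'a) rmod, \<sigma>). (M, restrict (\<lambda>m. theta_inv R A C M D (\<sigma> m)) (carrier M))"
  show "is_category ?K" by (rule is_category_entwined)
  show "?F \<in> Obj ?K \<rightarrow> Obj ?L"
    by (auto simp: entwined_category_def coring_comodule_category_def coring_comodule_of_entwined)
  show "?G \<in> Obj ?L \<rightarrow> Obj ?K"
    by (auto simp: entwined_category_def coring_comodule_category_def entwined_of_coring_comodule)
  have obj: "right_hom_module R A M" "lin_map R M (tensor_module R M C) \<rho>" "\<rho> \<in> extensional (carrier M)"
    if "(M, \<rho>) \<in> Obj ?K" for M :: "('k, 'm, 'a) rmod" and \<rho>
    using that hom_comoduleD(2)[OF C] by (auto simp: entwined_category_def entwined_module_def)
  show "?G (?F X) = X" if X: "X \<in> Obj ?K" for X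
  proof -
    obtain M \<rho> where e: "X = (M, \<rho>)" by (cases X)
    note o = obj[OF X[unfolded e]]
    interpret M: twisted_coring_module R A C \<psi> r M by (rule module_locale[OF o(1)])
    have "(\<lambda>m\<in>carrier M. theta_inv R A C M D ((\<lambda>m\<in>carrier M. theta R A C M D (\<rho> m)) m)) = \<rho>"
      by (rule extensionalityI[OF restrict_extensional o(3)]) (simp add: lin_map_closed[OF o(2)])
    thus ?thesis by (simp add: e)
  qed
  show "?F (?G X) = X" if X: "X \<in> Obj ?L" for X
  proof -
    obtain M \<sigma> where e: "X = (M, \<sigma>)" by (cases X)
    have c: "coring_comodule R A E M \<sigma>" and x: "\<sigma> \<in> extensional (carrier M)"
      using X by (simp_all add: e coring_comodule_category_def)
    have M: "right_hom_module R A M" using c by (simp add: coring_comodule_def Let_def)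
    interpret M: twisted_coring_module R A C \<psi> r M by (rule module_locale[OF M])
    have "(\<lambda>m\<in>carrier M. theta R A C M D ((\<lambda>m\<in>carrier M. theta_inv R A C M D (\<sigma> m)) m)) = \<sigma>"
      by (rule extensionalityI[OF restrict_extensional x])
        (simp add: lin_map_closed[OF entwined_of_coring_comodule(2)[OF c]])
    thus ?thesis by (simp add: e)
  qed
  show "Hom ?L (?F X) (?F Y) = Hom ?K X Y" if X: "X \<in> Obj ?K" and Y: "Y \<in> Obj ?K" for X Y
  proof -
    obtain M \<rho> N \<tau> where e: "X = (M, \<rho>)" "Y = (N, \<tau>)" by (cases X, cases Y) auto
    note o = obj[OF X[unfolded e]] obj[OF Y[unfolded e]]
    show ?thesis
      using morphism_iff[OF o(1,4,2,5)] by (simp add: e entwined_category_def coring_comodule_category_def)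
  qed
  show "Idn ?L (?F X) = Idn ?K X" for X
    by (cases X) (simp add: entwined_category_def coring_comodule_category_def)
  show "Cmp ?L (?F X) (?F Y) (?F Z) = Cmp ?K X Y Z" for X Y Z
    by (cases X) (simp add: entwined_category_def coring_comodule_category_def)
qed

end

section \<open>Hom-entwining structures and Hom-corings on \<open>A \<otimes> C\<close>\<close>

lemma entwined_bimodule_of_entwining:
  assumes "hom_entwining R A C \<psi>"
  shows "entwined_bimodule R A C \<psi> (entwining_ract R A C \<psi>)"
proof -
  have *: "hom_algebra R A" "hom_coalgebra R C" "hom_morphism R (tensor R C A) (tensor R A C) \<psi>"
    using assms by (simp_all add: hom_entwining_def)
  show ?thesis
    by (intro entwined_bimodule.intro twisted_bimodule.intro algebra_coalgebra.intro
        twisted_bimodule_axioms.intro entwined_bimodule_axioms.intro *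
        bilin_map_entwining_ract[OF *] assms)
qed

context entwined_bimodule
begin

lemma structure_formulas:
  assumes "a \<in> carrier A" "a' \<in> carrier A" "c \<in> carrier C"
  shows "lact D a (pAC a' c) = pAC (ainv A a \<otimes>\<^bsub>A\<^esub> a') (aut C c)"
    and "ract D (pAC a' c) a =
      tlift R (tensor R A C) (\<lambda>b d. pAC (a' \<otimes>\<^bsub>A\<^esub> b) (aut C d)) (\<psi> (pCA c (ainv A a)))"
    and "ccomult E (pAC a c) = tlift R DD (\<lambda>c1 c2. pDD (pAC (ainv A a) c1) (pAC \<one>\<^bsub>A\<^esub> c2)) (comult C c)"
    and "ccounit E (pAC a c) = counit C c \<odot>\<^bsub>A\<^esub> aut A a"
  using assms by (simp_all add: tlift_eq_sw[where M = A and N = C] tlift_eq_sw[where M = C and N = C])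

end

theorem theorem3p8:
  fixes R :: "('k, 'r) ring_scheme"
    and A :: "('k, 'a) hmod"
    and C :: "('k, 'c) coalg"
  assumes "hom_algebra R A" and "hom_coalgebra R C"
  shows
    "(\<forall>\<psi>. hom_entwining R A C \<psi> \<longrightarrow>
        (let r = entwining_ract R A C \<psi>; D = AC_coring R A C r in
          (\<forall>a \<in> carrier A. \<forall>a' \<in> carrier A. \<forall>c \<in> carrier C.
             lact (AC_bimod R A C r) a (pure R A C a' c) =
               pure R A C (ainv A a \<otimes>\<^bsub>A\<^esub> a') (aut C c) \<and>
             ract (AC_bimod R A C r) (pure R A C a' c) a =
               tlift R (tensor R A C) (\<lambda>b d. pure R A C (a' \<otimes>\<^bsub>A\<^esub> b) (aut C d))
                 (\<psi> (pure R C A c (ainv A a)))) \<and>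
          hom_bimodule R A (AC_bimod R A C r) \<and>
          (\<forall>a \<in> carrier A. \<forall>c \<in> carrier C.
             ccomult D (pure R A C a c) =
               tlift R (tensorAA R A (AC_bimod R A C r) (AC_bimod R A C r))
                 (\<lambda>c1 c2. pureA R A (AC_bimod R A C r) (AC_bimod R A C r)
                    (pure R A C (ainv A a) c1) (pure R A C \<one>\<^bsub>A\<^esub> c2)) (comult C c) \<and>
             ccounit D (pure R A C a c) = counit C c \<odot>\<^bsub>A\<^esub> aut A a) \<and>
          hom_coring R A D))
   \<and> (\<forall>r. hom_coring R A (AC_coring R A C r) \<longrightarrow>
        (\<forall>c \<in> carrier C. \<forall>a \<in> carrier A.
           coring_psi R A C r (pure R C A c a) = r (pure R A C \<one>\<^bsub>A\<^esub> (ainv C c)) a) \<and>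
        hom_entwining R A C (coring_psi R A C r))
   \<and> (\<forall>\<psi>. hom_entwining R A C \<psi> \<longrightarrow>
        isomorphic_categories
          (entwined_category R A C \<psi> ::
            (('k, 'm, 'a) rmod \<times> ('m \<Rightarrow> ('k, 'm, 'c) tens), 'm \<Rightarrow> 'm) cat)
          (coring_comodule_category R A (AC_coring R A C (entwining_ract R A C \<psi>)) ::
            (('k, 'm, 'a) rmod \<times> ('m \<Rightarrow> ('k, 'm, ('k, 'a, 'c) tens) tensA), 'm \<Rightarrow> 'm) cat))"
proof (intro conjI allI impI, goal_cases)
  case (1 \<psi>)
  then interpret entwined_bimodule R A C \<psi> "entwining_ract R A C \<psi>"
    by (rule entwined_bimodule_of_entwining)
  show ?case
    unfolding Let_def
    by (intro conjI ballI structure_formulas hom_bimodule_D hom_coring_E)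
next
  case (2 r)
  then interpret coring_structure R A C r
    by (intro coring_structure.intro algebra_coalgebra.intro coring_structure_axioms.intro assms)
  show ?case by (intro ballI coring_psi_pure)
next
  case (3 r)
  then interpret coring_structure R A C r
    by (intro coring_structure.intro algebra_coalgebra.intro coring_structure_axioms.intro assms)
  show ?case by (rule hom_entwining_coring_psi)
next
  case (4 \<psi>)
  then interpret entwined_bimodule R A C \<psi> "entwining_ract R A C \<psi>"
    by (rule entwined_bimodule_of_entwining)
  show ?case by (rule entwined_category_iso)
qed

end
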